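(* Let $\lambda\ge0$, let $I\subset\mathcal{V}$ and let $E(I)=\operatorname{int}\big(\bigcup_{i\in I}\overline{T_i}\big)\in\mathcal{S}_{\mathcal{T}}(\Omega)$ be the corresponding union of simplices. If the pair $I\cup\{t\}$, $I^c\cup\{s\}$ is a minimal $(s,t)$-cut of the $(s,t)$-graph associated with $\mathcal{T}$, $p_k$ and $\lambda$, then $$E(I)\in\operatorname*{argmin}_{E\in\mathcal{S}_{\mathcal{T}}(\Omega)}\ \mathrm{Per}(E,\Omega)-\lambda\int_Ep_k\,dx.$$
   Context: $\Omega\subset\mathbb{R}^d$ is a bounded polyhedral domain with strongly Lipschitz boundary and $\mathcal{T}=\{T_1,\dots,T_n\}$ is a triangulation of it: pairwise disjoint open simplices with $\overline\Omega=\bigcup_i\overline{T_i}$. $\mathcal{S}_{\mathcal{T}}(\Omega)$ is the class of open sets that are interiors of unions of closures of simplices of $\mathcal{T}$; $\mathrm{Per}(E,\Omega)$ is the perimeter of $E$ in $\Omega$. $p_k$ is a function constant on each simplex of $\mathcal{T}$ with $\int_\Omega p_k\,dx=0$ (the dual variable of an iterate of a conditional gradient method), with value $p_k(T_i)$ on $T_i$. The $(s,t)$-graph: node set $\mathcal{V}=\{1,\dots,n\}$, one node per simplex, with edge weights $w_{i,j}=\mathcal{H}^{d-1}(\partial T_i\cap\partial T_j)$, together with two additional nodes $s$ (source) and $t$ (sink), directed edges $(s,i)$ and $(i,t)$ for every $i\in\mathcal{V}$, with weights $w_{s,i}=\max\{0,-\lambda p_k(T_i)\mathcal{L}^d(T_i)\}$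 and $w_{i,t}=\max\{0,\lambda p_k(T_i)\mathcal{L}^d(T_i)\}$. For $I\subset\mathcal{V}$ and $I^c=\mathcal{V}\setminus I$, the associated $(s,t)$-cut is the partition of the nodes into $I\cup\{t\}$ and $I^c\cup\{s\}$, with cut value $$\Theta_I=\sum_{i\notin I}\sum_{j\in I}w_{i,j}+\sum_{i\in I}w_{s,i}+\sum_{i\notin I}w_{i,t}.$$ A minimal cut is an $(s,t)$-cut minimizing $\Theta_I$ over all $I\subset\mathcal{V}$. *)

theory Defs
  imports "HOL-Analysis.Analysis"
begin

section \<open>Hausdorff measure\<close>

text \<open>
  The empty set is treated separately because \<open>0 ^ 0 = 1\<close>. The covering sets are required to be
  bounded because the library's \<^const>\<open>diameter\<close> is a real number and has no meaningful value on
  unbounded sets. The factor \<^term>\<open>unit_ball_vol (real m)\<close> normalises the measure so that it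
  agrees with Lebesgue measure on \<open>m\<close>-dimensional planes.
\<close>

definition hausdorff_gauge :: "nat \<Rightarrow> 'a::euclidean_space set \<Rightarrow> real" where
  "hausdorff_gauge m C =
     (if C = {} then 0 else unit_ball_vol (real m) * (diameter C / 2) ^ m)"

definition hausdorff_content :: "nat \<Rightarrow> real \<Rightarrow> 'a::euclidean_space set \<Rightarrow> ennreal" where
  "hausdorff_content m \<delta> A =
     (INF C \<in> {C :: nat \<Rightarrow> 'a set.
         (\<forall>k. bounded (C k) \<and> diameter (C k) \<le> \<delta>) \<and> A \<subseteq> (\<Union>k. C k)}.
       \<Sum>k. ennreal (hausdorff_gauge m (C k)))"

definition hausdorff_measure :: "nat \<Rightarrow> 'a::euclidean_space set \<Rightarrow> ennreal" where
  "hausdorff_measure m A = (SUP \<delta> \<in> {0<..}. hausdorff_content m \<delta> A)"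


section \<open>Perimeter\<close>

definition divergence :: "('a::euclidean_space \<Rightarrow> 'a) \<Rightarrow> 'a \<Rightarrow> real" where
  "divergence \<phi> x = (\<Sum>b\<in>Basis. frechet_derivative \<phi> (at x) b \<bullet> b)"

definition C1_compact_support :: "'a::euclidean_space set \<Rightarrow> ('a \<Rightarrow> 'a) set" where
  "C1_compact_support \<Omega> = {\<phi>.
     (\<exists>D :: 'a \<Rightarrow> 'a \<Rightarrow>\<^sub>L 'a. continuous_on UNIV D \<and>
        (\<forall>x. (\<phi> has_derivative blinfun_apply (D x)) (at x))) \<and>
     compact (closure {x. \<phi> x \<noteq> 0}) \<and> closure {x. \<phi> x \<noteq> 0} \<subseteq> \<Omega>}"

definition perimeter :: "'a::euclidean_space set \<Rightarrow> 'a set \<Rightarrow> ereal" where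
  "perimeter E \<Omega> =
     (SUP \<phi> \<in> {\<phi> \<in> C1_compact_support \<Omega>. \<forall>x. norm (\<phi> x) \<le> 1}.
       ereal (LINT x:E|lebesgue. divergence \<phi> x))"


section \<open>Domains and triangulations\<close>

definition polyhedral_domain :: "'a::euclidean_space set \<Rightarrow> bool" where
  "polyhedral_domain \<Omega> \<longleftrightarrow>
     open \<Omega> \<and> connected \<Omega> \<and> \<Omega> \<noteq> {} \<and>
     (\<exists>\<F>. finite \<F> \<and> (\<forall>F\<in>\<F>. polytope F \<and> aff_dim F = int DIM('a) - 1) \<and>
          frontier \<Omega> = \<Union>\<F>)"

text \<open>
  Near each boundary point, \<open>\<Omega>\<close> is the strict epigraph, in some unit direction \<open>e\<close>, of a Lipschitz
  function \<open>g\<close> on the hyperplane orthogonal to \<open>e\<close>.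
\<close>

definition strongly_lipschitz_boundary :: "'a::euclidean_space set \<Rightarrow> bool" where
  "strongly_lipschitz_boundary \<Omega> \<longleftrightarrow>
     (\<forall>x \<in> frontier \<Omega>. \<exists>r > 0. \<exists>e L. \<exists>g :: 'a \<Rightarrow> real.
        norm e = 1 \<and> L-lipschitz_on {z. z \<bullet> e = 0} g \<and>
        \<Omega> \<inter> ball x r = {y \<in> ball x r. y \<bullet> e > g (y - (y \<bullet> e) *\<^sub>R e)})"

definition open_simplex :: "'a::euclidean_space set \<Rightarrow> bool" where
  "open_simplex T \<longleftrightarrow> (\<exists>S. int DIM('a) simplex S \<and> T = interior S)"

definition domain_triangulation :: "'a::euclidean_space set \<Rightarrow> nat \<Rightarrow> (nat \<Rightarrow> 'a set) \<Rightarrow> bool" where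
  "domain_triangulation \<Omega> n T \<longleftrightarrow>
     (\<forall>i\<in>{1..n}. open_simplex (T i)) \<and> disjoint_family_on T {1..n} \<and>
     closure \<Omega> = (\<Union>i\<in>{1..n}. closure (T i))"

definition simplex_union :: "(nat \<Rightarrow> 'a::euclidean_space set) \<Rightarrow> nat set \<Rightarrow> 'a set" where
  "simplex_union T I = interior (\<Union>i\<in>I. closure (T i))"

definition simplicial_sets :: "nat \<Rightarrow> (nat \<Rightarrow> 'a::euclidean_space set) \<Rightarrow> 'a set set" where
  "simplicial_sets n T = {simplex_union T I | I. I \<subseteq> {1..n}}"


section \<open>The (s,t)-graph and its cuts\<close>

datatype st_node = Source | Sink | Node nat

text \<open>
  Here \<open>c i\<close> is the value on \<open>T i\<close> of a function that is constant on each simplex. All weights are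
  nonnegative, and taking them in \<^typ>\<open>ennreal\<close> keeps the Hausdorff measure as it is.
  A weight of \<open>0\<close> stands for a missing edge.
\<close>

fun st_weight ::
  "(nat \<Rightarrow> 'a::euclidean_space set) \<Rightarrow> real \<Rightarrow> (nat \<Rightarrow> real) \<Rightarrow> st_node \<Rightarrow> st_node \<Rightarrow> ennreal"
where
  "st_weight T lam c (Node i) (Node j) =
     hausdorff_measure (DIM('a) - 1) (frontier (T i) \<inter> frontier (T j))"
| "st_weight T lam c Source (Node i) = ennreal (max 0 (- lam * c i * measure lebesgue (T i)))"
| "st_weight T lam c (Node i) Sink = ennreal (max 0 (lam * c i * measure lebesgue (T i)))"
| "st_weight T lam c _ _ = 0"

text \<open>
  The value of the cut with sides \<open>I \<union> {t}\<close> and \<open>({1..n} - I) \<union> {s}\<close>.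
\<close>

definition cut_value ::
  "nat \<Rightarrow> (nat \<Rightarrow> 'a::euclidean_space set) \<Rightarrow> real \<Rightarrow> (nat \<Rightarrow> real) \<Rightarrow> nat set \<Rightarrow> ennreal"
where
  "cut_value n T lam c I =
     (\<Sum>i\<in>{1..n} - I. \<Sum>j\<in>I. st_weight T lam c (Node i) (Node j))
     + (\<Sum>i\<in>I. st_weight T lam c Source (Node i))
     + (\<Sum>i\<in>{1..n} - I. st_weight T lam c (Node i) Sink)"

definition minimal_cut ::
  "nat \<Rightarrow> (nat \<Rightarrow> 'a::euclidean_space set) \<Rightarrow> real \<Rightarrow> (nat \<Rightarrow> real) \<Rightarrow> nat set \<Rightarrow> bool"
where
  "minimal_cut n T lam c I \<longleftrightarrow> is_arg_min (cut_value n T lam c) (\<lambda>J. J \<subseteq> {1..n}) I"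

end

theory Submission
  imports Defs
begin

text \<open>
  For a union \<open>E(I)\<close> of cells, \<open>Per(E(I), \<Omega>)\<close> is the sum of the areas of the interfaces
  \<open>K = closure T\<^sub>i \<inter> closure T\<^sub>j\<close> with \<open>i \<in> I\<close>, \<open>j \<notin> I\<close>; hence the cut value is the energy plus a
  constant and both have the same minimisers.

  The area on a hyperplane is measured by the Lebesgue measure of the slab of width one over the
  set. It agrees with the Hausdorff measure: one inequality is the isodiametric inequality (proved by
  Steiner symmetrisation), the other follows by packing open sets with balls.

  For the perimeter, \<open>\<integral>\<^sub>E div \<phi>\<close> is the limit of \<open>1/h \<integral> \<phi>\<^sub>b (1\<^sub>E(x - h b) - 1\<^sub>E(x)) dx\<close>, summed over the basis
  vectors \<open>b\<close>. The integrand splits over pairs of cells, and each pair contributes in the limit the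
  flux through its interface. So the triangulation need not be conforming, and no cancellation of
  face integrals is needed. This bounds the perimeter by the total area of the interfaces. Bump fields
  along the normals, supported near disjoint compact parts of the interfaces, show equality; here the
  Lipschitz boundary gives \<open>interior (closure \<Omega>) = \<Omega>\<close>, so almost all of each interface lies in \<open>\<Omega>\<close>.
\<close>

section \<open>Isodiametric inequality\<close>

text \<open>The gauge of a covering set depends on its diameter alone, so bounding the Hausdorff
  measure from below needs that balls maximise volume among sets of given diameter. Almost
  everywhere in \<Omega> the indicators of the cells sum to 1. Multiplying by these sums at
  \<open>x - h b\<close> and at \<open>x\<close> turns the jump of the indicator of E(I) into a sum
  over pairs of cells that is antisymmetric in the pair; the part with both cells in I cancels, and
  only pairs across the cut remain. Two disjoint open simplices are separated by some hyperplane,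
  and any choice will do: the interface lies in it, and an interface of lower dimension than the
  hyperplane has area 0. The constant between cut value and energy is the value of the cut for the
  empty set, because max(0, -x) = max(0, x) - x.\<close>

lemma emeasure_lborel_centered_interval:
  fixes L :: ennreal
  shows "emeasure lborel {t::real. ennreal (2 * \<bar>t\<bar>) < L} = L"
proof (cases L)
  case (real l)
  then have "{t::real. ennreal (2 * \<bar>t\<bar>) < L} = {-(l/2)<..<l/2}"
    by (auto simp: ennreal_less_iff)
  with real show ?thesis by simp
next
  case top
  then show ?thesis by simp
qed

text \<open>With \<open>a\<close> and \<open>b\<close> the infimum and supremum of \<open>F\<close>,
  the hypothesis forces \<open>G\<close> into \<open>{b - \<rho>..a + \<rho>}\<close>. The two
  lengths therefore add up to at most 2 \<rho>, and the half-lengths of the centred intervals to at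
  most \<rho>.\<close>

lemma centered_intervals_distance:
  fixes F G :: "real set"
  assumes "\<And>t u. t \<in> F \<Longrightarrow> u \<in> G \<Longrightarrow> \<bar>t - u\<bar> \<le> \<rho>"
    and "F \<in> sets borel" "G \<in> sets borel"
    and x: "ennreal (2 * \<bar>x\<bar>) < emeasure lborel F" and y: "ennreal (2 * \<bar>y\<bar>) < emeasure lborel G"
  shows "\<bar>x - y\<bar> \<le> \<rho>"
proof -
  have "F \<noteq> {}" "G \<noteq> {}" using x y by auto
  then obtain t0 u0 where 0: "t0 \<in> F" "u0 \<in> G" by auto
  have bF: "t \<in> {u0 - \<rho>..u0 + \<rho>}" if "t \<in> F" for t
    using assms(1)[OF that 0(2)] by auto
  then have bdd: "bdd_below F" "bdd_above F"
    by (meson atLeastAtMost_iff bdd_below.I, meson atLeastAtMost_iff bdd_above.I)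
  define a b where "a = Inf F" and "b = Sup F"
  have F: "F \<subseteq> {a..b}"
    using bdd by (auto simp: a_def b_def intro: cInf_lower cSup_upper)
  have G: "G \<subseteq> {b - \<rho>..a + \<rho>}"
  proof
    fix u assume u: "u \<in> G"
    have "b \<le> u + \<rho>" unfolding b_def
      by (rule cSup_least[OF \<open>F \<noteq> {}\<close>]) (use assms(1)[OF _ u] in \<open>force\<close>)
    moreover have "u - \<rho> \<le> a" unfolding a_def
      by (rule cInf_greatest[OF \<open>F \<noteq> {}\<close>]) (use assms(1)[OF _ u] in \<open>force\<close>)
    ultimately show "u \<in> {b - \<rho>..a + \<rho>}" by auto
  qed
  have "a \<le> b" "b - \<rho> \<le> a + \<rho>" using F G 0 by auto
  have "emeasure lborel F \<le> ennreal (b - a)"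
    using emeasure_mono[OF F, of lborel] \<open>a \<le> b\<close> by simp
  moreover have "emeasure lborel G \<le> ennreal ((a + \<rho>) - (b - \<rho>))"
    using emeasure_mono[OF G, of lborel] \<open>b - \<rho> \<le> a + \<rho>\<close> by simp
  ultimately have "2 * \<bar>x\<bar> < b - a" "2 * \<bar>y\<bar> < (a + \<rho>) - (b - \<rho>)"
    using x y by (meson ennreal_less_iff abs_ge_zero mult_nonneg_nonneg order_less_le_trans zero_le_numeral)+
  then show ?thesis by linarith
qed

text \<open>On every line parallel to axis \<open>j\<close> the section of \<open>A\<close> is
  replaced by the centred interval of equal length. Fubini keeps the volume,
  \<open>centered_intervals_distance\<close> on each pair of lines keeps the diameter bound, and a
  symmetry in a coordinate of \<open>S\<close> survives because reflected lines have sections of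
  equal length. \<open>D\<close> bounds the squared distance.\<close>

lemma steiner_symmetrization_step:
  fixes A :: "('i \<Rightarrow> real) set"
  assumes J: "finite J" "j \<in> J" and A: "A \<in> sets (PiM J (\<lambda>_. lborel))"
    and diam: "\<And>f g. f \<in> A \<Longrightarrow> g \<in> A \<Longrightarrow> (\<Sum>i\<in>J. (f i - g i)\<^sup>2) \<le> D"
    and sym: "\<And>k f. k \<in> S \<Longrightarrow> f \<in> A \<Longrightarrow> f(k := - f k) \<in> A"
    and S: "S \<subseteq> J"
  obtains B where "B \<in> sets (PiM J (\<lambda>_. lborel))"
    "emeasure (PiM J (\<lambda>_. lborel)) B = emeasure (PiM J (\<lambda>_. lborel)) A"
    "\<And>f g. f \<in> B \<Longrightarrow> g \<in> B \<Longrightarrow> (\<Sum>i\<in>J. (f i - g i)\<^sup>2) \<le> D"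
    "\<And>k f. k \<in> insert j S \<Longrightarrow> f \<in> B \<Longrightarrow> f(k := - f k) \<in> B"
proof -
  interpret product_sigma_finite "\<lambda>_::'i. lborel :: real measure" by standard
  let ?M = "PiM J (\<lambda>_. lborel :: real measure)"
  let ?N = "PiM (J - {j}) (\<lambda>_. lborel :: real measure)"
  note A[measurable]
  define l where "l f = emeasure lborel {t. f(j := t) \<in> A}" for f
  have Jj: "insert j (J - {j}) = J" using J by auto
  have upd[measurable]: "(\<lambda>(f, t). f(j := t)) \<in> ?M \<Otimes>\<^sub>M lborel \<rightarrow>\<^sub>M ?M"
    using measurable_add_dim[of j J "\<lambda>_. lborel :: real measure"] J by (simp add: insert_absorb)
  have upd1: "(\<lambda>t. f(j := t)) \<in> lborel \<rightarrow>\<^sub>M ?M" if "f \<in> space ?M \<or> f \<in> space ?N" for f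
  proof (cases "f \<in> space ?M")
    case True
    then show ?thesis using measurable_Pair2[OF upd True] by simp
  next
    case False
    then show ?thesis using that measurable_component_update[of f "J - {j}" "\<lambda>_. lborel" j] Jj by simp
  qed
  have fib[measurable]: "{t. f(j := t) \<in> A} \<in> sets borel" if "f \<in> space ?M \<or> f \<in> space ?N" for f
    using measurable_sets[OF upd1[OF that] A] by (simp add: vimage_def)
  have l[measurable]: "l \<in> borel_measurable ?M"
  proof -
    let ?X = "(\<lambda>(f, t). f(j := t)) -` A \<inter> space (?M \<Otimes>\<^sub>M lborel)"
    have "?X \<in> sets (?M \<Otimes>\<^sub>M lborel)" by measurable
    from lborel.measurable_emeasure_Pair[OF this]
    show ?thesis
      by (rule measurable_cong[THEN iffD1, rotated])
        (auto simp: l_def vimage_def space_pair_measure intro!: arg_cong[where f="emeasure lborel"])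
  qed
  \<comment> \<open>The strict inequality leaves the section empty where that of \<open>A\<close> is
    null, so a point of \<open>B\<close> always comes with a nonempty section of \<open>A\<close>,
    from which the diameter bound is read off.\<close>
  define B where "B = {f \<in> space ?M. ennreal (2 * \<bar>f j\<bar>) < l f}"
  have lj: "l (f(j := t)) = l f" for f t by (simp add: l_def)
  have B[measurable]: "B \<in> sets ?M" unfolding B_def using J by measurable
  have fm: "f(k := t) \<in> space ?M" if "f \<in> space ?M" "k \<in> J" for f k t
    using that J by (auto simp: space_PiM PiE_def extensional_def)
  have fm': "f(j := t) \<in> space ?M" if "f \<in> space ?N" for f t
    using that J by (auto simp: space_PiM PiE_def extensional_def)
  have *: "emeasure ?M C = (\<integral>\<^sup>+ f. emeasure lborel {t. f(j := t) \<in> C} \<partial>?N)" if C: "C \<in> sets ?M" for C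
  proof -
    have "emeasure ?M C = (\<integral>\<^sup>+ f. indicator C f \<partial>?M)" using C by simp
    also have "\<dots> = (\<integral>\<^sup>+ f. (\<integral>\<^sup>+ t. indicator C (f(j := t)) \<partial>lborel) \<partial>?N)"
      using product_nn_integral_insert[of "J - {j}" j "indicator C"] J C Jj by simp
    also have "\<dots> = (\<integral>\<^sup>+ f. emeasure lborel {t. f(j := t) \<in> C} \<partial>?N)"
    proof (rule nn_integral_cong)
      fix f assume f: "f \<in> space ?N"
      have "{t. f(j := t) \<in> C} \<in> sets borel"
        using measurable_sets[OF upd1 C] f by (simp add: vimage_def)
      then have "emeasure lborel {t. f(j := t) \<in> C} = (\<integral>\<^sup>+ t. indicator {t. f(j := t) \<in> C} t \<partial>lborel)"
        by simp
      then show "(\<integral>\<^sup>+ t. indicator C (f(j := t)) \<partial>lborel) = emeasure lborel {t. f(j := t) \<in> C}"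
        by (simp add: indicator_def)
    qed
    finally show ?thesis .
  qed
  have "emeasure ?M B = (\<integral>\<^sup>+ f. l f \<partial>?N)"
    unfolding *[OF B]
  proof (rule nn_integral_cong)
    fix f assume f: "f \<in> space ?N"
    have "{t. f(j := t) \<in> B} = {t. ennreal (2 * \<bar>t\<bar>) < l f}"
      using fm'[OF f] by (auto simp: B_def lj)
    then show "emeasure lborel {t. f(j := t) \<in> B} = l f"
      by (simp add: emeasure_lborel_centered_interval)
  qed
  also have "\<dots> = emeasure ?M A"
    unfolding *[OF A] l_def ..
  finally have mB: "emeasure ?M B = emeasure ?M A" .
  have dB: "(\<Sum>i\<in>J. (f i - g i)\<^sup>2) \<le> D" if f: "f \<in> B" and g: "g \<in> B" for f g
  proof -
    \<comment> \<open>The squared distance off coordinate \<open>j\<close>; this leaves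
      \<open>D - R\<close> for coordinate \<open>j\<close>.\<close>
    define R where "R = (\<Sum>i\<in>J - {j}. (f i - g i)\<^sup>2)"
    let ?F = "{t. f(j := t) \<in> A}" and ?G = "{t. g(j := t) \<in> A}"
    have "emeasure lborel ?F \<noteq> 0" "emeasure lborel ?G \<noteq> 0"
      using f g by (auto simp: B_def l_def)
    then have "?F \<noteq> {}" "?G \<noteq> {}" by (auto simp del: Collect_empty_eq)
    have tu: "(t - u)\<^sup>2 + R \<le> D" if "t \<in> ?F" "u \<in> ?G" for t u
    proof -
      have "(\<Sum>i\<in>J. ((f(j := t)) i - (g(j := u)) i)\<^sup>2) = (t - u)\<^sup>2 + R"
        using J by (subst sum.remove[of _ j]) (auto simp: R_def intro!: sum.cong)
      then show ?thesis using diam[of "f(j := t)" "g(j := u)"] that by simp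
    qed
    then have "D - R \<ge> 0" using \<open>?F \<noteq> {}\<close> \<open>?G \<noteq> {}\<close> 
      by (smt (verit) equals0I zero_le_power2)
    have "\<bar>f j - g j\<bar> \<le> sqrt (D - R)"
    proof (rule centered_intervals_distance[of ?F ?G])
      show "\<bar>t - u\<bar> \<le> sqrt (D - R)" if "t \<in> ?F" "u \<in> ?G" for t u
        using tu[OF that] by (intro real_le_rsqrt) simp
    qed (use f g in \<open>auto simp: B_def l_def intro!: fib\<close>)
    then have "(f j - g j)\<^sup>2 \<le> D - R"
      using \<open>D - R \<ge> 0\<close> by (metis real_sqrt_abs real_sqrt_le_iff)
    then show ?thesis using J by (subst sum.remove[of _ j]) (auto simp: R_def)
  qed
  have "f(k := - f k) \<in> B" if k: "k \<in> insert j S" and f: "f \<in> B" for k f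
  proof (cases "k = j")
    case True
    with f J show ?thesis by (auto simp: B_def lj intro!: fm)
  next
    case False
    with k have kS: "k \<in> S" by simp
    have "f(k := - f k, j := t) \<in> A \<longleftrightarrow> f(j := t) \<in> A" for t
    proof -
      let ?g = "f(j := t)" and ?h = "f(k := - f k, j := t)"
      have "?h = ?g(k := - ?g k)" "?g = ?h(k := - ?h k)" using False by auto
      then show ?thesis using sym[OF kS, of ?g] sym[OF kS, of ?h] by metis
    qed
    then have "l (f(k := - f k)) = l f" by (simp add: l_def)
    with f False kS S show ?thesis by (auto simp: B_def intro!: fm)
  qed
  with B mB dB that show ?thesis by blast
qed

text \<open>One coordinate after the other is treated. A step preserves the symmetries already
  gained, so at the end all coordinate reflections are available at once.\<close>

lemma steiner_symmetrization:
  fixes A :: "('i \<Rightarrow> real) set"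
  assumes J: "finite J" and A: "A \<in> sets (PiM J (\<lambda>_. lborel))"
    and diam: "\<And>f g. f \<in> A \<Longrightarrow> g \<in> A \<Longrightarrow> (\<Sum>i\<in>J. (f i - g i)\<^sup>2) \<le> D"
  obtains B where "B \<in> sets (PiM J (\<lambda>_. lborel))"
    "emeasure (PiM J (\<lambda>_. lborel)) B = emeasure (PiM J (\<lambda>_. lborel)) A"
    "\<And>f g. f \<in> B \<Longrightarrow> g \<in> B \<Longrightarrow> (\<Sum>i\<in>J. (f i - g i)\<^sup>2) \<le> D"
    "\<And>k f. k \<in> J \<Longrightarrow> f \<in> B \<Longrightarrow> f(k := - f k) \<in> B"
proof -
  let ?M = "PiM J (\<lambda>_. lborel :: real measure)"
  let ?sym = "\<lambda>S B. B \<in> sets ?M \<and> emeasure ?M B = emeasure ?M A \<and>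
    (\<forall>f g. f \<in> B \<longrightarrow> g \<in> B \<longrightarrow> (\<Sum>i\<in>J. (f i - g i)\<^sup>2) \<le> D) \<and>
    (\<forall>k f. k \<in> S \<longrightarrow> f \<in> B \<longrightarrow> f(k := - f k) \<in> B)"
  have "\<exists>B. ?sym S B" if "S \<subseteq> J" for S
    using finite_subset[OF that J] that
  proof (induction S rule: finite_induct)
    case empty
    then show ?case using A diam by auto
  next
    case (insert j S)
    have jS: "j \<in> J" "S \<subseteq> J" using insert by auto
    obtain B where B: "B \<in> sets ?M" "emeasure ?M B = emeasure ?M A"
      "\<forall>f g. f \<in> B \<longrightarrow> g \<in> B \<longrightarrow> (\<Sum>i\<in>J. (f i - g i)\<^sup>2) \<le> D"
      "\<forall>k f. k \<in> S \<longrightarrow> f \<in> B \<longrightarrow> f(k := - f k) \<in> B"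
      using insert.IH[OF jS(2)] by (elim exE conjE) rule
    obtain B' where B': "B' \<in> sets ?M" "emeasure ?M B' = emeasure ?M B"
      "\<And>f g. f \<in> B' \<Longrightarrow> g \<in> B' \<Longrightarrow> (\<Sum>i\<in>J. (f i - g i)\<^sup>2) \<le> D"
      "\<And>k f. k \<in> insert j S \<Longrightarrow> f \<in> B' \<Longrightarrow> f(k := - f k) \<in> B'"
      using steiner_symmetrization_step[OF J jS(1) B(1) B(3)[rule_format] B(4)[rule_format] jS(2)] by blast
    show ?case
      by (intro exI[of _ B'] conjI allI impI B'(1) B'(3,4)) (simp_all only: B'(2) B(2))
  qed
  from this[OF subset_refl] that show ?thesis by blast
qed

text \<open>A set invariant under all coordinate reflections contains \<open>-f\<close> together
  with \<open>f\<close>, so the diameter bound puts it into the ball of radius \<open>D / 2\<close>.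
  An arbitrary finite index set is allowed because the coordinates of a hyperplane will be
  \<open>Basis - {e}\<close>.\<close>

theorem isodiametric_inequality_PiM:
  fixes A :: "('i \<Rightarrow> real) set"
  assumes J: "finite J" and A: "A \<in> sets (PiM J (\<lambda>_. lborel))" and "D \<ge> 0"
    and diam: "\<And>f g. f \<in> A \<Longrightarrow> g \<in> A \<Longrightarrow> (\<Sum>i\<in>J. (f i - g i)\<^sup>2) \<le> D\<^sup>2"
  shows "emeasure (PiM J (\<lambda>_. lborel)) A \<le> ennreal (unit_ball_vol (real (card J)) * (D / 2) ^ card J)"
proof -
  let ?M = "PiM J (\<lambda>_. lborel :: real measure)"
  obtain B where B: "B \<in> sets ?M" "emeasure ?M B = emeasure ?M A"
    "\<And>f g. f \<in> B \<Longrightarrow> g \<in> B \<Longrightarrow> (\<Sum>i\<in>J. (f i - g i)\<^sup>2) \<le> D\<^sup>2"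
    "\<And>k f. k \<in> J \<Longrightarrow> f \<in> B \<Longrightarrow> f(k := - f k) \<in> B"
    using steiner_symmetrization[OF J A diam] by blast
  have neg: "(\<lambda>i. if i \<in> K then - f i else f i) \<in> B" if "f \<in> B" "K \<subseteq> J" for f K
    using finite_subset[OF that(2) J] that(2)
  proof (induction K rule: finite_induct)
    case empty
    then show ?case using that by simp
  next
    case (insert k K)
    then have "(\<lambda>i. if i \<in> K then - f i else f i) \<in> B" by auto
    from B(4)[OF _ this, of k] insert
    have "(\<lambda>i. if i \<in> K then - f i else f i)(k := - f k) \<in> B" by auto
    also have "(\<lambda>i. if i \<in> K then - f i else f i)(k := - f k) =
      (\<lambda>i. if i \<in> insert k K then - f i else f i)" by auto
    finally show ?case .
  qed
  have sub: "B \<subseteq> {f. sqrt (\<Sum>i\<in>J. (f i)\<^sup>2) \<le> D / 2} \<inter> space ?M"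
  proof
    fix f assume f: "f \<in> B"
    have "(\<Sum>i\<in>J. (f i - (if i \<in> J then - f i else f i))\<^sup>2) \<le> D\<^sup>2"
      by (rule B(3)[OF f neg[OF f subset_refl]])
    also have "(\<Sum>i\<in>J. (f i - (if i \<in> J then - f i else f i))\<^sup>2) = 4 * (\<Sum>i\<in>J. (f i)\<^sup>2)"
      by (simp add: sum_distrib_left power2_eq_square algebra_simps)
    finally have "(\<Sum>i\<in>J. (f i)\<^sup>2) \<le> (D / 2)\<^sup>2" by (simp add: power_divide)
    then have "sqrt (\<Sum>i\<in>J. (f i)\<^sup>2) \<le> D / 2" using \<open>D \<ge> 0\<close>
      by (intro real_le_lsqrt) (auto intro: sum_nonneg)
    then show "f \<in> {f. sqrt (\<Sum>i\<in>J. (f i)\<^sup>2) \<le> D / 2} \<inter> space ?M"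
      using sets.sets_into_space[OF B(1)] f by auto
  qed
  \<comment> \<open>The volume formula is applied to balls of positive radius; \<open>D\<close> may
    be 0, so \<open>D / 2\<close> is approached from above.\<close>
  have bound: "emeasure ?M A \<le> ennreal (unit_ball_vol (real (card J)) * (r / 2) ^ card J)" if "r > D" for r
  proof -
    have "{f. sqrt (\<Sum>i\<in>J. (f i)\<^sup>2) \<le> r / 2} \<inter> space ?M \<in> sets ?M"
      using J by measurable
    then have "emeasure ?M B \<le> emeasure ?M ({f. sqrt (\<Sum>i\<in>J. (f i)\<^sup>2) \<le> r / 2} \<inter> space ?M)"
      using sub that by (intro emeasure_mono) auto
    also have "\<dots> = ennreal (unit_ball_vol (real (card J)) * (r / 2) ^ card J)"
      using that \<open>D \<ge> 0\<close> J by (intro emeasure_cball_aux) auto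
    finally show ?thesis using B(2) by simp
  qed
  have "((\<lambda>r. ennreal (unit_ball_vol (real (card J)) * (r / 2) ^ card J)) \<longlongrightarrow>
    ennreal (unit_ball_vol (real (card J)) * (D / 2) ^ card J)) (at_right D)"
    by (intro tendsto_intros) auto
  then show ?thesis
    by (rule tendsto_lowerbound) (auto simp: eventually_at_right_less intro: bound eventually_mono[OF eventually_at_right_less])
qed

section \<open>Lebesgue measure under linear maps\<close>

lemma linear_borel_measurable:
  fixes L :: "'a::euclidean_space \<Rightarrow> 'a"
  shows "linear L \<Longrightarrow> L \<in> borel_measurable borel"
  by (simp add: linear_continuous_on linear_conv_bounded_linear borel_measurable_continuous_onI)

lemma unit_ball_measure:
  "emeasure lborel (ball (0::'a::euclidean_space) 1) = ennreal (measure lborel (ball (0::'a) 1))"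
  "measure lborel (ball (0::'a) 1) > 0"
  using emeasure_bounded_finite[of "ball (0::'a) 1"]
  by (auto intro!: emeasure_eq_ennreal_measure)

lemma convex_frontier_null_sets:
  fixes S :: "'a::euclidean_space set"
  assumes "convex S" shows "frontier S \<in> null_sets lborel"
  using negligible_convex_frontier[OF assms] negligible_iff_null_sets null_sets_completion_iff
  by (metis borel_closed frontier_closed sets_lborel)

lemma lborel_emeasure_translate:
  fixes c :: "'a::euclidean_space"
  assumes "A \<in> sets borel"
  shows "emeasure lborel ((\<lambda>x. c + x) -` A) = emeasure lborel A"
  using emeasure_distr[of "(+) c" lborel borel A] assms by (simp add: lborel_distr_plus)

text \<open>Uniqueness of Haar measure by Fubini: \<open>indicator A (x + y) * indicator B y\<close>
  is integrated against both measures. Integrating over \<open>x\<close> first, invariance of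
  \<open>M\<close> gives the left side; shifting \<open>y\<close> by \<open>x\<close> and then
  integrating over \<open>x\<close> gives the right side. The reflection arises because
  \<open>y - x \<in> B\<close> means that \<open>x\<close> lies in \<open>y - B\<close>.\<close>

lemma translation_invariant_measure_unique:
  fixes M :: "'a::euclidean_space measure"
  assumes sets[measurable_cong]: "sets M = sets borel" and "sigma_finite_measure M"
    and inv: "\<And>A c. A \<in> sets borel \<Longrightarrow> emeasure M ((\<lambda>x. x + c) -` A) = emeasure M A"
    and A[measurable]: "A \<in> sets borel" and B[measurable]: "B \<in> sets borel"
  shows "emeasure M A * emeasure lborel B = emeasure lborel A * emeasure M (uminus -` B)"
proof -
  interpret M: sigma_finite_measure M by fact
  interpret P: pair_sigma_finite M lborel
    by (simp add: pair_sigma_finite_def M.sigma_finite_measure_axioms lborel.sigma_finite_measure_axioms)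
  have space: "space M = UNIV" using sets_eq_imp_space_eq[OF sets] by simp
  have vA: "(\<lambda>x. x + y) -` A \<in> sets borel" for y :: 'a
    using measurable_sets[of "\<lambda>x. x + y" borel borel A] by simp
  have vB: "uminus -` B \<in> sets borel"
    using measurable_sets[of "uminus" borel borel B] by simp
  have vB2: "(\<lambda>x. y - x) -` B \<in> sets borel" for y
    using measurable_sets[of "\<lambda>x. y - x" borel borel B] by simp
  have "emeasure M A * emeasure lborel B = (\<integral>\<^sup>+ y. emeasure M A * indicator B y \<partial>lborel)"
    by (subst nn_integral_cmult) auto
  also have "\<dots> = (\<integral>\<^sup>+ y. (\<integral>\<^sup>+ x. indicator A (x + y) * indicator B y \<partial>M) \<partial>lborel)"
  proof (rule nn_integral_cong)
    fix y :: 'a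
    have "(\<integral>\<^sup>+ x. indicator A (x + y) * indicator B y \<partial>M) =
        (\<integral>\<^sup>+ x. indicator ((\<lambda>x. x + y) -` A) x \<partial>M) * indicator B y"
      by (subst nn_integral_multc[symmetric]) (auto simp: indicator_def)
    also have "\<dots> = emeasure M A * indicator B y"
      using vA[of y] by (subst nn_integral_indicator) (auto simp: sets inv)
    finally show "emeasure M A * indicator B y = (\<integral>\<^sup>+ x. indicator A (x + y) * indicator B y \<partial>M)" ..
  qed
  also have "\<dots> = (\<integral>\<^sup>+ x. (\<integral>\<^sup>+ y. indicator A (x + y) * indicator B y \<partial>lborel) \<partial>M)"
    by (rule P.Fubini') measurable
  also have "\<dots> = (\<integral>\<^sup>+ x. (\<integral>\<^sup>+ y. indicator A y * indicator B (y - x) \<partial>lborel) \<partial>M)"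
  proof (rule nn_integral_cong)
    fix x :: 'a
    have "(\<integral>\<^sup>+ y. indicator A y * indicator B (y - x) \<partial>lborel) =
      (\<integral>\<^sup>+ y. indicator A y * indicator B (y - x) \<partial>distr lborel borel ((+) x))"
      by (simp add: lborel_distr_plus)
    also have "\<dots> = (\<integral>\<^sup>+ y. indicator A (x + y) * indicator B y \<partial>lborel)"
      by (subst nn_integral_distr) auto
    finally show "(\<integral>\<^sup>+ y. indicator A (x + y) * indicator B y \<partial>lborel) =
      (\<integral>\<^sup>+ y. indicator A y * indicator B (y - x) \<partial>lborel)" ..
  qed
  also have "\<dots> = (\<integral>\<^sup>+ y. (\<integral>\<^sup>+ x. indicator A y * indicator B (y - x) \<partial>M) \<partial>lborel)"
    by (rule P.Fubini'[symmetric]) measurable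
  also have "\<dots> = (\<integral>\<^sup>+ y. indicator A y * emeasure M (uminus -` B) \<partial>lborel)"
  proof (rule nn_integral_cong)
    fix y :: 'a
    have "(\<integral>\<^sup>+ x. indicator A y * indicator B (y - x) \<partial>M) =
        indicator A y * (\<integral>\<^sup>+ x. indicator ((\<lambda>x. y - x) -` B) x \<partial>M)"
      by (subst nn_integral_cmult[symmetric]) (auto simp: indicator_def)
    also have "(\<integral>\<^sup>+ x. indicator ((\<lambda>x. y - x) -` B) x \<partial>M) = emeasure M ((\<lambda>x. y - x) -` B)"
      using vB2[of y] by (subst nn_integral_indicator) (auto simp: sets)
    also have "(\<lambda>x. y - x) -` B = (\<lambda>x. x + (- y)) -` (uminus -` B)" by auto
    finally show "(\<integral>\<^sup>+ x. indicator A y * indicator B (y - x) \<partial>M) =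
      indicator A y * emeasure M (uminus -` B)" unfolding inv[OF vB] .
  qed
  also have "\<dots> = emeasure lborel A * emeasure M (uminus -` B)"
    by (subst nn_integral_multc) auto
  finally show ?thesis .
qed

text \<open>The constant is 1 / |det L|, the factor by which taking preimages scales volume. It will
  be found from uniqueness of translation-invariant measures and from compositions, without
  determinants.\<close>

definition volume_factor :: "('a::euclidean_space \<Rightarrow> 'a) \<Rightarrow> real \<Rightarrow> bool" where
  "volume_factor L c \<longleftrightarrow> c > 0 \<and> distr lborel borel L = density lborel (\<lambda>_. ennreal c)"

lemma volume_factor_emeasure:
  assumes "volume_factor L c" "linear L" "A \<in> sets borel"
  shows "emeasure lborel (L -` A) = ennreal c * emeasure lborel A"
proof -
  have L: "L \<in> borel_measurable borel"
    using assms(2) by (simp add: linear_borel_measurable)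
  have "emeasure lborel (L -` A) = emeasure (distr lborel borel L) A"
    using assms(3) L by (subst emeasure_distr) auto
  also have "\<dots> = ennreal c * emeasure lborel A"
    using assms by (simp add: volume_factor_def emeasure_density_const)
  finally show ?thesis .
qed

lemma volume_factorI:
  assumes "linear L" "c > 0"
    and "\<And>A. A \<in> sets borel \<Longrightarrow> emeasure lborel (L -` A) = ennreal c * emeasure lborel A"
  shows "volume_factor L c"
proof -
  have L: "L \<in> borel_measurable borel"
    using assms(1) by (simp add: linear_borel_measurable)
  have "distr lborel borel L = density lborel (\<lambda>_. ennreal c)"
    by (rule measure_eqI) (use L in \<open>auto simp: emeasure_distr emeasure_density_const assms\<close>)
  with \<open>c > 0\<close> show ?thesis by (simp add: volume_factor_def)
qed

lemma volume_factor_eq_1: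
  fixes L :: "'a::euclidean_space \<Rightarrow> 'a"
  assumes "volume_factor L c" "linear L" "L -` ball 0 1 = ball 0 1" shows "c = 1"
  using volume_factor_emeasure[OF assms(1,2), of "ball 0 1"] assms(1) unit_ball_measure(2)[where 'a='a]
  unfolding assms(3) unit_ball_measure(1) by (simp add: volume_factor_def ennreal_mult[symmetric])

lemma volume_factor_comp:
  assumes "volume_factor L c" "linear L" "volume_factor K d" "linear K"
  shows "volume_factor (L \<circ> K) (c * d)"
proof (rule volume_factorI)
  fix A :: "'a set" assume A: "A \<in> sets borel"
  have "L \<in> borel_measurable borel"
    using assms(2) by (simp add: linear_borel_measurable)
  then have LA: "L -` A \<in> sets borel" using measurable_sets[OF _ A, of L borel] by simp
  have "(L \<circ> K) -` A = K -` (L -` A)" by auto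
  then show "emeasure lborel ((L \<circ> K) -` A) = ennreal (c * d) * emeasure lborel A"
    using assms(1,3) A LA volume_factor_emeasure[OF assms(1,2) A] volume_factor_emeasure[OF assms(3,4) LA]
    by (simp add: ennreal_mult volume_factor_def mult_ac)
qed (use assms in \<open>auto simp: volume_factor_def linear_compose\<close>)

text \<open>The image of Lebesgue measure under \<open>L\<close> is translation invariant, and it is
  finite on balls since the inverse is bounded. Comparison on the unit ball, which equals its own
  reflection, yields the constant.\<close>

lemma volume_factor_exists:
  fixes L :: "'a::euclidean_space \<Rightarrow> 'a"
  assumes L: "linear L" "inj L"
  shows "\<exists>c. volume_factor L c"
proof -
  obtain K where K: "linear K" "\<And>x. K (L x) = x" "\<And>x. L (K x) = x"
    using linear_injective_isomorphism[OF L] by blast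
  have Lm[measurable]: "L \<in> borel_measurable borel"
    using L by (simp add: linear_borel_measurable)
  have Lc: "continuous_on UNIV L" "bounded_linear K"
    using L K by (simp_all add: linear_continuous_on linear_conv_bounded_linear)
  let ?M = "distr lborel borel L"
  have vim: "L -` A = K ` A" for A using K by (auto simp: image_iff) metis
  let ?V = "L -` ball 0 1"
  have bV: "bounded ?V" unfolding vim by (intro bounded_linear_image Lc) auto
  have oV: "open ?V" using Lc by (intro open_vimage) auto
  have "0 \<in> ?V" using L by (simp add: linear_0)
  have fin: "emeasure lborel ?V < \<infinity>" using emeasure_bounded_finite[OF bV] by simp
  have pos: "emeasure lborel ?V \<noteq> 0"
  proof
    assume "emeasure lborel ?V = 0"
    then have "negligible ?V" using oV by (simp add: negligible_iff_null_sets null_sets_def)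
    with open_not_negligible[OF oV] \<open>0 \<in> ?V\<close> show False by blast
  qed
  note vol = unit_ball_measure(1)[where 'a='a] and volpos = unit_ball_measure(2)[where 'a='a]
  define c where "c = measure lborel ?V / measure lborel (ball (0::'a) 1)"
  have V: "emeasure lborel ?V = ennreal (measure lborel ?V)"
    using fin by (intro emeasure_eq_ennreal_measure) auto
  then have "measure lborel ?V > 0" using pos by (metis ennreal_0 zero_less_measure_iff)
  then have "c > 0" using volpos by (simp add: c_def)
  have sf: "sigma_finite_measure ?M"
  proof (standard, intro exI[of _ "range (\<lambda>n. ball (0::'a) (real n))"] conjI ballI)
    show "\<Union> (range (\<lambda>n. ball (0::'a) (real n))) = space ?M"
      by (auto simp: reals_Archimedean2)
    fix a assume "a \<in> range (\<lambda>n. ball (0::'a) (real n))"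
    then obtain n where a: "a = ball 0 (real n)" by auto
    have "bounded (L -` a)" unfolding vim a by (intro bounded_linear_image Lc) auto
    then show "emeasure ?M a \<noteq> \<infinity>"
      using emeasure_bounded_finite[of "L -` a"] by (simp add: emeasure_distr a)
  qed auto
  have inv: "emeasure ?M ((\<lambda>x. x + y) -` A) = emeasure ?M A" if A: "A \<in> sets borel" for A y
  proof -
    have 1: "(\<lambda>x. x + y) -` A \<in> sets borel" using measurable_sets[of "\<lambda>x. x + y" borel borel A] A by simp
    have 2: "L -` A \<in> sets borel" using measurable_sets[OF Lm A] by simp
    have "L -` (\<lambda>x. x + y) -` A = (\<lambda>x. K y + x) -` (L -` A)"
      using K L by (auto simp: linear_add add.commute)
    then show ?thesis using 1 A 2 lborel_emeasure_translate[of "L -` A" "K y"]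
      by (simp add: emeasure_distr)
  qed
  have "volume_factor L c"
  proof (rule volume_factorI)
    fix A :: "'a set" assume A: "A \<in> sets borel"
    have "emeasure ?M A * emeasure lborel (ball (0::'a) 1) =
        emeasure lborel A * emeasure ?M (uminus -` ball 0 1)"
      by (rule translation_invariant_measure_unique[OF _ sf inv A]) auto
    also have "uminus -` ball (0::'a) 1 = ball 0 1" by auto
    also have "emeasure ?M (ball 0 1) = ennreal c * emeasure lborel (ball (0::'a) 1)"
      using volpos \<open>c > 0\<close> unfolding vol
      by (simp add: emeasure_distr V c_def ennreal_mult[symmetric])
    finally have "emeasure ?M A * ennreal (measure lborel (ball (0::'a) 1)) =
      (ennreal c * emeasure lborel A) * ennreal (measure lborel (ball (0::'a) 1))"
      unfolding vol by (simp add: mult_ac)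
    then have "emeasure ?M A = ennreal c * emeasure lborel A"
      using volpos by (simp add: mult_right_ennreal_cancel)
    then show "emeasure lborel (L -` A) = ennreal c * emeasure lborel A"
      using A by (simp add: emeasure_distr)
  qed (use L \<open>c > 0\<close> in auto)
  then show ?thesis ..
qed

section \<open>Volume factors of reflections, stretches and shears\<close>

lemma volume_factor_orthogonal:
  fixes R :: "'a::euclidean_space \<Rightarrow> 'a"
  assumes R: "orthogonal_transformation R"
  shows "volume_factor R 1"
proof -
  have L: "linear R" "inj R"
    using R by (auto simp: orthogonal_transformation_linear orthogonal_transformation_inj)
  have V: "R -` ball 0 1 = ball 0 1" using R by (auto simp: orthogonal_transformation_norm)
  obtain c where c: "volume_factor R c" using volume_factor_exists[OF L] by blast
  with volume_factor_eq_1[OF c L(1) V] show ?thesis by simp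
qed

text \<open>Householder reflection along \<open>a - b\<close>: equal norms give
  \<open>2 * (a \<bullet> u) = u \<bullet> u\<close>, hence \<open>R a = b\<close>. Since
  \<open>R\<close> is its own inverse, conjugation is composition with \<open>R\<close> on both
  sides.\<close>

lemma orthogonal_transformation_between_units:
  fixes a b :: "'a::euclidean_space"
  assumes "norm a = 1" "norm b = 1"
  obtains R where "orthogonal_transformation R" "R a = b" "\<And>x. R (R x) = x"
proof (cases "a = b")
  case True
  then show ?thesis using that[of "\<lambda>x. x"] by (simp add: orthogonal_transformation_id)
next
  case False
  define u where "u = a - b"
  define R where "R x = x - (2 * (x \<bullet> u) / (u \<bullet> u)) *\<^sub>R u" for x
  have uu: "u \<bullet> u \<noteq> 0" using False by (simp add: u_def)
  have "linear R" unfolding R_def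
    by (intro linearI) (auto simp: algebra_simps inner_add_left add_divide_distrib scaleR_add_left)
  have "a \<bullet> a = 1" "b \<bullet> b = 1" using assms by (simp_all add: norm_eq_1)
  then have au: "2 * (a \<bullet> u) = u \<bullet> u"
    by (simp add: u_def inner_diff_left inner_diff_right inner_commute)
  have "R a = b" using uu by (simp add: R_def au) (simp add: u_def)
  moreover have "R x \<bullet> R y = x \<bullet> y" for x y
    using uu by (simp add: R_def inner_diff_left inner_diff_right inner_commute field_simps)
  then have "orthogonal_transformation R" using \<open>linear R\<close> by (simp add: orthogonal_transformation_def)
  moreover have "R x \<bullet> u = - (x \<bullet> u)" for x using uu by (simp add: R_def inner_diff_left)
  then have "R (R x) = x" for x
    by (subst R_def) (simp add: R_def)
  ultimately show ?thesis using that by blast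
qed

lemma orthogonal_inner: "orthogonal_transformation R \<Longrightarrow> R x \<bullet> R y = x \<bullet> y"
  by (simp add: orthogonal_transformation_def)

text \<open>Conjugation with a reflection that exchanges \<nu> and a basis vector makes the map
  diagonal, where \<open>lborel_affine_euclidean\<close> gives the factor.\<close>

lemma volume_factor_stretch:
  fixes \<nu> :: "'a::euclidean_space"
  assumes \<nu>: "norm \<nu> = 1" and g: "g \<noteq> 0"
  shows "volume_factor (\<lambda>x. x + ((g - 1) * (x \<bullet> \<nu>)) *\<^sub>R \<nu>) (1 / \<bar>g\<bar>)"
proof -
  obtain e :: 'a where e: "e \<in> Basis" using nonempty_Basis by blast
  obtain R :: "'a \<Rightarrow> 'a" where R: "orthogonal_transformation R" "R e = \<nu>" "\<And>x. R (R x) = x"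
    using orthogonal_transformation_between_units[of e \<nu>] e \<nu> by auto
  define S where "S x = x + ((g - 1) * (x \<bullet> e)) *\<^sub>R e" for x
  define c where "c j = (if j = e then g else 1)" for j
  have linS: "linear S" unfolding S_def
    by (intro linearI) (auto simp: algebra_simps inner_add_left)
  have linR: "linear R" using R by (simp add: orthogonal_transformation_linear)
  have S: "S x = 0 + (\<Sum>j\<in>Basis. (c j * (x \<bullet> j)) *\<^sub>R j)" for x
  proof -
    have "(\<Sum>j\<in>Basis. (c j * (x \<bullet> j)) *\<^sub>R j) =
        (\<Sum>j\<in>Basis. (x \<bullet> j) *\<^sub>R j + (if j = e then ((g - 1) * (x \<bullet> e)) *\<^sub>R e else 0))"
      by (intro sum.cong) (auto simp: c_def algebra_simps)
    also have "\<dots> = S x" using e by (simp add: sum.distrib euclidean_representation S_def)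
    finally show ?thesis by simp
  qed
  have Sm: "S \<in> borel_measurable borel"
    using linS by (simp add: linear_borel_measurable)
  have "(\<Prod>j\<in>Basis. \<bar>c j\<bar>) = \<bar>g\<bar>"
    using e by (simp add: c_def if_distrib[of abs] prod.If_cases)
  then have lb: "lborel = density (distr lborel borel S) (\<lambda>_. ennreal \<bar>g\<bar>)"
    using lborel_affine_euclidean[of c 0] g unfolding S[abs_def] by (simp add: c_def)
  have "volume_factor S (1 / \<bar>g\<bar>)"
  proof (rule volume_factorI[OF linS])
    fix A :: "'a set" assume A: "A \<in> sets borel"
    have "emeasure lborel A = ennreal \<bar>g\<bar> * emeasure lborel (S -` A)"
      using A Sm by (subst lb) (simp add: emeasure_density_const emeasure_distr)
    then have "ennreal (1 / \<bar>g\<bar>) * emeasure lborel A = ennreal (1 / \<bar>g\<bar> * \<bar>g\<bar>) * emeasure lborel (S -` A)"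
      by (subst ennreal_mult) (auto simp: mult_ac)
    then show "emeasure lborel (S -` A) = ennreal (1 / \<bar>g\<bar>) * emeasure lborel A"
      using g by simp
  qed (use g in auto)
  then have "volume_factor (R \<circ> (S \<circ> R)) (1 * ((1 / \<bar>g\<bar>) * 1))"
    using R by (intro volume_factor_comp volume_factor_orthogonal linR linS linear_compose)
  moreover have "(R \<circ> (S \<circ> R)) x = x + ((g - 1) * (x \<bullet> \<nu>)) *\<^sub>R \<nu>" for x
    using R orthogonal_inner[OF R(1), of x \<nu>] orthogonal_inner[OF R(1), of "R x" "e"]
    by (simp add: S_def linear_add[OF linR] linear_cmul[OF linR])
  ultimately show ?thesis by (simp add: o_def)
qed

text \<open>Reflection in the hyperplane orthogonal to \<nu> conjugates the shear by
  \<open>u\<close> into the shear by \<open>- u\<close>, which is its inverse. Both have the same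
  factor \<open>c\<close>, and their composition is the identity, so
  \<open>c * c = 1\<close>.\<close>

lemma volume_factor_shear:
  fixes \<nu> :: "'a::euclidean_space"
  assumes \<nu>: "norm \<nu> = 1" and u: "u \<bullet> \<nu> = 0"
  shows "volume_factor (\<lambda>x. x + (x \<bullet> \<nu>) *\<^sub>R u) 1"
proof -
  have nn: "\<nu> \<bullet> \<nu> = 1" using \<nu> by (simp add: norm_eq_1)
  have u': "\<nu> \<bullet> u = 0" using u by (simp add: inner_commute)
  define S where "S v x = x + (x \<bullet> \<nu>) *\<^sub>R v" for v x
  define \<rho> where "\<rho> x = x + ((-1 - 1) * (x \<bullet> \<nu>)) *\<^sub>R \<nu>" for x
  have linS: "linear (S v)" for v unfolding S_def
    by (intro linearI) (auto simp: algebra_simps inner_add_left)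
  have lin\<rho>: "linear \<rho>" unfolding \<rho>_def
    by (intro linearI) (auto simp: algebra_simps inner_add_left)
  have \<rho>: "volume_factor \<rho> 1" unfolding \<rho>_def using volume_factor_stretch[OF \<nu>, of "-1"] by simp
  have inv: "S (- u) (S u x) = x" for x using u by (simp add: S_def inner_add_left inner_diff_left)
  have inv': "S u (S (- u) x) = x" for x using u by (simp add: S_def inner_add_left inner_diff_left)
  then have "inj (S u)" using inv by (metis injI)
  then obtain c where c: "volume_factor (S u) c" using volume_factor_exists[OF linS] by blast
  have "(\<rho> \<circ> (S u \<circ> \<rho>)) x = S (- u) x" for x
    using u u' nn by (simp add: S_def \<rho>_def inner_add_left algebra_simps)
  then have eq: "\<rho> \<circ> (S u \<circ> \<rho>) = S (- u)" by auto
  have "volume_factor (\<rho> \<circ> (S u \<circ> \<rho>)) (1 * (c * 1))"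
    by (intro volume_factor_comp \<rho> lin\<rho> linS c linear_compose)
  then have c': "volume_factor (S (- u)) c" unfolding eq by simp
  have "volume_factor (S u \<circ> S (- u)) (c * c)"
    by (intro volume_factor_comp c c' linS)
  also have "S u \<circ> S (- u) = (\<lambda>x. x)" using inv' by auto
  finally have "c * c = 1"
    by (intro volume_factor_eq_1[of "\<lambda>x. x"]) (simp_all add: linear_iff)
  then have "c = 1" using c by (simp add: volume_factor_def) (metis abs_of_pos abs_mult_self_eq real_sqrt_abs2 real_sqrt_one)
  with c show ?thesis by (simp add: S_def[abs_def])
qed

lemma lborel_integral_translate:
  fixes f :: "'a::euclidean_space \<Rightarrow> real"
  assumes "f \<in> borel_measurable borel"
  shows "(\<integral>x. f (x + c) \<partial>lborel) = (\<integral>x. f x \<partial>lborel)"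
proof -
  have "(\<integral>x. f x \<partial>lborel) = (\<integral>x. f x \<partial>distr lborel borel ((+) c))" by (simp add: lborel_distr_plus)
  also have "\<dots> = (\<integral>x. f (c + x) \<partial>lborel)" using assms by (subst integral_distr) auto
  finally show ?thesis by (simp add: add.commute)
qed

text \<open>The substitution is the affine map that fixes the hyperplane
  \<open>x \<bullet> \<nu> = a\<close> pointwise and whose linear part sends \<nu> to
  \<open>w\<close>. It splits into a stretch along \<nu> followed by a shear; only the stretch
  changes volume.\<close>

lemma integral_stretch_shear:
  fixes \<nu> w :: "'a::euclidean_space" and f :: "'a \<Rightarrow> real"
  assumes \<nu>: "norm \<nu> = 1" and w: "w \<bullet> \<nu> \<noteq> 0" and f[measurable]: "f \<in> borel_measurable borel"
  shows "(\<integral>x. f x \<partial>lborel) = \<bar>w \<bullet> \<nu>\<bar> * (\<integral>x. f (x - (x \<bullet> \<nu> - a) *\<^sub>R \<nu> + (x \<bullet> \<nu> - a) *\<^sub>R w) \<partial>lborel)"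
proof -
  define g where "g = w \<bullet> \<nu>"
  \<comment> \<open>Chosen so that stretch and shear send \<nu> first to
    \<open>g *\<^sub>R \<nu>\<close> and then to
    \<open>g *\<^sub>R \<nu> + g *\<^sub>R u = w\<close>.\<close>
  define u where "u = (1 / g) *\<^sub>R (w - g *\<^sub>R \<nu>)"
  have nn: "\<nu> \<bullet> \<nu> = 1" using \<nu> by (simp add: norm_eq_1)
  have u: "u \<bullet> \<nu> = 0" using nn by (simp add: u_def g_def inner_diff_left)
  have g: "g \<noteq> 0" using w by (simp add: g_def)
  define S where "S x = x + (x \<bullet> \<nu>) *\<^sub>R u" for x
  define D where "D x = x + ((g - 1) * (x \<bullet> \<nu>)) *\<^sub>R \<nu>" for x
  have lin: "linear S" "linear D" unfolding S_def D_def
    by (auto intro!: linearI simp: algebra_simps inner_add_left)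
  have SD: "(S \<circ> D) x = x - (x \<bullet> \<nu>) *\<^sub>R \<nu> + (x \<bullet> \<nu>) *\<^sub>R w" for x
    using g nn by (simp add: S_def D_def u_def inner_add_left algebra_simps)
  have vf: "volume_factor (S \<circ> D) (1 * (1 / \<bar>g\<bar>))"
    using volume_factor_shear[OF \<nu> u] volume_factor_stretch[OF \<nu> g] lin
    unfolding S_def D_def by (intro volume_factor_comp) auto
  have m[measurable]: "S \<circ> D \<in> borel_measurable borel" unfolding SD[abs_def] by measurable
  let ?L = "\<lambda>x. x - (x \<bullet> \<nu> - a) *\<^sub>R \<nu> + (x \<bullet> \<nu> - a) *\<^sub>R w" and ?f = "\<lambda>x. f (x + a *\<^sub>R \<nu>)"
  have L: "?L (x + a *\<^sub>R \<nu>) = (S \<circ> D) x + a *\<^sub>R \<nu>" for x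
    unfolding SD using nn by (simp add: inner_add_left algebra_simps)
  have "(\<integral>x. f (?L x) \<partial>lborel) = (\<integral>x. f (?L (x + a *\<^sub>R \<nu>)) \<partial>lborel)"
    by (rule lborel_integral_translate[symmetric]) measurable
  also have "\<dots> = (\<integral>x. ?f x \<partial>distr lborel borel (S \<circ> D))"
    unfolding L by (subst integral_distr) auto
  also have "\<dots> = (1 / \<bar>g\<bar>) * (\<integral>x. ?f x \<partial>lborel)"
    using vf by (simp add: volume_factor_def integral_density)
  also have "(\<integral>x. ?f x \<partial>lborel) = (\<integral>x. f x \<partial>lborel)"
    by (rule lborel_integral_translate) measurable
  finally show ?thesis using g by (simp add: g_def)
qed

section \<open>Surface measure on hyperplanes\<close>

text \<open>For a unit vector \<nu> the unit thickness of the slab makes this, by Fubini, the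
  Lebesgue measure of one dimension less on the plane. As an image under orthogonal projection it is
  a Borel measure on the whole space, so its definition needs no coordinates on the plane.\<close>

definition hyperplane_measure :: "'a::euclidean_space \<Rightarrow> real \<Rightarrow> 'a measure" where
  "hyperplane_measure \<nu> a =
     distr (density lborel (indicator {x. a \<le> x \<bullet> \<nu> \<and> x \<bullet> \<nu> \<le> a + 1})) borel
       (\<lambda>x. x - (x \<bullet> \<nu> - a) *\<^sub>R \<nu>)"

lemma sets_hyperplane_measure [simp, measurable_cong]:
  "sets (hyperplane_measure \<nu> a) = sets borel"
  by (simp add: hyperplane_measure_def)

lemma space_hyperplane_measure [simp]: "space (hyperplane_measure \<nu> a) = UNIV"
  by (simp add: hyperplane_measure_def)

lemma nn_integral_hyperplane_measure:
  assumes [measurable]: "f \<in> borel_measurable borel"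
  shows "(\<integral>\<^sup>+ x. f x \<partial>hyperplane_measure \<nu> a) =
    (\<integral>\<^sup>+ x. indicator {x. a \<le> x \<bullet> \<nu> \<and> x \<bullet> \<nu> \<le> a + 1} x * f (x - (x \<bullet> \<nu> - a) *\<^sub>R \<nu>) \<partial>lborel)"
  unfolding hyperplane_measure_def by (simp add: nn_integral_distr nn_integral_density)

lemma emeasure_hyperplane_measure:
  assumes A[measurable]: "A \<in> sets borel"
  shows "emeasure (hyperplane_measure \<nu> a) A =
    emeasure lborel {x. a \<le> x \<bullet> \<nu> \<and> x \<bullet> \<nu> \<le> a + 1 \<and> x - (x \<bullet> \<nu> - a) *\<^sub>R \<nu> \<in> A}"
proof -
  have "emeasure (hyperplane_measure \<nu> a) A = (\<integral>\<^sup>+ x. indicator A x \<partial>hyperplane_measure \<nu> a)"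
    by simp
  also have "\<dots> = (\<integral>\<^sup>+ x. indicator {x. a \<le> x \<bullet> \<nu> \<and> x \<bullet> \<nu> \<le> a + 1 \<and> x - (x \<bullet> \<nu> - a) *\<^sub>R \<nu> \<in> A} x \<partial>lborel)"
    by (subst nn_integral_hyperplane_measure[OF borel_measurable_indicator[OF A]], intro nn_integral_cong)
      (simp split: split_indicator)
  also have "\<dots> = emeasure lborel {x. a \<le> x \<bullet> \<nu> \<and> x \<bullet> \<nu> \<le> a + 1 \<and> x - (x \<bullet> \<nu> - a) *\<^sub>R \<nu> \<in> A}"
    by (subst nn_integral_indicator) auto
  finally show ?thesis .
qed

lemma emeasure_hyperplane_measure_off_plane:
  fixes \<nu> :: "'a::euclidean_space"
  assumes "norm \<nu> = 1"
  shows "emeasure (hyperplane_measure \<nu> a) {x. x \<bullet> \<nu> \<noteq> a} = 0"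
proof -
  have "\<nu> \<bullet> \<nu> = 1" using assms by (simp add: norm_eq_1)
  then have "(x - (x \<bullet> \<nu> - a) *\<^sub>R \<nu>) \<bullet> \<nu> = a" for x
    by (simp add: inner_diff_left)
  then show ?thesis
    by (subst emeasure_hyperplane_measure) auto
qed

lemma bounded_slab_preimage:
  fixes \<nu> :: "'a::euclidean_space"
  assumes "bounded A" "norm \<nu> = 1"
  shows "bounded {x. a \<le> x \<bullet> \<nu> \<and> x \<bullet> \<nu> \<le> a + 1 \<and> x - (x \<bullet> \<nu> - a) *\<^sub>R \<nu> \<in> A}"
proof -
  obtain B where B: "\<And>x. x \<in> A \<Longrightarrow> norm x \<le> B" using assms by (auto simp: bounded_iff)
  have "norm x \<le> B + 1" if "a \<le> x \<bullet> \<nu>" "x \<bullet> \<nu> \<le> a + 1" "x - (x \<bullet> \<nu> - a) *\<^sub>R \<nu> \<in> A" for x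
  proof -
    have "norm x \<le> norm (x - (x \<bullet> \<nu> - a) *\<^sub>R \<nu>) + norm ((x \<bullet> \<nu> - a) *\<^sub>R \<nu>)"
      by (metis diff_add_cancel norm_triangle_ineq)
    also have "\<dots> \<le> B + 1" using B[OF that(3)] that assms by (intro add_mono) auto
    finally show ?thesis .
  qed
  then show ?thesis by (auto simp: bounded_iff)
qed

lemma emeasure_hyperplane_measure_bounded:
  fixes \<nu> :: "'a::euclidean_space"
  assumes "norm \<nu> = 1" "bounded A"
  shows "emeasure (hyperplane_measure \<nu> a) A < \<infinity>"
proof (cases "A \<in> sets borel")
  case True
  then show ?thesis
    using emeasure_bounded_finite[OF bounded_slab_preimage[OF assms(2,1)]]
    by (simp add: emeasure_hyperplane_measure)
qed (simp add: emeasure_notin_sets)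

text \<open>The isometry \<open>z \<mapsto> c + R z\<close> carries the slab over
  \<open>z \<bullet> e = 0\<close> to the slab over \<open>x \<bullet> \<nu> = a\<close> and
  commutes with the projections. Computations are thereby reduced to a coordinate
  hyperplane.\<close>

lemma emeasure_hyperplane_measure_rotate:
  fixes \<nu> :: "'a::euclidean_space" and R :: "'a \<Rightarrow> 'a"
  assumes R: "orthogonal_transformation R" "R e = \<nu>" and \<nu>: "norm \<nu> = 1" and c: "c \<bullet> \<nu> = a"
    and A[measurable]: "A \<in> sets borel"
  shows "emeasure (hyperplane_measure \<nu> a) A = emeasure (hyperplane_measure e 0) {z. c + R z \<in> A}"
proof -
  have linR: "linear R" using R by (simp add: orthogonal_transformation_linear)
  then have Rm[measurable]: "R \<in> borel_measurable borel"
    by (simp add: linear_borel_measurable)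
  have RA: "{z. c + R z \<in> A} \<in> sets borel"
    using measurable_sets[of "\<lambda>z. c + R z" borel borel A] by (simp add: vimage_def)
  let ?S = "{x. a \<le> x \<bullet> \<nu> \<and> x \<bullet> \<nu> \<le> a + 1 \<and> x - (x \<bullet> \<nu> - a) *\<^sub>R \<nu> \<in> A}"
  have S: "?S \<in> sets borel" by measurable
  then have S': "(\<lambda>x. c + x) -` ?S \<in> sets borel"
    using measurable_sets[of "\<lambda>x. c + x" borel borel ?S] by simp
  have "emeasure lborel ?S = emeasure lborel (R -` (\<lambda>x. c + x) -` ?S)"
    using volume_factor_emeasure[OF volume_factor_orthogonal[OF R(1)] linR S'] 
      lborel_emeasure_translate[OF S] by simp
  also have "R -` (\<lambda>x. c + x) -` ?S =
    {z. 0 \<le> z \<bullet> e \<and> z \<bullet> e \<le> 0 + 1 \<and> z - (z \<bullet> e - 0) *\<^sub>R e \<in> {z. c + R z \<in> A}}"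
  proof -
    have 1: "(c + R z) \<bullet> \<nu> = a + z \<bullet> e" for z
      using c orthogonal_inner[OF R(1), of z e] by (simp add: inner_add_left R(2))
    have 2: "c + R z - (a + z \<bullet> e - a) *\<^sub>R \<nu> = c + R (z - (z \<bullet> e - 0) *\<^sub>R e)" for z
      by (simp add: linear_diff[OF linR] linear_cmul[OF linR] R(2))
    show ?thesis
      by (rule set_eqI) (simp only: vimage_eq mem_Collect_eq 1 2, simp)
  qed
  finally show ?thesis using RA by (simp add: emeasure_hyperplane_measure)
qed

text \<open>Fubini in direction \<open>e\<close>: the coordinate along \<open>e\<close> runs through
  the unit interval and contributes the factor 1.\<close>

lemma emeasure_hyperplane_measure_Basis:
  fixes e :: "'a::euclidean_space"
  assumes e: "e \<in> Basis" and A[measurable]: "A \<in> sets borel"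
  shows "emeasure (hyperplane_measure e 0) A =
    emeasure (PiM (Basis - {e}) (\<lambda>_. lborel))
      {g \<in> space (PiM (Basis - {e}) (\<lambda>_. lborel)). (\<Sum>b\<in>Basis - {e}. g b *\<^sub>R b) \<in> A}"
proof -
  interpret product_sigma_finite "\<lambda>_::'a. lborel :: real measure" by standard
  let ?J = "Basis - {e}"
  have J: "insert e ?J = Basis" "finite ?J" "e \<notin> ?J" using e by auto
  define F where "F x = indicator {x. 0 \<le> x \<bullet> e \<and> x \<bullet> e \<le> 0 + 1} x * (indicator A (x - (x \<bullet> e - 0) *\<^sub>R e) :: ennreal)" for x
  have F[measurable]: "F \<in> borel_measurable borel" unfolding F_def by measurable
  define X where "X = {g \<in> space (PiM ?J (\<lambda>_. lborel)). (\<Sum>b\<in>?J. g b *\<^sub>R b) \<in> A}"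
  have X: "X \<in> sets (PiM ?J (\<lambda>_. lborel))" unfolding X_def by measurable
  have "emeasure (hyperplane_measure e 0) A = (\<integral>\<^sup>+ x. indicator A x \<partial>hyperplane_measure e 0)"
    by simp
  also have "\<dots> = (\<integral>\<^sup>+ x. F x \<partial>lborel)"
    unfolding F_def by (rule nn_integral_hyperplane_measure) simp
  also have "\<dots> = (\<integral>\<^sup>+ g. F (\<Sum>b\<in>Basis. g b *\<^sub>R b) \<partial>PiM Basis (\<lambda>_. lborel))"
    by (subst lborel_eq, subst nn_integral_distr) auto
  also have "\<dots> = (\<integral>\<^sup>+ g. (\<integral>\<^sup>+ y. F (\<Sum>b\<in>Basis. (g(e := y)) b *\<^sub>R b) \<partial>lborel) \<partial>PiM ?J (\<lambda>_. lborel))"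
    using product_nn_integral_insert[of ?J e "\<lambda>g. F (\<Sum>b\<in>Basis. g b *\<^sub>R b)"] J by simp
  also have "\<dots> = (\<integral>\<^sup>+ g. indicator X g \<partial>PiM ?J (\<lambda>_. lborel))"
  proof (rule nn_integral_cong)
    fix g assume g: "g \<in> space (PiM ?J (\<lambda>_. lborel :: real measure))"
    have "F (\<Sum>b\<in>Basis. (g(e := y)) b *\<^sub>R b) = indicator X g * indicator {0..1} y" for y
    proof -
      have *: "(\<Sum>b\<in>Basis. (g(e := y)) b *\<^sub>R b) = y *\<^sub>R e + (\<Sum>b\<in>?J. g b *\<^sub>R b)"
        by (subst J(1)[symmetric], subst sum.insert) (auto intro!: sum.cong)
      have "(\<Sum>b\<in>?J. g b *\<^sub>R b) \<bullet> e = 0"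
        using e by (auto simp: inner_sum_left inner_Basis intro!: sum.neutral)
      then have "(y *\<^sub>R e + (\<Sum>b\<in>?J. g b *\<^sub>R b)) \<bullet> e = y"
        using e by (simp add: inner_add_left)
      then show ?thesis unfolding * F_def using g by (auto simp: indicator_def X_def)
    qed
    then show "(\<integral>\<^sup>+ y. F (\<Sum>b\<in>Basis. (g(e := y)) b *\<^sub>R b) \<partial>lborel) = indicator X g"
      by (simp add: nn_integral_cmult)
  qed
  also have "\<dots> = emeasure (PiM ?J (\<lambda>_. lborel)) X" using X by simp
  finally show ?thesis unfolding X_def .
qed

lemma norm_sum_Basis_subset:
  fixes J :: "'a::euclidean_space set"
  assumes "J \<subseteq> Basis"
  shows "norm (\<Sum>b\<in>J. g b *\<^sub>R b) = sqrt (\<Sum>b\<in>J. (g b)\<^sup>2)"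
proof -
  let ?x = "\<Sum>b\<in>J. g b *\<^sub>R b"
  have fJ: "finite J" using assms by (rule finite_subset) simp
  have ip: "?x \<bullet> c = (if c \<in> J then g c else 0)" if "c \<in> Basis" for c
  proof -
    have "?x \<bullet> c = (\<Sum>b\<in>J. if b = c then g c else 0)"
      using that assms by (auto simp: inner_sum_left inner_Basis intro!: sum.cong)
    then show ?thesis using fJ by simp
  qed
  have "(norm ?x)\<^sup>2 = (\<Sum>c\<in>Basis. (?x \<bullet> c)\<^sup>2)"
    by (simp add: power2_norm_eq_inner) (subst euclidean_inner, simp add: power2_eq_square)
  also have "\<dots> = (\<Sum>c\<in>Basis. if c \<in> J then (g c)\<^sup>2 else 0)"
    by (intro sum.cong) (auto simp: ip)
  also have "\<dots> = (\<Sum>b\<in>J. (g b)\<^sup>2)" using assms by (simp add: sum.If_cases Int_absorb1)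
  finally show ?thesis by (metis norm_ge_zero real_sqrt_unique)
qed

text \<open>The value is the Hausdorff gauge of the ball. That the gauge is exact on balls centred
  in the plane is what the packing argument for the upper bound uses.\<close>

lemma emeasure_hyperplane_measure_cball:
  fixes \<nu> :: "'a::euclidean_space"
  assumes \<nu>: "norm \<nu> = 1" and c: "c \<bullet> \<nu> = a" and r: "r > 0"
  shows "emeasure (hyperplane_measure \<nu> a) (cball c r) =
    ennreal (unit_ball_vol (real (DIM('a) - 1)) * r ^ (DIM('a) - 1))"
proof -
  obtain e :: 'a where e: "e \<in> Basis" using nonempty_Basis by blast
  obtain R :: "'a \<Rightarrow> 'a" where R: "orthogonal_transformation R" "R e = \<nu>"
    using orthogonal_transformation_between_units[of e \<nu>] e \<nu> by auto
  let ?J = "Basis - {e}" let ?M = "PiM ?J (\<lambda>_. lborel :: real measure)"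
  have "{z. c + R z \<in> cball c r} = cball 0 r"
    using R(1) by (auto simp: dist_norm orthogonal_transformation_norm)
  then have "emeasure (hyperplane_measure \<nu> a) (cball c r) = emeasure (hyperplane_measure e 0) (cball 0 r)"
    using emeasure_hyperplane_measure_rotate[OF R \<nu> c, of "cball c r"] by simp
  also have "\<dots> = emeasure ?M {g \<in> space ?M. (\<Sum>b\<in>?J. g b *\<^sub>R b) \<in> cball 0 r}"
    by (rule emeasure_hyperplane_measure_Basis[OF e]) simp
  also have "{g \<in> space ?M. (\<Sum>b\<in>?J. g b *\<^sub>R b) \<in> cball 0 r} =
      {g. sqrt (\<Sum>i\<in>?J. (g i)\<^sup>2) \<le> r} \<inter> space ?M"
    by (auto simp: norm_sum_Basis_subset)
  also have "emeasure ?M \<dots> = ennreal (unit_ball_vol (real (card ?J)) * r ^ card ?J)"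
    using r by (intro emeasure_cball_aux) auto
  finally show ?thesis using e by simp
qed

text \<open>The isodiametric inequality in coordinates of the plane. Only the part of
  \<open>C\<close> in the plane is measured, and the coordinates preserve distances, so the diameter
  of that part is at most \<open>diameter C\<close>.\<close>

lemma emeasure_hyperplane_measure_le_gauge:
  fixes C :: "'a::euclidean_space set"
  assumes \<nu>: "norm \<nu> = 1" and C[measurable]: "C \<in> sets borel" and b: "bounded C"
  shows "emeasure (hyperplane_measure \<nu> a) C \<le> ennreal (hausdorff_gauge (DIM('a) - 1) C)"
proof (cases "C = {}")
  case False
  obtain e :: 'a where e: "e \<in> Basis" using nonempty_Basis by blast
  obtain R :: "'a \<Rightarrow> 'a" where R: "orthogonal_transformation R" "R e = \<nu>"
    using orthogonal_transformation_between_units[of e \<nu>] e \<nu> by auto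
  have linR: "linear R" using R by (simp add: orthogonal_transformation_linear)
  then have Rm[measurable]: "R \<in> borel_measurable borel"
    by (simp add: linear_borel_measurable)
  let ?J = "Basis - {e}" let ?M = "PiM ?J (\<lambda>_. lborel :: real measure)"
  define c where "c = a *\<^sub>R \<nu>"
  have c: "c \<bullet> \<nu> = a" using \<nu> by (simp add: c_def norm_eq_1)
  have RC[measurable]: "{z. c + R z \<in> C} \<in> sets borel"
    using measurable_sets[of "\<lambda>z. c + R z" borel borel C] by (simp add: vimage_def)
  have "emeasure (hyperplane_measure \<nu> a) C = emeasure (hyperplane_measure e 0) {z. c + R z \<in> C}"
    by (rule emeasure_hyperplane_measure_rotate[OF R \<nu> c C])
  also have "\<dots> = emeasure ?M {g \<in> space ?M. (\<Sum>b\<in>?J. g b *\<^sub>R b) \<in> {z. c + R z \<in> C}}"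
    by (rule emeasure_hyperplane_measure_Basis[OF e RC])
  also have "\<dots> \<le> ennreal (unit_ball_vol (real (card ?J)) * (diameter C / 2) ^ card ?J)"
  proof (rule isodiametric_inequality_PiM)
    show "{g \<in> space ?M. (\<Sum>b\<in>?J. g b *\<^sub>R b) \<in> {z. c + R z \<in> C}} \<in> sets ?M" by measurable
    show "0 \<le> diameter C" using b by (rule diameter_ge_0)
    fix f g :: "'a \<Rightarrow> real"
    assume f: "f \<in> {g \<in> space ?M. (\<Sum>b\<in>?J. g b *\<^sub>R b) \<in> {z. c + R z \<in> C}}"
      and g: "g \<in> {g \<in> space ?M. (\<Sum>b\<in>?J. g b *\<^sub>R b) \<in> {z. c + R z \<in> C}}"
    let ?s = "\<lambda>f. \<Sum>b\<in>?J. f b *\<^sub>R b"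
    have "sqrt (\<Sum>i\<in>?J. (f i - g i)\<^sup>2) = norm (\<Sum>b\<in>?J. (f b - g b) *\<^sub>R b)"
      by (simp add: norm_sum_Basis_subset)
    also have "\<dots> = norm (R (?s f - ?s g))"
      using R(1) by (simp add: orthogonal_transformation_norm scaleR_diff_left sum_subtractf)
    also have "\<dots> = dist (c + R (?s f)) (c + R (?s g))"
      by (simp add: dist_norm linear_diff[OF linR])
    also have "\<dots> \<le> diameter C"
      using f g b by (intro diameter_bounded_bound) auto
    finally show "(\<Sum>i\<in>?J. (f i - g i)\<^sup>2) \<le> (diameter C)\<^sup>2"
      by (simp add: sum_nonneg sqrt_le_D)
  qed auto
  finally show ?thesis using False e by (simp add: hausdorff_gauge_def)
qed (simp add: hausdorff_gauge_def)

section \<open>Hausdorff measure in hyperplanes\<close>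

lemma hausdorff_gauge_cball:
  fixes x :: "'a::euclidean_space"
  assumes "r > 0" shows "hausdorff_gauge m (cball x r) = unit_ball_vol (real m) * r ^ m"
  using assms by (simp add: hausdorff_gauge_def)

lemma hausdorff_gauge_closure: "hausdorff_gauge m (closure C) = hausdorff_gauge m C" if "bounded C"
  using that by (simp add: hausdorff_gauge_def diameter_closure)

lemma hausdorff_content_le_cover:
  fixes C :: "nat \<Rightarrow> 'a::euclidean_space set"
  assumes "\<And>k. bounded (C k)" "\<And>k. diameter (C k) \<le> \<delta>" "A \<subseteq> (\<Union>k. C k)"
  shows "hausdorff_content m \<delta> A \<le> (\<Sum>k. ennreal (hausdorff_gauge m (C k)))"
  unfolding hausdorff_content_def by (rule INF_lower) (use assms in auto)

lemma hausdorff_content_mono: "A \<subseteq> B \<Longrightarrow> hausdorff_content m \<delta> A \<le> hausdorff_content m \<delta> B"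
  unfolding hausdorff_content_def by (rule INF_superset_mono) auto

text \<open>The cover is \<open>C\<close> followed by empty sets, which cost nothing because the
  gauge of the empty set is 0 even for \<open>m = 0\<close>.\<close>

lemma hausdorff_content_le_gauge:
  fixes C :: "'a::euclidean_space set"
  assumes "bounded C" "diameter C \<le> \<delta>" "\<delta> \<ge> 0"
  shows "hausdorff_content m \<delta> C \<le> ennreal (hausdorff_gauge m C)"
proof -
  define E where "E k = (if k = 0 then C else {})" for k :: nat
  have "hausdorff_content m \<delta> C \<le> (\<Sum>k. ennreal (hausdorff_gauge m (E k)))"
  proof (rule hausdorff_content_le_cover)
    show "C \<subseteq> (\<Union>k. E k)" by (auto simp: E_def)
  qed (use assms in \<open>auto simp: E_def\<close>)
  also have "\<dots> = (\<Sum>k\<in>{0}. ennreal (hausdorff_gauge m (E k)))"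
    by (intro suminf_finite) (auto simp: E_def hausdorff_gauge_def)
  finally show ?thesis by (simp add: E_def)
qed

lemma hausdorff_content_Un:
  fixes A B :: "'a::euclidean_space set"
  shows "hausdorff_content m \<delta> (A \<union> B) \<le> hausdorff_content m \<delta> A + hausdorff_content m \<delta> B"
proof (rule ennreal_le_epsilon)
  fix e :: real assume e: "e > 0"
    and fin: "hausdorff_content m \<delta> A + hausdorff_content m \<delta> B < top"
  let ?S = "\<lambda>A. {C :: nat \<Rightarrow> 'a set. (\<forall>k. bounded (C k) \<and> diameter (C k) \<le> \<delta>) \<and> A \<subseteq> (\<Union>k. C k)}"
  have ex: "\<exists>C\<in>?S A. (\<Sum>k. ennreal (hausdorff_gauge m (C k))) < hausdorff_content m \<delta> A + ennreal (e / 2)"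
    if "hausdorff_content m \<delta> A < top" for A
  proof -
    have "hausdorff_content m \<delta> A < hausdorff_content m \<delta> A + ennreal (e / 2)"
      using that e by (cases "hausdorff_content m \<delta> A") (auto simp: ennreal_less_iff simp flip: ennreal_plus)
    then show ?thesis unfolding hausdorff_content_def INF_less_iff .
  qed
  obtain C where C: "C \<in> ?S A" "(\<Sum>k. ennreal (hausdorff_gauge m (C k))) < hausdorff_content m \<delta> A + ennreal (e / 2)"
    using ex[of A] fin by (auto simp: less_top)
  obtain D where D: "D \<in> ?S B" "(\<Sum>k. ennreal (hausdorff_gauge m (D k))) < hausdorff_content m \<delta> B + ennreal (e / 2)"
    using ex[of B] fin by (auto simp: less_top)
  \<comment> \<open>Interleaving: even indices run through the cover of \<open>A\<close>, odd ones
    through the cover of \<open>B\<close>.\<close>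
  define E where "E k = (if even k then C (k div 2) else D (k div 2))" for k
  let ?g = "\<lambda>C k. ennreal (hausdorff_gauge m (C k))"
  have "hausdorff_content m \<delta> (A \<union> B) \<le> (\<Sum>k. ?g E k)"
  proof (rule hausdorff_content_le_cover)
    show "A \<union> B \<subseteq> (\<Union>k. E k)"
    proof
      fix x assume "x \<in> A \<union> B"
      then obtain k where "x \<in> C k \<or> x \<in> D k" using C D by blast
      moreover have "E (2 * k) = C k" "E (2 * k + 1) = D k" by (auto simp: E_def)
      ultimately show "x \<in> (\<Union>k. E k)" by blast
    qed
  qed (use C D in \<open>auto simp: E_def\<close>)
  also have "\<dots> \<le> (\<Sum>k. ?g C k) + (\<Sum>k. ?g D k)"
  proof (rule suminf_le_const)
    fix n
    have "(\<Sum>k<2 * n. ?g E k) = (\<Sum>k<n. ?g C k) + (\<Sum>k<n. ?g D k)"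
      by (induction n) (auto simp: E_def algebra_simps)
    moreover have "(\<Sum>k<n. ?g E k) \<le> (\<Sum>k<2 * n. ?g E k)" by (intro sum_mono2) auto
    moreover have "(\<Sum>k<n. ?g C k) + (\<Sum>k<n. ?g D k) \<le> (\<Sum>k. ?g C k) + (\<Sum>k. ?g D k)"
      by (intro add_mono sum_le_suminf) auto
    ultimately show "(\<Sum>k<n. ?g E k) \<le> (\<Sum>k. ?g C k) + (\<Sum>k. ?g D k)" by simp
  qed auto
  also have "\<dots> \<le> (hausdorff_content m \<delta> A + ennreal (e / 2)) + (hausdorff_content m \<delta> B + ennreal (e / 2))"
    using C(2) D(2) by (intro add_mono) auto
  also have "\<dots> = hausdorff_content m \<delta> A + hausdorff_content m \<delta> B + ennreal e"
  proof -
    have "ennreal e = ennreal (e / 2) + ennreal (e / 2)" using e by (simp flip: ennreal_plus)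
    then show ?thesis by (simp add: ac_simps)
  qed
  finally show "hausdorff_content m \<delta> (A \<union> B) \<le> hausdorff_content m \<delta> A + hausdorff_content m \<delta> B + ennreal e" .
qed

lemma hausdorff_content_Un_UN:
  fixes A :: "'a::euclidean_space set"
  assumes "finite F" "\<And>i. i \<in> F \<Longrightarrow> bounded (C i) \<and> diameter (C i) \<le> \<delta>" "\<delta> \<ge> 0"
  shows "hausdorff_content m \<delta> (A \<union> (\<Union>i\<in>F. C i)) \<le>
    hausdorff_content m \<delta> A + (\<Sum>i\<in>F. ennreal (hausdorff_gauge m (C i)))"
  using assms(1,2)
proof (induction F rule: finite_induct)
  case (insert i F)
  have "hausdorff_content m \<delta> (A \<union> (\<Union>i\<in>insert i F. C i)) \<le>
      hausdorff_content m \<delta> (C i) + hausdorff_content m \<delta> (A \<union> (\<Union>i\<in>F. C i))"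
    using hausdorff_content_Un[of m \<delta> "C i" "A \<union> (\<Union>i\<in>F. C i)"] by (simp add: Un_left_commute)
  also have "\<dots> \<le> ennreal (hausdorff_gauge m (C i)) +
      (hausdorff_content m \<delta> A + (\<Sum>i\<in>F. ennreal (hausdorff_gauge m (C i))))"
    using insert assms(3) by (intro add_mono hausdorff_content_le_gauge) auto
  finally show ?case using insert by (simp add: ac_simps)
qed simp

text \<open>Closing the members of a cover makes them measurable and changes neither diameter nor
  gauge; the isodiametric bound then applies to each of them.\<close>

lemma hyperplane_measure_le_hausdorff_measure:
  fixes K :: "'a::euclidean_space set"
  assumes \<nu>: "norm \<nu> = 1" and K: "K \<in> sets borel"
  shows "emeasure (hyperplane_measure \<nu> a) K \<le> hausdorff_measure (DIM('a) - 1) K"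
proof -
  let ?\<sigma> = "hyperplane_measure \<nu> a"
  \<comment> \<open>One scale is enough, since the Hausdorff measure is a supremum over scales; 1 is
    an arbitrary choice.\<close>
  have "emeasure ?\<sigma> K \<le> hausdorff_content (DIM('a) - 1) 1 K"
    unfolding hausdorff_content_def
  proof (rule INF_greatest)
    fix C :: "nat \<Rightarrow> 'a set"
    assume C: "C \<in> {C. (\<forall>k. bounded (C k) \<and> diameter (C k) \<le> 1) \<and> K \<subseteq> (\<Union>k. C k)}"
    have "emeasure ?\<sigma> K \<le> emeasure ?\<sigma> (\<Union>k. closure (C k))"
      using C closure_subset by (intro emeasure_mono) (auto, blast)
    also have "\<dots> \<le> (\<Sum>k. emeasure ?\<sigma> (closure (C k)))"
      by (intro emeasure_subadditive_countably) auto
    also have "\<dots> \<le> (\<Sum>k. ennreal (hausdorff_gauge (DIM('a) - 1) (C k)))"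
    proof (rule suminf_le)
      fix k
      have b: "bounded (C k)" using C by blast
      show "emeasure ?\<sigma> (closure (C k)) \<le> ennreal (hausdorff_gauge (DIM('a) - 1) (C k))"
        using emeasure_hyperplane_measure_le_gauge[OF \<nu>, of "closure (C k)" a] b
        by (simp add: hausdorff_gauge_closure bounded_closure)
    qed auto
    finally show "emeasure ?\<sigma> K \<le> (\<Sum>k. ennreal (hausdorff_gauge (DIM('a) - 1) (C k)))" .
  qed
  also have "\<dots> \<le> hausdorff_measure (DIM('a) - 1) K"
    unfolding hausdorff_measure_def by (rule SUP_upper) simp
  finally show ?thesis .
qed

text \<open>Vitali's covering lemma for small balls centred in the plane. The factor 10 gives even
  the fivefold balls a diameter of at most \<delta>, so that they are admissible in the content. The
  family is countable and possibly finite, hence the index set \<open>N\<close>.\<close>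

lemma hyperplane_Vitali_cover:
  fixes U :: "'a::euclidean_space set"
  assumes U: "open U" and \<delta>: "\<delta> > 0"
  obtains N :: "nat set" and x :: "nat \<Rightarrow> 'a" and r :: "nat \<Rightarrow> real"
  where "\<forall>n\<in>N. x n \<bullet> \<nu> = a" "\<forall>n\<in>N. 0 < r n \<and> 10 * r n \<le> \<delta>"
    "\<forall>n\<in>N. cball (x n) (r n) \<subseteq> U"
    "disjoint_family_on (\<lambda>n. cball (x n) (r n)) N"
    "U \<inter> {x. x \<bullet> \<nu> = a} \<subseteq> (\<Union>n\<in>N. cball (x n) (5 * r n))"
proof -
  let ?K = "U \<inter> {x. x \<bullet> \<nu> = a}"
  have "\<exists>r>0. 10 * r \<le> \<delta> \<and> cball x r \<subseteq> U" if x: "x \<in> ?K" for x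
  proof -
    obtain s where "s > 0" "cball x s \<subseteq> U" using x U by (auto simp: open_contains_cball_eq)
    moreover have "cball x (min s (\<delta> / 10)) \<subseteq> cball x s" by (rule subset_cball) simp
    ultimately show ?thesis using \<delta> by (intro exI[of _ "min s (\<delta> / 10)"]) auto
  qed
  then obtain r where r: "\<And>x. x \<in> ?K \<Longrightarrow> r x > 0 \<and> 10 * r x \<le> \<delta> \<and> cball x (r x) \<subseteq> U" by metis
  have sub: "?K \<subseteq> (\<Union>x\<in>?K. cball x (r x))"
  proof
    fix x assume "x \<in> ?K"
    with r[of x] show "x \<in> (\<Union>x\<in>?K. cball x (r x))" by (intro UN_I[of x]) auto
  qed
  have bnd: "0 < r x \<and> r x \<le> \<delta>" if "x \<in> ?K" for x using r[OF that] by linarith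
  obtain C where C: "countable C" "C \<subseteq> ?K"
    "pairwise (\<lambda>i j. disjnt (cball i (r i)) (cball j (r j))) C"
    "?K \<subseteq> (\<Union>i\<in>C. cball i (5 * r i))"
    by (rule Vitali_covering_lemma_cballs[where a="\<lambda>x. x", OF sub bnd]) (assumption, rule that, assumption+)
  let ?x = "from_nat_into C"
  define N where "N = to_nat_on C ` C"
  have xN: "?x n \<in> C" if "n \<in> N" for n using that C(1) by (auto simp: N_def)
  have xinj: "?x n \<noteq> ?x n'" if "n \<in> N" "n' \<in> N" "n \<noteq> n'" for n n'
    using that C(1) by (auto simp: N_def)
  show ?thesis
  proof (rule that[of N ?x "\<lambda>n. r (?x n)"])
    show "disjoint_family_on (\<lambda>n. cball (?x n) (r (?x n))) N"
      using C(3) xN xinj by (auto simp: disjoint_family_on_def pairwise_def disjnt_def) 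
    show "?K \<subseteq> (\<Union>n\<in>N. cball (?x n) (5 * r (?x n)))"
      using C(1,4) by (auto simp: N_def)
  qed (use subsetD[OF C(2) xN] r in auto)
qed

text \<open>
  If the content of relatively open sets is at most \<open>q\<close> times their measure, then packing a
  fixed proportion \<open>\<theta>\<close> of such a set with balls, for which the two quantities agree, improves \<open>q\<close>.
\<close>

lemma hausdorff_content_open_le:
  fixes \<nu> :: "'a::euclidean_space" and a :: real
  defines "m \<equiv> DIM('a) - 1" and "P \<equiv> {x. x \<bullet> \<nu> = a}" and "\<sigma> \<equiv> hyperplane_measure \<nu> a"
  assumes \<nu>: "norm \<nu> = 1" and \<delta>: "\<delta> > 0" and U: "open U" "bounded U"
  shows "hausdorff_content m \<delta> (U \<inter> P) \<le> ennreal ((1 + (1 - 1 / (2 * 5 ^ m)) ^ k * (5 ^ m - 1)) * measure \<sigma> U)"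
  using U
proof (induction k arbitrary: U)
  let ?w = "unit_ball_vol (real m)"
  have w: "?w \<ge> 0" by simp
  have vol: "emeasure \<sigma> (cball x r) = ennreal (?w * r ^ m)" if "x \<bullet> \<nu> = a" "r > 0" for x r
    unfolding \<sigma>_def m_def using emeasure_hyperplane_measure_cball[OF \<nu> that] .
  have sets[simp]: "sets \<sigma> = sets borel" by (simp add: \<sigma>_def)
  have fin: "emeasure \<sigma> V = ennreal (measure \<sigma> V)" if "bounded V" for V
    using emeasure_hyperplane_measure_bounded[OF \<nu> that, of a]
    by (intro emeasure_eq_ennreal_measure) (auto simp: \<sigma>_def)
  have offP: "emeasure \<sigma> V = emeasure \<sigma> (V \<inter> P)" if "V \<in> sets borel" for V
  proof (rule emeasure_eq_AE)
    have "{x. x \<bullet> \<nu> \<noteq> a} \<in> null_sets \<sigma>"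
      using emeasure_hyperplane_measure_off_plane[OF \<nu>, of a] by (auto simp: null_sets_def \<sigma>_def)
    then show "AE x in \<sigma>. (x \<in> V) = (x \<in> V \<inter> P)"
      by (rule AE_I') (auto simp: P_def)
  qed (use that in \<open>auto simp: P_def\<close>)
  {
    \<comment> \<open>For \<open>k = 0\<close> the claimed factor is \<open>5 ^ m\<close>: the
      fivefold balls cover, and their gauges are \<open>5 ^ m\<close> times the measures of the
      disjoint balls inside \<open>U\<close>.\<close>
    case (0 U)
    obtain N :: "nat set" and x :: "nat \<Rightarrow> 'a" and r :: "nat \<Rightarrow> real" where N': "\<forall>n\<in>N. x n \<bullet> \<nu> = a" "\<forall>n\<in>N. 0 < r n \<and> 10 * r n \<le> \<delta>"
      "\<forall>n\<in>N. cball (x n) (r n) \<subseteq> U"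
      "disjoint_family_on (\<lambda>n. cball (x n) (r n)) N"
      "U \<inter> P \<subseteq> (\<Union>n\<in>N. cball (x n) (5 * r n))"
      by (rule hyperplane_Vitali_cover[OF 0(1) \<delta>, of \<nu> a, folded P_def]) (rule that, assumption+)
    note N = N'(1-3)[rule_format] N'(4,5)
    define B where "B n = (if n \<in> N then cball (x n) (r n) else {})" for n
    define B5 where "B5 n = (if n \<in> N then cball (x n) (5 * r n) else {})" for n
    have B5: "ennreal (hausdorff_gauge m (B5 n)) = ennreal (5 ^ m) * emeasure \<sigma> (B n)" for n
    proof (cases "n \<in> N")
      case True
      then show ?thesis using N(1)[OF True] N(2)[OF True]
        by (simp add: B5_def B_def hausdorff_gauge_cball vol power_mult_distrib ennreal_mult[symmetric] mult_ac)
    qed (simp add: B_def B5_def hausdorff_gauge_def)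
    have "hausdorff_content m \<delta> (U \<inter> P) \<le> (\<Sum>n. ennreal (hausdorff_gauge m (B5 n)))"
    proof (rule hausdorff_content_le_cover)
      show "diameter (B5 n) \<le> \<delta>" for n using N(2)[of n] \<delta> by (auto simp: B5_def)
    qed (use N(5) in \<open>auto simp: B5_def\<close>)
    also have "\<dots> = ennreal (5 ^ m) * (\<Sum>n. emeasure \<sigma> (B n))"
      unfolding B5 by simp
    also have "(\<Sum>n. emeasure \<sigma> (B n)) = emeasure \<sigma> (\<Union>n. B n)"
      using N(4) by (intro suminf_emeasure) (auto simp: B_def disjoint_family_on_def)
    also have "\<dots> \<le> emeasure \<sigma> U"
      using N(3) 0 by (intro emeasure_mono) (auto simp: B_def split: if_splits)
    finally have "hausdorff_content m \<delta> (U \<inter> P) \<le> ennreal (5 ^ m) * emeasure \<sigma> U"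
      by (simp add: mult_left_mono)
    then show ?case using fin[OF 0(2)] by (simp add: ennreal_mult)
  next
    case (Suc k U)
    \<comment> \<open>The fivefold balls cover, so the disjoint balls carry at least the fraction
      \<open>1 / 5 ^ m\<close> of the measure of \<open>U\<close>; the extra factor 2 pays for
      keeping only finitely many of them.\<close>
    define \<theta> :: real where "\<theta> = 1 / (2 * 5 ^ m)"
    define q where "q = 1 + (1 - \<theta>) ^ k * (5 ^ m - 1)"
    have \<theta>: "0 < \<theta>" "\<theta> < 1"
    proof -
      have "(1::real) \<le> 5 ^ m" by (rule one_le_power) simp
      then have "(1::real) < 2 * 5 ^ m" by linarith
      then show "0 < \<theta>" "\<theta> < 1" by (simp_all add: \<theta>_def divide_less_eq)
    qed
    have q: "q \<ge> 1" using \<theta> by (simp add: q_def)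
    show ?case
    proof (cases "measure \<sigma> U = 0")
      case True
      then show ?thesis using Suc by fastforce
    next
      case False
      then have U0: "measure \<sigma> U > 0" by (simp add: zero_less_measure_iff)
      obtain N :: "nat set" and x :: "nat \<Rightarrow> 'a" and r :: "nat \<Rightarrow> real" where N': "\<forall>n\<in>N. x n \<bullet> \<nu> = a" "\<forall>n\<in>N. 0 < r n \<and> 10 * r n \<le> \<delta>"
        "\<forall>n\<in>N. cball (x n) (r n) \<subseteq> U"
        "disjoint_family_on (\<lambda>n. cball (x n) (r n)) N"
        "U \<inter> P \<subseteq> (\<Union>n\<in>N. cball (x n) (5 * r n))"
        by (rule hyperplane_Vitali_cover[OF Suc.prems(1) \<delta>, of \<nu> a, folded P_def]) (rule that, assumption+)
      note N = N'(1-3)[rule_format] N'(4,5)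
      define B where "B n = (if n \<in> N then cball (x n) (r n) else {})" for n
      define B5 where "B5 n = (if n \<in> N then cball (x n) (5 * r n) else {})" for n
      have B5: "emeasure \<sigma> (B5 n) = ennreal (5 ^ m) * emeasure \<sigma> (B n)" for n
      proof (cases "n \<in> N")
        case True
        then show ?thesis using N(1)[OF True] N(2)[OF True]
          by (simp add: B5_def B_def vol power_mult_distrib ennreal_mult[symmetric] mult_ac)
      qed (simp add: B_def B5_def)
      have gB: "ennreal (hausdorff_gauge m (B n)) = emeasure \<sigma> (B n)" for n
        using N(1,2)[of n] by (auto simp: B_def hausdorff_gauge_cball vol) (simp add: hausdorff_gauge_def)
      have Bb: "B n \<in> sets borel" "bounded (B n)" "closed (B n)" "B n \<subseteq> U" for n 
        using N(3) by (auto simp: B_def)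
      have BB5: "B5 n \<in> sets borel" for n by (auto simp: B5_def)
      have "emeasure \<sigma> U = emeasure \<sigma> (U \<inter> P)" using Suc by (intro offP) auto
      also have "\<dots> \<le> emeasure \<sigma> (\<Union>n. B5 n)"
        using N(5) BB5 by (intro emeasure_mono) (auto simp: B5_def)
      also have "\<dots> \<le> (\<Sum>n. emeasure \<sigma> (B5 n))"
        using BB5 by (intro emeasure_subadditive_countably) auto
      finally have "emeasure \<sigma> U \<le> ennreal (5 ^ m) * (\<Sum>n. emeasure \<sigma> (B n))"
        unfolding B5 by simp
      moreover have "ennreal (measure \<sigma> U / 2) < emeasure \<sigma> U"
        using U0 unfolding fin[OF Suc.prems(2)] by (simp add: ennreal_less_iff)
      ultimately have "ennreal (measure \<sigma> U / 2) < (SUP M. ennreal (5 ^ m) * (\<Sum>n<M. emeasure \<sigma> (B n)))"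
        by (simp add: suminf_eq_SUP SUP_mult_left_ennreal)
      then obtain M where M: "ennreal (measure \<sigma> U / 2) < ennreal (5 ^ m) * (\<Sum>n<M. emeasure \<sigma> (B n))"
        by (auto simp: less_SUP_iff)
      \<comment> \<open>A finite union of closed balls is closed, so \<open>U - D\<close> is open
        and the induction hypothesis applies to it.\<close>
      define D where "D = (\<Union>n<M. B n)"
      have D: "closed D" "bounded D" "D \<subseteq> U" using Bb by (auto simp: D_def)
      have sD: "(\<Sum>n<M. emeasure \<sigma> (B n)) = emeasure \<sigma> D"
        unfolding D_def using N(4) Bb
        by (intro sum_emeasure) (auto simp: B_def disjoint_family_on_def)
      define s where "s = measure \<sigma> D"
      have "measure \<sigma> U / 2 < 5 ^ m * s"
        using M U0 unfolding sD fin[OF D(2)] s_def by (simp add: ennreal_mult[symmetric] ennreal_less_iff)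
      then have s\<theta>: "\<theta> * measure \<sigma> U \<le> s" by (simp add: \<theta>_def field_simps)
      have UD: "open (U - D)" "bounded (U - D)" using Suc.prems D by (auto simp: open_Diff bounded_diff)
      have mUD: "measure \<sigma> (U - D) = measure \<sigma> U - s"
        unfolding s_def using fin[OF Suc.prems(2)] D Suc.prems by (intro measure_Diff) auto
      have sU: "s \<le> measure \<sigma> U" using mUD measure_nonneg[of \<sigma> "U - D"] by linarith
      have "hausdorff_content m \<delta> (U \<inter> P) \<le> hausdorff_content m \<delta> (((U - D) \<inter> P) \<union> (\<Union>n\<in>{..<M}. B n))"
        by (intro hausdorff_content_mono) (auto simp: D_def)
      also have "\<dots> \<le> hausdorff_content m \<delta> ((U - D) \<inter> P) + (\<Sum>n<M. ennreal (hausdorff_gauge m (B n)))"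
      proof (rule hausdorff_content_Un_UN)
        fix n
        show "bounded (B n) \<and> diameter (B n) \<le> \<delta>"
          using Bb(2)[of n] N(2)[of n] \<delta> by (auto simp: B_def)
      qed (use \<delta> in auto)
      also have "\<dots> \<le> ennreal (q * measure \<sigma> (U - D)) + ennreal s"
        unfolding gB sD fin[OF D(2)] s_def q_def \<theta>_def using Suc.IH[OF UD] by (intro add_mono) auto
      also have "\<dots> = ennreal (q * (measure \<sigma> U - s) + s)"
        unfolding mUD using q sU by (subst ennreal_plus) (auto simp: s_def)
      \<comment> \<open>The factor \<open>q\<close> is paid only off \<open>D\<close>. With
        \<open>M\<close> for the measure of \<open>U\<close>,
        \<open>q * (M - s) + s = q * M - (q - 1) * s\<close>, and \<open>s\<close> is at least
        \<open>\<theta> * M\<close>.\<close>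
      also have "\<dots> \<le> ennreal ((1 + (1 - \<theta>) * (q - 1)) * measure \<sigma> U)"
      proof (rule ennreal_leI)
        have "(q - 1) * (\<theta> * measure \<sigma> U) \<le> (q - 1) * s" using q s\<theta> by (intro mult_left_mono) auto
        then show "q * (measure \<sigma> U - s) + s \<le> (1 + (1 - \<theta>) * (q - 1)) * measure \<sigma> U"
          by (simp add: algebra_simps)
      qed
      also have "1 + (1 - \<theta>) * (q - 1) = 1 + (1 - \<theta>) ^ Suc k * (5 ^ m - 1)"
        by (simp add: q_def mult.assoc)
      finally show ?thesis by (simp add: \<theta>_def)
    qed
  }
qed

text \<open>Letting \<open>k\<close> grow drives the factor in
  \<open>hausdorff_content_open_le\<close> to 1, so at every scale the content of a bounded
  relatively open set is at most its area. A compact set inherits this from shrinking open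
  neighbourhoods, whose areas are finite and decrease to its own.\<close>

theorem hausdorff_measure_eq_hyperplane_measure:
  fixes K :: "'a::euclidean_space set"
  assumes \<nu>: "norm \<nu> = 1" and K: "compact K" "K \<subseteq> {x. x \<bullet> \<nu> = a}"
  shows "hausdorff_measure (DIM('a) - 1) K = emeasure (hyperplane_measure \<nu> a) K"
proof (rule antisym)
  let ?m = "DIM('a) - 1" and ?\<sigma> = "hyperplane_measure \<nu> a"
  show "emeasure ?\<sigma> K \<le> hausdorff_measure ?m K"
    using K by (intro hyperplane_measure_le_hausdorff_measure[OF \<nu>]) (auto simp: compact_imp_closed)
  show "hausdorff_measure ?m K \<le> emeasure ?\<sigma> K"
    unfolding hausdorff_measure_def
  proof (rule SUP_least)
    fix \<delta> :: real assume "\<delta> \<in> {0<..}"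
    then have \<delta>: "\<delta> > 0" by simp
    have U: "hausdorff_content ?m \<delta> (U \<inter> {x. x \<bullet> \<nu> = a}) \<le> emeasure ?\<sigma> U" if U: "open U" "bounded U" for U
    proof -
      have "(1::real) \<le> 5 ^ ?m" by (rule one_le_power) simp
      then have "(1::real) \<le> 2 * 5 ^ ?m" by linarith
      then have "0 < 1 / (2 * 5 ^ ?m :: real) \<and> 1 / (2 * 5 ^ ?m) \<le> (1::real)"
        by (simp add: divide_le_eq del: One_nat_def)
      then have "(\<lambda>k. (1 - 1 / (2 * 5 ^ ?m) :: real) ^ k) \<longlonglongrightarrow> 0"
        by (intro LIMSEQ_realpow_zero) auto
      then have "(\<lambda>k. ennreal ((1 + (1 - 1 / (2 * 5 ^ ?m)) ^ k * (5 ^ ?m - 1)) * measure ?\<sigma> U))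
        \<longlonglongrightarrow> ennreal ((1 + 0 * (5 ^ ?m - 1)) * measure ?\<sigma> U)"
        by (intro tendsto_ennrealI tendsto_mult tendsto_add tendsto_const)
      then have "hausdorff_content ?m \<delta> (U \<inter> {x. x \<bullet> \<nu> = a}) \<le> ennreal ((1 + 0 * (5 ^ ?m - 1)) * measure ?\<sigma> U)"
        by (rule tendsto_lowerbound) (use hausdorff_content_open_le[OF \<nu> \<delta> U] in auto)
      also have "\<dots> = emeasure ?\<sigma> U"
        using emeasure_hyperplane_measure_bounded[OF \<nu> U(2), of a]
        by (simp add: emeasure_eq_ennreal_measure)
      finally show ?thesis .
    qed
    show "hausdorff_content ?m \<delta> K \<le> emeasure ?\<sigma> K"
    proof (cases "K = {}")
      case True
      then show ?thesis using hausdorff_content_le_gauge[of "{}::'a set" \<delta> ?m] \<delta>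
        by (simp add: hausdorff_gauge_def)
    next
      case False
      define V where "V n = {x. infdist x K < 1 / real (Suc n)}" for n
      have oV: "open (V n)" for n
        unfolding V_def by (intro open_Collect_less continuous_intros)
      have bV: "bounded (V n)" for n
      proof -
        obtain B where B: "\<And>x. x \<in> K \<Longrightarrow> norm x \<le> B"
          using compact_imp_bounded[OF K(1)] by (auto simp: bounded_iff)
        have "norm x \<le> B + 1" if "x \<in> V n" for x
        proof -
          obtain y where y: "y \<in> K" "infdist x K = dist x y"
            using infdist_attains_inf[OF compact_imp_closed[OF K(1)] False] by blast
          have "dist x y < 1 / real (Suc n)" using that y by (simp add: V_def)
          also have "\<dots> \<le> 1" by simp
          finally have "dist x y \<le> 1" by simp
          then show ?thesis using B[OF y(1)] norm_triangle_sub[of x y] by (simp add: dist_norm)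
        qed
        then show ?thesis by (auto simp: bounded_iff)
      qed
      have KV: "K \<subseteq> V n" for n by (auto simp: V_def)
      have "(\<Inter>n. V n) = K"
      proof (intro antisym subsetI)
        fix x assume x: "x \<in> (\<Inter>n. V n)"
        have "infdist x K \<le> 0"
        proof (rule ccontr)
          assume "\<not> infdist x K \<le> 0"
          then obtain n where "inverse (real (Suc n)) < infdist x K"
            using reals_Archimedean[of "infdist x K"] by auto
          moreover have "infdist x K < 1 / real (Suc n)" using x by (auto simp: V_def)
          ultimately show False by (simp add: inverse_eq_divide)
        qed
        then show "x \<in> K"
          using in_closed_iff_infdist_zero[OF compact_imp_closed[OF K(1)] False] infdist_nonneg[of x K]
          by (metis order_antisym)
      qed (use KV in auto)
      moreover have "(\<lambda>n. emeasure ?\<sigma> (V n)) \<longlonglongrightarrow> emeasure ?\<sigma> (\<Inter>n. V n)"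
      proof (rule Lim_emeasure_decseq)
        show "decseq V"
        proof (intro decseq_SucI subsetI)
          fix n x assume "x \<in> V (Suc n)"
          then have "infdist x K < 1 / real (Suc (Suc n))" by (simp add: V_def)
          also have "\<dots> \<le> 1 / real (Suc n)" by (intro divide_left_mono) auto
          finally show "x \<in> V n" by (simp add: V_def)
        qed
      qed (use oV emeasure_hyperplane_measure_bounded[OF \<nu> bV, of a] in \<open>auto simp: less_top\<close>)
      ultimately have lim: "(\<lambda>n. emeasure ?\<sigma> (V n)) \<longlonglongrightarrow> emeasure ?\<sigma> K" by simp
      have le: "hausdorff_content ?m \<delta> K \<le> emeasure ?\<sigma> (V n)" for n
      proof -
        have "hausdorff_content ?m \<delta> K \<le> hausdorff_content ?m \<delta> (V n \<inter> {x. x \<bullet> \<nu> = a})"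
          using KV[of n] K(2) by (intro hausdorff_content_mono) auto
        also have "\<dots> \<le> emeasure ?\<sigma> (V n)" by (rule U[OF oV bV])
        finally show ?thesis .
      qed
      show ?thesis by (rule LIMSEQ_le_const[OF lim]) (use le in auto)
    qed
  qed
qed

section \<open>Flux through an interface\<close>

lemma integral_hyperplane_measure:
  fixes f :: "'a::euclidean_space \<Rightarrow> real"
  assumes [measurable]: "f \<in> borel_measurable borel"
  shows "(\<integral>x. f x \<partial>hyperplane_measure \<nu> a) =
    (\<integral>x. indicator {x. a \<le> x \<bullet> \<nu> \<and> x \<bullet> \<nu> \<le> a + 1} x * f (x - (x \<bullet> \<nu> - a) *\<^sub>R \<nu>) \<partial>lborel)"
proof -
  let ?S = "{x. a \<le> x \<bullet> \<nu> \<and> x \<bullet> \<nu> \<le> a + 1}"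
  have "density lborel (indicator ?S) = density lborel (\<lambda>x. ennreal (indicator ?S x))"
    by (simp add: ennreal_indicator)
  then have "(\<integral>x. f x \<partial>hyperplane_measure \<nu> a) =
      (\<integral>x. f x \<partial>distr (density lborel (\<lambda>x. ennreal (indicator ?S x))) borel (\<lambda>x. x - (x \<bullet> \<nu> - a) *\<^sub>R \<nu>))"
    by (simp add: hyperplane_measure_def)
  also have "\<dots> = (\<integral>x. f (x - (x \<bullet> \<nu> - a) *\<^sub>R \<nu>) \<partial>density lborel (\<lambda>x. ennreal (indicator ?S x)))"
    by (subst integral_distr) auto
  also have "\<dots> = (\<integral>x. indicator ?S x *\<^sub>R f (x - (x \<bullet> \<nu> - a) *\<^sub>R \<nu>) \<partial>lborel)"
    by (subst integral_density) auto
  finally show ?thesis by simp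
qed

text \<open>The convex hull of \<open>q\<close> and of the flat disc of radius \<open>e\<close>
  around \<open>y\<close> is a cone with apex below the plane; near \<open>y\<close> it fills the
  whole lower side.\<close>

lemma half_ball_in_convex:
  fixes P :: "'a::euclidean_space set"
  assumes P: "convex P" and q: "q \<in> P" "q \<bullet> \<nu> < a" and e: "e > 0"
    and y: "y \<bullet> \<nu> = a" and \<nu>: "norm \<nu> = 1"
    and plane: "\<And>v. v \<bullet> \<nu> = 0 \<Longrightarrow> norm v < e \<Longrightarrow> y + v \<in> P"
  obtains r where "r > 0" "\<And>x. norm (x - y) < r \<Longrightarrow> x \<bullet> \<nu> \<le> a \<Longrightarrow> x \<in> P"
proof -
  define s0 where "s0 = a - q \<bullet> \<nu>"
  have s0: "s0 > 0" using q by (simp add: s0_def)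
  \<comment> \<open>A point \<open>x\<close> near \<open>y\<close> lies on the segment from
    \<open>q\<close> to a point \<open>u\<close> of the plane, with weight \<open>l < 1 / 2\<close>
    at \<open>q\<close> by the first bound in \<open>r\<close>. Then \<open>norm (u - y)\<close> is
    at most \<open>2 * k * norm (x - y)\<close>, which the second bound keeps below
    \<open>e\<close>.\<close>
  define k where "k = 1 + norm (q - y) / s0"
  have k: "k \<ge> 1" using s0 by (simp add: k_def)
  define r where "r = min (s0 / 2) (e / (2 * k))"
  have r: "r > 0" using s0 k e by (simp add: r_def)
  have "x \<in> P" if x: "norm (x - y) < r" "x \<bullet> \<nu> \<le> a" for x
  proof -
    define s where "s = a - x \<bullet> \<nu>"
    define l where "l = s / s0"
    have s: "s \<ge> 0" "s \<le> norm (x - y)"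
    proof -
      have "s = (y - x) \<bullet> \<nu>" by (simp add: s_def y inner_diff_left)
      also have "\<dots> \<le> norm (y - x) * norm \<nu>" by (rule norm_cauchy_schwarz)
      finally show "s \<le> norm (x - y)" using \<nu> by (simp add: norm_minus_commute)
    qed (use x in \<open>simp add: s_def\<close>)
    have l: "0 \<le> l" "l < 1 / 2" "l * s0 = s"
      using s s0 x by (auto simp: l_def r_def divide_simps)
    define u where "u = (1 / (1 - l)) *\<^sub>R (x - l *\<^sub>R q)"
    have u1: "(1 - l) *\<^sub>R u = x - l *\<^sub>R q" using l by (simp add: u_def)
    then have xu: "x = (1 - l) *\<^sub>R u + l *\<^sub>R q" by simp
    have un: "(1 - l) * (u \<bullet> \<nu>) = (1 - l) * a"
    proof -
      have "(1 - l) * (u \<bullet> \<nu>) = x \<bullet> \<nu> - l * (q \<bullet> \<nu>)"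
        using l by (simp add: u_def inner_diff_left)
      also have "\<dots> = (a - s) - l * (a - s0)" by (simp add: s_def s0_def)
      also have "\<dots> = (1 - l) * a" using l(3) by (simp add: algebra_simps)
      finally show ?thesis .
    qed
    then have "u \<bullet> \<nu> = a" using l by simp
    have "(1 - l) *\<^sub>R (u - y) = (x - y) - l *\<^sub>R (q - y)"
      by (simp add: scaleR_diff_right u1) (simp add: algebra_simps)
    moreover have "norm ((1 - l) *\<^sub>R (u - y)) = (1 - l) * norm (u - y)" using l by simp
    ultimately have "(1 - l) * norm (u - y) = norm ((x - y) - l *\<^sub>R (q - y))" by metis
    also have "\<dots> \<le> norm (x - y) + l * norm (q - y)"
      using norm_triangle_ineq4[of "x - y" "l *\<^sub>R (q - y)"] l by simp
    also have "\<dots> \<le> norm (x - y) + (norm (x - y) / s0) * norm (q - y)"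
      using s s0 by (intro add_left_mono mult_right_mono) (auto simp: l_def divide_right_mono)
    also have "\<dots> = norm (x - y) * k" by (simp add: k_def algebra_simps)
    also have "\<dots> < e / (2 * k) * k"
      using x(1) k by (intro mult_strict_right_mono) (auto simp: r_def)
    also have "\<dots> = e / 2" using k by simp
    finally have 1: "(1 - l) * norm (u - y) < e / 2" .
    have "(1 / 2) * norm (u - y) \<le> (1 - l) * norm (u - y)"
      using l by (intro mult_right_mono) auto
    with 1 have "norm (u - y) < e" by linarith
    then have "y + (u - y) \<in> P" using \<open>u \<bullet> \<nu> = a\<close> y by (intro plane) (auto simp: inner_diff_left)
    then have "u \<in> P" by simp
    then show ?thesis unfolding xu using P q(1) l by (intro convexD) auto
  qed
  with r that show ?thesis by blast
qed

lemma point_strictly_below: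
  fixes P :: "'a::euclidean_space set"
  assumes "interior P \<noteq> {}" "P \<subseteq> {x. x \<bullet> \<nu> \<le> a}" "norm \<nu> = 1"
  obtains q where "q \<in> P" "q \<bullet> \<nu> < a"
proof -
  obtain q where q: "q \<in> interior P" using assms by auto
  then obtain e where e: "e > 0" "cball q e \<subseteq> P"
    using mem_interior_cball by blast
  have "q + e *\<^sub>R \<nu> \<in> cball q e" using e assms by (simp add: dist_norm)
  then have "(q + e *\<^sub>R \<nu>) \<bullet> \<nu> \<le> a" using e assms by auto
  moreover have "\<nu> \<bullet> \<nu> = 1" using assms by (simp add: norm_eq_1)
  ultimately have "q \<bullet> \<nu> < a" using e by (simp add: inner_add_left)
  moreover have "q \<in> P" using q interior_subset by auto
  ultimately show ?thesis using that by blast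
qed

lemma both_half_balls:
  fixes P Q :: "'a::euclidean_space set"
  assumes \<nu>: "norm \<nu> = 1"
    and P: "convex P" "interior P \<noteq> {}" "P \<subseteq> {x. x \<bullet> \<nu> \<le> a}"
    and Q: "convex Q" "interior Q \<noteq> {}" "Q \<subseteq> {x. x \<bullet> \<nu> \<ge> a}"
    and e: "e > 0" and y: "y \<bullet> \<nu> = a"
    and plane: "\<And>v. v \<bullet> \<nu> = 0 \<Longrightarrow> norm v < e \<Longrightarrow> y + v \<in> P \<inter> Q"
  obtains r where "r > 0" "\<And>x. norm (x - y) < r \<Longrightarrow> x \<bullet> \<nu> \<le> a \<Longrightarrow> x \<in> P"
    "\<And>x. norm (x - y) < r \<Longrightarrow> x \<bullet> \<nu> \<ge> a \<Longrightarrow> x \<in> Q"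
proof -
  obtain q where q: "q \<in> P" "q \<bullet> \<nu> < a" by (rule point_strictly_below[OF P(2,3) \<nu>])
  obtain r1 where r1: "r1 > 0" "\<And>x. norm (x - y) < r1 \<Longrightarrow> x \<bullet> \<nu> \<le> a \<Longrightarrow> x \<in> P"
    using half_ball_in_convex[OF P(1) q e y \<nu>] plane by blast
  have Q': "Q \<subseteq> {x. x \<bullet> (- \<nu>) \<le> - a}" "norm (- \<nu>) = 1" "y \<bullet> (- \<nu>) = - a" using Q \<nu> y by auto
  obtain p where p: "p \<in> Q" "p \<bullet> (- \<nu>) < - a" by (rule point_strictly_below[OF Q(2) Q'(1,2)])
  obtain r2 where r2: "r2 > 0" "\<And>x. norm (x - y) < r2 \<Longrightarrow> x \<bullet> (- \<nu>) \<le> - a \<Longrightarrow> x \<in> Q"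
    using half_ball_in_convex[OF Q(1) p e Q'(3,2)] plane by auto
  show ?thesis using r1 r2 by (intro that[of "min r1 r2"]) auto
qed

text \<open>The width-one cylinder over the part of \<open>K\<close> in the plane is convex, so its
  frontier is null, and an interior point of the cylinder projects to a point of \<open>K\<close>
  that is interior within the plane. If that part has lower dimension, the cylinder itself is
  null.\<close>

lemma AE_interface_interior:
  fixes K :: "'a::euclidean_space set"
  assumes \<nu>: "norm \<nu> = 1" and K: "convex K" "closed K"
  shows "AE z in lborel. a \<le> z \<bullet> \<nu> \<longrightarrow> z \<bullet> \<nu> \<le> a + 1 \<longrightarrow> z - (z \<bullet> \<nu> - a) *\<^sub>R \<nu> \<in> K \<longrightarrow>
    (\<exists>e>0. \<forall>v. v \<bullet> \<nu> = 0 \<longrightarrow> norm v < e \<longrightarrow> z - (z \<bullet> \<nu> - a) *\<^sub>R \<nu> + v \<in> K)"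
proof -
  define pr where "pr z = z - (z \<bullet> \<nu> - a) *\<^sub>R \<nu>" for z
  define Z where "Z = {z. a \<le> z \<bullet> \<nu> \<and> z \<bullet> \<nu> \<le> a + 1 \<and> pr z \<in> K}"
  have "convex Z"
    unfolding convex_alt
  proof (intro ballI allI impI)
    fix x y :: 'a and u :: real
    assume x: "x \<in> Z" and y: "y \<in> Z" and u: "0 \<le> u \<and> u \<le> 1"
    have "pr ((1 - u) *\<^sub>R x + u *\<^sub>R y) = (1 - u) *\<^sub>R pr x + u *\<^sub>R pr y"
      by (simp add: pr_def inner_add_left algebra_simps)
    moreover have "(1 - u) *\<^sub>R pr x + u *\<^sub>R pr y \<in> K"
      using K(1) x y u by (intro convexD) (auto simp: Z_def)
    moreover have "((1 - u) *\<^sub>R x + u *\<^sub>R y) \<bullet> \<nu> = (1 - u) * (x \<bullet> \<nu>) + u * (y \<bullet> \<nu>)"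
      by (simp add: inner_add_left)
    moreover have "a \<le> (1 - u) * (x \<bullet> \<nu>) + u * (y \<bullet> \<nu>)"
      using convex_bound_le[of "- (x \<bullet> \<nu>)" "- a" "- (y \<bullet> \<nu>)" "1 - u" u] x y u by (simp add: Z_def)
    moreover have "(1 - u) * (x \<bullet> \<nu>) + u * (y \<bullet> \<nu>) \<le> a + 1"
      using x y u by (intro convex_bound_le) (auto simp: Z_def)
    ultimately show "(1 - u) *\<^sub>R x + u *\<^sub>R y \<in> Z" by (simp add: Z_def)
  qed
  then have "AE z in lborel. z \<notin> frontier Z" by (intro AE_not_in convex_frontier_null_sets)
  then show ?thesis
  proof (rule eventually_mono, intro impI, goal_cases)
    case (1 z)
    then have "z \<in> Z" by (simp add: Z_def pr_def)
    moreover have "Z - interior Z \<subseteq> frontier Z" using closure_subset[of Z] by (auto simp: frontier_def)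
    ultimately have "z \<in> interior Z" using 1(1) by blast
    then obtain e where e: "e > 0" "ball z e \<subseteq> Z" using mem_interior by blast
    have "z - (z \<bullet> \<nu> - a) *\<^sub>R \<nu> + v \<in> K" if v: "v \<bullet> \<nu> = 0" "norm v < e" for v
    proof -
      have "z + v \<in> ball z e" using v by (simp add: dist_norm)
      then have "pr (z + v) \<in> K" using e by (auto simp: Z_def)
      then show ?thesis using v by (simp add: pr_def inner_add_left algebra_simps)
    qed
    then show ?case using e(1) by blast
  qed
qed

lemma hyperplane_null_lborel:
  fixes \<nu> :: "'a::euclidean_space"
  assumes "\<nu> \<noteq> 0" shows "{x. x \<bullet> \<nu> = a} \<in> null_sets lborel"
proof -
  have "negligible {x. \<nu> \<bullet> x = a}" using assms by (intro negligible_hyperplane) auto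
  moreover have "closed {x. \<nu> \<bullet> x = a}" by (rule closed_hyperplane)
  ultimately show ?thesis
    by (metis (no_types, lifting) Collect_cong borel_closed inner_commute negligible_iff_null_sets null_sets_completion_iff sets_lborel)
qed

text \<open>
  The map \<open>y + t \<nu> \<mapsto> y + t h b\<close>, with \<open>y\<close> in the hyperplane, straightens the thin layer of
  points \<open>x\<close> that a translation by \<open>h b\<close> carries across the hyperplane into a slab of width one.
\<close>

lemma interface_flux_limit:
  fixes P Q :: "'a::euclidean_space set" and f :: "'a \<Rightarrow> real" and h :: "nat \<Rightarrow> real"
  assumes \<nu>: "norm \<nu> = 1"
    and P: "convex P" "compact P" "interior P \<noteq> {}" "P \<subseteq> {x. x \<bullet> \<nu> \<le> a}"
    and Q: "convex Q" "compact Q" "interior Q \<noteq> {}" "Q \<subseteq> {x. x \<bullet> \<nu> \<ge> a}"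
    and f: "continuous_on UNIV f"
    and h: "\<And>n. h n > 0" "h \<longlonglongrightarrow> 0"
  shows "(\<lambda>n. (1 / h n) * (\<integral>x. f x * (indicator P (x - h n *\<^sub>R b) * indicator Q x
      - indicator Q (x - h n *\<^sub>R b) * indicator P x) \<partial>lborel))
    \<longlonglongrightarrow> (b \<bullet> \<nu>) * (\<integral>x. indicator (P \<inter> Q) x * f x \<partial>hyperplane_measure \<nu> a)"
proof -
  define \<beta> where "\<beta> = b \<bullet> \<nu>"
  define G where "G n x = f x * (indicator P (x - h n *\<^sub>R b) * indicator Q x
      - indicator Q (x - h n *\<^sub>R b) * indicator P x)" for n x
  have [measurable]: "P \<in> sets borel" "Q \<in> sets borel" "f \<in> borel_measurable borel"
    using P Q f by (auto simp: compact_imp_closed borel_measurable_continuous_onI)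
  have G[measurable]: "G n \<in> borel_measurable borel" for n unfolding G_def by measurable
  have nn: "\<nu> \<bullet> \<nu> = 1" using \<nu> by (simp add: norm_eq_1)
  show ?thesis
  proof (cases "\<beta> = 0")
    \<comment> \<open>The translation is parallel to the plane, so a point of one cell with its
      translate in the other must lie in the plane, a null set.\<close>
    case True
    have "(\<integral>x. G n x \<partial>lborel) = 0" for n
    proof -
      have "{x. x \<bullet> \<nu> = a} \<in> null_sets lborel" using \<nu> by (intro hyperplane_null_lborel) auto
      then have "AE x in lborel. x \<notin> {x. x \<bullet> \<nu> = a}" by (rule AE_not_in)
      then have "AE x in lborel. G n x = 0"
      proof (rule eventually_mono)
        fix x assume x: "x \<notin> {x. x \<bullet> \<nu> = a}"
        have "(x - h n *\<^sub>R b) \<bullet> \<nu> = x \<bullet> \<nu>" using True by (simp add: inner_diff_left \<beta>_def)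
        show "G n x = 0"
        proof (rule ccontr)
          assume "G n x \<noteq> 0"
          then have "x - h n *\<^sub>R b \<in> P \<and> x \<in> Q \<or> x - h n *\<^sub>R b \<in> Q \<and> x \<in> P"
            by (auto simp: G_def indicator_def split: if_splits)
          then have "x \<bullet> \<nu> = a"
            using P(4) Q(4) \<open>(x - h n *\<^sub>R b) \<bullet> \<nu> = x \<bullet> \<nu>\<close> by fastforce
          with x show False by simp
        qed
      qed
      then show ?thesis by (subst integral_cong_AE[where g="\<lambda>_. 0"]) auto
    qed
    with True show ?thesis by (simp add: G_def \<beta>_def)
  next
    case False
    let ?v = "\<lambda>n. h n *\<^sub>R b"
    define pr where "pr z = z - (z \<bullet> \<nu> - a) *\<^sub>R \<nu>" for z
    define t where "t z = z \<bullet> \<nu> - a" for z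
    define L where "L n z = pr z + t z *\<^sub>R ?v n" for n z
    have prn: "pr z \<bullet> \<nu> = a" for z using nn by (simp add: pr_def inner_diff_left)
    have Ln: "L n z \<bullet> \<nu> = a + t z * (h n * \<beta>)" for n z
      by (simp add: L_def inner_add_left prn \<beta>_def)
    have Ln': "(L n z - ?v n) \<bullet> \<nu> = a + (t z - 1) * (h n * \<beta>)" for n z
      by (simp add: Ln inner_diff_left \<beta>_def algebra_simps)
    have hb: "h n * \<beta> \<noteq> 0" for n using h(1)[of n] False by auto
    \<comment> \<open>The Jacobian of the straightening is \<open>h n * \<bar>\<beta>\<bar>\<close>.
      Its \<open>h n\<close> cancels the difference quotient, and the region of integration no
      longer shrinks with \<open>n\<close>.\<close>
    have key: "(1 / h n) * (\<integral>x. G n x \<partial>lborel) = \<bar>\<beta>\<bar> * (\<integral>z. G n (L n z) \<partial>lborel)" for n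
    proof -
      have "?v n \<bullet> \<nu> \<noteq> 0" using hb[of n] by (simp add: \<beta>_def)
      then have "(\<integral>x. G n x \<partial>lborel) = \<bar>?v n \<bullet> \<nu>\<bar> * (\<integral>z. G n (L n z) \<partial>lborel)"
        using integral_stretch_shear[OF \<nu> _ G[of n], of "?v n" a] by (simp add: L_def pr_def t_def)
      then show ?thesis using h(1)[of n] by (simp add: abs_mult \<beta>_def)
    qed
    have LP: "t z * (h n * \<beta>) \<le> 0" if "L n z \<in> P" for n z
      using subsetD[OF P(4) that] by (simp add: Ln)
    have LQ: "t z * (h n * \<beta>) \<ge> 0" if "L n z \<in> Q" for n z
      using subsetD[OF Q(4) that] by (simp add: Ln)
    have LP': "(t z - 1) * (h n * \<beta>) \<le> 0" if "L n z - ?v n \<in> P" for n z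
      using subsetD[OF P(4) that] by (simp add: Ln')
    have LQ': "(t z - 1) * (h n * \<beta>) \<ge> 0" if "L n z - ?v n \<in> Q" for n z
      using subsetD[OF Q(4) that] by (simp add: Ln')
    \<comment> \<open>\<open>t z\<close> is the fraction of the step \<open>h n *\<^sub>R b\<close>
      that is made after crossing the plane. The sign of \<beta> decides the direction of crossing,
      so at most one of the two products in \<open>G\<close> is nonzero.\<close>
    have fwd: "\<beta> > 0 \<and> 0 \<le> t z \<and> t z \<le> 1" if "L n z \<in> Q" "L n z - ?v n \<in> P" for n z
      using LQ[OF that(1)] LP'[OF that(2)] h(1)[of n] False by (auto simp: mult_le_0_iff zero_le_mult_iff)
    have bwd: "\<beta> < 0 \<and> 0 \<le> t z \<and> t z \<le> 1" if "L n z \<in> P" "L n z - ?v n \<in> Q" for n z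
      using LP[OF that(1)] LQ'[OF that(2)] h(1)[of n] False by (auto simp: mult_le_0_iff zero_le_mult_iff)
    have out: "G n (L n z) = 0" if "\<not> (0 \<le> t z \<and> t z \<le> 1)" for n z
      using fwd[of n z] bwd[of n z] that by (auto simp: G_def indicator_def)
    obtain R where R: "\<And>x. x \<in> P \<union> Q \<Longrightarrow> norm x \<le> R"
      using compact_imp_bounded[OF compact_Un[OF P(2) Q(2)]] by (auto simp: bounded_iff)
    have "compact (f ` (P \<union> Q))"
      using f P Q by (intro compact_continuous_image compact_Un) (auto intro: continuous_on_subset)
    then obtain M where M: "\<And>x. x \<in> P \<union> Q \<Longrightarrow> \<bar>f x\<bar> \<le> M"
      using compact_imp_bounded[of "f ` (P \<union> Q)"] by (auto simp: bounded_iff)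
    have "Bseq h" using h(2) by (intro convergent_imp_Bseq convergentI)
    then obtain H where "\<forall>n. norm (h n) \<le> H" unfolding Bseq_def by blast
    then have H: "\<bar>h n\<bar> \<le> H" for n by simp
    define W where "W = cball (0::'a) (R + H * norm b + 1)"
    define S where "S = {z. a \<le> z \<bullet> \<nu> \<and> z \<bullet> \<nu> \<le> a + 1}"
    \<comment> \<open>The limit carries \<open>sgn \<beta>\<close> from the direction of crossing.
      Together with \<open>\<bar>\<beta>\<bar>\<close> from the Jacobian it becomes \<beta>, the
      factor \<open>b \<bullet> \<nu>\<close> of the flux.\<close>
    define F where "F z = sgn \<beta> * (indicator S z * (indicator (P \<inter> Q) (pr z) * f (pr z)))" for z
    have [measurable]: "pr \<in> borel_measurable borel" "S \<in> sets borel"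
      unfolding pr_def S_def by measurable
    have [measurable]: "L n \<in> borel_measurable borel" for n unfolding L_def t_def by measurable
    obtain x0 where "x0 \<in> P" using P(3) interior_subset by blast
    then have M0: "M \<ge> 0" using M[of x0] by force
    \<comment> \<open>\<open>z\<close> and \<open>L n z\<close> differ by \<open>t z\<close> times
      the difference of \<nu> and the step, so wherever the integrand is nonzero \<open>z\<close>
      stays in the fixed ball \<open>W\<close>.\<close>
    have bound: "norm (G n (L n z)) \<le> M * indicator W z" for n z
    proof (cases "G n (L n z) = 0")
      case True
      then show ?thesis using M0 by simp
    next
      case False
      then have tz: "0 \<le> t z" "t z \<le> 1" using out by blast+
      have PQ: "L n z \<in> P \<union> Q" using False by (auto simp: G_def indicator_def split: if_splits)
      have "norm z = norm (L n z - t z *\<^sub>R ?v n + t z *\<^sub>R \<nu>)"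
        by (simp add: L_def pr_def t_def)
      then have "norm z \<le> norm (L n z) + norm (t z *\<^sub>R ?v n) + norm (t z *\<^sub>R \<nu>)"
        using norm_triangle_ineq[of "L n z - t z *\<^sub>R ?v n" "t z *\<^sub>R \<nu>"]
          norm_triangle_ineq4[of "L n z" "t z *\<^sub>R ?v n"] by linarith
      also have "\<dots> \<le> R + H * norm b + 1"
      proof (intro add_mono)
        show "norm (L n z) \<le> R" by (rule R[OF PQ])
        have "t z * (\<bar>h n\<bar> * norm b) \<le> 1 * (H * norm b)"
          using tz H[of n] by (intro mult_mono) auto
        then show "norm (t z *\<^sub>R ?v n) \<le> H * norm b"
          using tz by (simp add: abs_mult mult.assoc)
      qed (use tz \<nu> in auto)
      finally have "z \<in> W" by (simp add: W_def)
      moreover have "\<bar>G n (L n z)\<bar> \<le> \<bar>f (L n z)\<bar> * 1"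
        unfolding G_def abs_mult by (intro mult_left_mono) (auto simp: indicator_def)
      ultimately show ?thesis using M[OF PQ] by simp
    qed
    have conv1: "(\<lambda>n. L n z) \<longlonglongrightarrow> pr z" for z
    proof -
      have "(\<lambda>n. pr z + t z *\<^sub>R ?v n) \<longlonglongrightarrow> pr z + t z *\<^sub>R (0 *\<^sub>R b)"
        by (intro tendsto_intros h)
      then show ?thesis by (simp add: L_def)
    qed
    have conv2: "(\<lambda>n. L n z - ?v n) \<longlonglongrightarrow> pr z" for z
    proof -
      have "(\<lambda>n. L n z - ?v n) \<longlonglongrightarrow> pr z - 0 *\<^sub>R b"
        by (intro tendsto_intros h conv1)
      then show ?thesis by simp
    qed
    have ev: "eventually (\<lambda>n. x n \<notin> C) sequentially" if "closed C" "x \<longlonglongrightarrow> l" "l \<notin> C" for C and x :: "nat \<Rightarrow> 'a" and l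
      using topological_tendstoD[OF that(2), of "- C"] that by (auto simp: open_Compl)
    have cv: "convex (P \<inter> Q)" "closed (P \<inter> Q)"
      using P Q by (auto simp: convex_Int compact_imp_closed closed_Int)
    have lim: "AE z in lborel. (\<lambda>n. G n (L n z)) \<longlonglongrightarrow> F z"
      using AE_interface_interior[OF \<nu> cv, of a]
    proof (rule eventually_mono)
      fix z assume z: "a \<le> z \<bullet> \<nu> \<longrightarrow> z \<bullet> \<nu> \<le> a + 1 \<longrightarrow> z - (z \<bullet> \<nu> - a) *\<^sub>R \<nu> \<in> P \<inter> Q \<longrightarrow>
        (\<exists>e>0. \<forall>v. v \<bullet> \<nu> = 0 \<longrightarrow> norm v < e \<longrightarrow> z - (z \<bullet> \<nu> - a) *\<^sub>R \<nu> + v \<in> P \<inter> Q)"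
      \<comment> \<open>Off the slab the integrand is 0. If \<open>pr z\<close> misses
        \<open>P\<close> or \<open>Q\<close>, the point and its translate converge to
        \<open>pr z\<close> and are eventually outside that closed set. In the last case
        \<open>pr z\<close> is interior to the interface within the plane, and the half balls
        capture both points once they are close.\<close>
      consider "\<not> (0 \<le> t z \<and> t z \<le> 1)" | "pr z \<notin> P" | "pr z \<notin> Q"
        | "0 \<le> t z" "t z \<le> 1" "pr z \<in> P \<inter> Q" by blast
      then show "(\<lambda>n. G n (L n z)) \<longlonglongrightarrow> F z"
      proof cases
        case 1
        then have "F z = 0" by (auto simp: F_def S_def t_def)
        moreover have "G n (L n z) = 0" for n using out[OF 1] .
        ultimately show ?thesis by simp
      next
        case 2
        then have "F z = 0" by (auto simp: F_def)
        have "eventually (\<lambda>n. G n (L n z) = 0) sequentially"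
          using ev[OF compact_imp_closed[OF P(2)] conv1 2] ev[OF compact_imp_closed[OF P(2)] conv2 2]
          by eventually_elim (simp add: G_def)
        then show ?thesis unfolding \<open>F z = 0\<close> by (rule tendsto_eventually)
      next
        case 3
        then have "F z = 0" by (auto simp: F_def)
        have "eventually (\<lambda>n. G n (L n z) = 0) sequentially"
          using ev[OF compact_imp_closed[OF Q(2)] conv1 3] ev[OF compact_imp_closed[OF Q(2)] conv2 3]
          by eventually_elim (simp add: G_def)
        then show ?thesis unfolding \<open>F z = 0\<close> by (rule tendsto_eventually)
      next
        case 4
        have Fz: "F z = sgn \<beta> * f (pr z)" using 4 by (auto simp: F_def S_def t_def)
        obtain e where e: "e > 0" "\<And>v. v \<bullet> \<nu> = 0 \<Longrightarrow> norm v < e \<Longrightarrow> pr z + v \<in> P \<inter> Q"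
          using z 4 by (auto simp: pr_def t_def)
        obtain r where r: "r > 0" "\<And>x. norm (x - pr z) < r \<Longrightarrow> x \<bullet> \<nu> \<le> a \<Longrightarrow> x \<in> P"
          "\<And>x. norm (x - pr z) < r \<Longrightarrow> x \<bullet> \<nu> \<ge> a \<Longrightarrow> x \<in> Q"
          using both_half_balls[OF \<nu> P(1,3,4) Q(1,3,4) e(1) prn e(2)] by blast
        have near: "eventually (\<lambda>n. norm (L n z - pr z) < r) sequentially"
          "eventually (\<lambda>n. norm (L n z - ?v n - pr z) < r) sequentially"
          using tendstoD[OF conv1 r(1)] tendstoD[OF conv2 r(1)] by (auto simp: dist_norm)
        have "eventually (\<lambda>n. sgn \<beta> * f (L n z) = G n (L n z)) sequentially"
          using near
        proof eventually_elim
          case (elim n)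
          have hn: "h n > 0" by (rule h)
          show ?case
          proof (cases "\<beta> > 0")
            case True
            have "L n z \<in> Q" using elim 4 True hn by (intro r(3)) (auto simp: Ln)
            moreover have "L n z - ?v n \<in> P"
              using elim 4 True hn by (intro r(2)) (auto simp: Ln' mult_le_0_iff)
            ultimately show ?thesis using True bwd[of n z] by (auto simp: G_def indicator_def)
          next
            case False
            then have b: "\<beta> < 0" using \<open>\<beta> \<noteq> 0\<close> by simp
            have "L n z \<in> P" using elim 4 b hn by (intro r(2)) (auto simp: Ln mult_le_0_iff)
            moreover have "L n z - ?v n \<in> Q"
              using elim 4 b hn by (intro r(3)) (auto simp: Ln' zero_le_mult_iff mult_le_0_iff)
            ultimately show ?thesis using b fwd[of n z] by (auto simp: G_def indicator_def)
          qed
        qed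
        moreover have "(\<lambda>n. sgn \<beta> * f (L n z)) \<longlonglongrightarrow> sgn \<beta> * f (pr z)"
        proof (intro tendsto_intros)
          have "isCont f (pr z)" using f by (simp add: continuous_on_eq_continuous_at)
          then show "(\<lambda>n. f (L n z)) \<longlonglongrightarrow> f (pr z)" using conv1 by (rule isCont_tendsto_compose)
        qed
        ultimately show ?thesis unfolding Fz by (rule Lim_transform_eventually[rotated])
      qed
    qed
    have "(\<lambda>n. \<integral>z. G n (L n z) \<partial>lborel) \<longlonglongrightarrow> (\<integral>z. F z \<partial>lborel)"
    proof (rule integral_dominated_convergence[where w="\<lambda>z. M * indicator W z"])
      show "integrable lborel (\<lambda>z. M * indicator W z)"
        using emeasure_bounded_finite[of W] by (auto simp: W_def intro!: integrable_real_indicator)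
      show "AE z in lborel. (\<lambda>n. G n (L n z)) \<longlonglongrightarrow> F z" by (rule lim)
      show "AE z in lborel. norm (G n (L n z)) \<le> M * indicator W z" for n using bound by auto
      show "F \<in> borel_measurable lborel" unfolding F_def by measurable
    qed measurable
    then have lim': "(\<lambda>n. (1 / h n) * (\<integral>x. G n x \<partial>lborel)) \<longlonglongrightarrow> \<bar>\<beta>\<bar> * (\<integral>z. F z \<partial>lborel)"
      unfolding key by (intro tendsto_intros)
    have F': "(\<integral>z. F z \<partial>lborel) = sgn \<beta> * (\<integral>x. indicator (P \<inter> Q) x * f x \<partial>hyperplane_measure \<nu> a)"
    proof -
      have "(\<integral>x. indicator (P \<inter> Q) x * f x \<partial>hyperplane_measure \<nu> a) =
          (\<integral>z. indicator S z * (indicator (P \<inter> Q) (pr z) * f (pr z)) \<partial>lborel)"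
        unfolding S_def pr_def by (rule integral_hyperplane_measure) measurable
      then show ?thesis unfolding F_def by simp
    qed
    have sg: "\<bar>\<beta>\<bar> * (sgn \<beta> * c) = \<beta> * c" for c
      using False by (simp add: sgn_if abs_if)
    show ?thesis using lim' unfolding F' sg unfolding G_def \<beta>_def .
  qed
qed

section \<open>Gauss-Green formula for unions of convex cells\<close>

lemma integrable_bounded_support:
  fixes f :: "'a::euclidean_space \<Rightarrow> real"
  assumes "f \<in> borel_measurable borel" "bounded W" "\<And>x. x \<notin> W \<Longrightarrow> f x = 0" "\<And>x. \<bar>f x\<bar> \<le> M"
  shows "integrable lborel f"
proof -
  obtain R where "\<forall>x\<in>W. norm x \<le> R" using assms(2) unfolding bounded_iff by blast
  then have R: "W \<subseteq> cball 0 R" by auto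
  have "integrable lborel (\<lambda>x. M * indicator (cball (0::'a) R) x)"
    using emeasure_bounded_finite[of "cball (0::'a) R"] by (auto intro!: integrable_real_indicator)
  then show ?thesis
  proof (rule Bochner_Integration.integrable_bound)
    show "AE x in lborel. norm (f x) \<le> norm (M * indicator (cball 0 R) x)"
    proof (rule AE_I2)
      fix x
      show "norm (f x) \<le> norm (M * indicator (cball 0 R) x)"
        using assms(3)[of x] assms(4)[of x] R by (cases "x \<in> W") auto
    qed
  qed (use assms in simp)
qed

text \<open>Multiplying by the sums that equal 1 gives a double sum over \<open>I\<close> and
  \<open>V\<close>, whose part over \<open>I\<close> and \<open>I\<close> is antisymmetric and
  cancels. It is meant for the cell indicators at a point and at its translate.\<close>

lemma sum_diff_eq_double_sum:
  fixes u v :: "'i \<Rightarrow> real"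
  assumes V: "finite V" "I \<subseteq> V" and "sum u V = 1" "sum v V = 1"
  shows "sum u I - sum v I = (\<Sum>i\<in>I. \<Sum>j\<in>V - I. u i * v j - v i * u j)"
proof -
  have fI: "finite I" using V finite_subset by auto
  have "sum u I - sum v I = sum u I * sum v V - sum v I * sum u V" using assms by simp
  also have "\<dots> = (\<Sum>i\<in>I. \<Sum>j\<in>V. u i * v j - v i * u j)"
    by (simp add: sum_product sum_subtractf)
  also have "\<dots> = (\<Sum>i\<in>I. (\<Sum>j\<in>I. u i * v j - v i * u j) + (\<Sum>j\<in>V - I. u i * v j - v i * u j))"
    by (intro sum.cong refl) (simp add: sum.subset_diff[OF V(2,1)] add.commute)
  also have "\<dots> = (\<Sum>i\<in>I. \<Sum>j\<in>I. u i * v j) - (\<Sum>i\<in>I. \<Sum>j\<in>I. v i * u j) + (\<Sum>i\<in>I. \<Sum>j\<in>V - I. u i * v j - v i * u j)"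
    by (simp add: sum.distrib sum_subtractf)
  also have "(\<Sum>i\<in>I. \<Sum>j\<in>I. v i * u j) = (\<Sum>i\<in>I. \<Sum>j\<in>I. u i * v j)"
    by (subst sum.swap) (simp add: mult.commute)
  finally show ?thesis by simp
qed

text \<open>Off the support the field vanishes on an open set, so its derivative vanishes there as
  well. Hence the derivative is bounded and the field is Lipschitz, which bounds all difference
  quotients uniformly.\<close>

lemma C1_compact_supportE:
  fixes \<phi> :: "'a::euclidean_space \<Rightarrow> 'a"
  assumes "\<phi> \<in> C1_compact_support \<Omega>"
  obtains D :: "'a \<Rightarrow> 'a \<Rightarrow>\<^sub>L 'a" and S B where "continuous_on UNIV D"
    "\<forall>x. (\<phi> has_derivative blinfun_apply (D x)) (at x)"
    "compact S" "S \<subseteq> \<Omega>" "\<forall>x. x \<notin> S \<longrightarrow> \<phi> x = 0 \<and> D x = 0"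
    "\<forall>x. norm (D x) \<le> B" "\<forall>x y. norm (\<phi> x - \<phi> y) \<le> B * norm (x - y)"
    "\<forall>x. divergence \<phi> x = (\<Sum>b\<in>Basis. D x b \<bullet> b)" "continuous_on UNIV \<phi>"
    "divergence \<phi> \<in> borel_measurable borel"
proof -
  define S where "S = closure {x. \<phi> x \<noteq> 0}"
  obtain D :: "'a \<Rightarrow> 'a \<Rightarrow>\<^sub>L 'a" where D: "continuous_on UNIV D"
    "\<And>x. (\<phi> has_derivative blinfun_apply (D x)) (at x)" and S: "compact S" "S \<subseteq> \<Omega>"
    using assms by (auto simp: C1_compact_support_def S_def)
  have \<phi>0: "\<phi> x = 0" if "x \<notin> S" for x using that closure_subset[of "{x. \<phi> x \<noteq> 0}"] by (auto simp: S_def)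
  have D0: "D x = 0" if x: "x \<notin> S" for x
  proof -
    have "open (- S)" using S by (simp add: compact_imp_closed open_Compl)
    then have "(\<phi> has_derivative (\<lambda>_. 0)) (at x)"
      using has_derivative_transform_within_open[OF has_derivative_const[of 0 "at x"] \<open>open (- S)\<close>] x \<phi>0
      by (metis ComplI ComplD)
    from has_derivative_unique[OF this D(2)] show ?thesis
      by (intro blinfun_eqI) (simp add: fun_eq_iff)
  qed
  have "compact (D ` S)" using D S by (intro compact_continuous_image) (auto intro: continuous_on_subset)
  then obtain B where B: "B > 0" "\<And>x. x \<in> S \<Longrightarrow> norm (D x) \<le> B"
    using compact_imp_bounded[of "D ` S"] by (auto simp: bounded_pos)
  have B': "norm (D x) \<le> B" for x using B D0[of x] by (cases "x \<in> S") auto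
  have lip: "norm (\<phi> x - \<phi> y) \<le> B * norm (x - y)" for x y
    by (rule differentiable_bound[of UNIV \<phi> "\<lambda>x. blinfun_apply (D x)"])
      (use D(2) B' in \<open>auto simp: norm_blinfun.rep_eq\<close>)
  have dv: "divergence \<phi> x = (\<Sum>b\<in>Basis. D x b \<bullet> b)" for x
    unfolding divergence_def using frechet_derivative_at[OF D(2)] by simp
  have "continuous_on UNIV \<phi>"
    using D(2) by (meson continuous_at_imp_continuous_on has_derivative_continuous)
  moreover have "divergence \<phi> \<in> borel_measurable borel"
    unfolding dv[abs_def] using D by (intro borel_measurable_continuous_onI continuous_intros)
  ultimately show ?thesis by (intro that[of D S B]) (use D S \<phi>0 D0 B' lip dv in auto)
qed

text \<open>Integration by parts is done on difference quotients: a translation passes from \<phi>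
  to the indicator, which need not be regular. The fluxes of the basis components recombine to that
  of the normal component.\<close>

lemma divergence_integral_eq_interface_flux:
  fixes P :: "'i \<Rightarrow> 'a::euclidean_space set"
  assumes V: "finite V" "I \<subseteq> V"
    and P: "\<And>i. i \<in> V \<Longrightarrow> convex (P i)" "\<And>i. i \<in> V \<Longrightarrow> compact (P i)" "\<And>i. i \<in> V \<Longrightarrow> interior (P i) \<noteq> {}"
    and sep: "\<And>i j. i \<in> V \<Longrightarrow> j \<in> V \<Longrightarrow> i \<noteq> j \<Longrightarrow> norm (\<nu> i j) = 1"
      "\<And>i j. i \<in> V \<Longrightarrow> j \<in> V \<Longrightarrow> i \<noteq> j \<Longrightarrow> P i \<subseteq> {x. x \<bullet> \<nu> i j \<le> a i j}"
      "\<And>i j. i \<in> V \<Longrightarrow> j \<in> V \<Longrightarrow> i \<noteq> j \<Longrightarrow> P j \<subseteq> {x. x \<bullet> \<nu> i j \<ge> a i j}"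
    and \<Omega>: "open \<Omega>" "\<Omega> \<subseteq> (\<Union>i\<in>V. P i)" and \<phi>: "\<phi> \<in> C1_compact_support \<Omega>"
  shows "(\<integral>x. indicator (\<Union>i\<in>I. P i) x * divergence \<phi> x \<partial>lborel) =
    (\<Sum>i\<in>I. \<Sum>j\<in>V - I. \<integral>x. indicator (P i \<inter> P j) x * (\<phi> x \<bullet> \<nu> i j) \<partial>hyperplane_measure (\<nu> i j) (a i j))"
proof -
  let ?\<sigma> = "\<lambda>i j. hyperplane_measure (\<nu> i j) (a i j)"
  obtain D S B where D: "continuous_on UNIV D"
    and D': "\<forall>x. (\<phi> has_derivative blinfun_apply (D x)) (at x)"
    and S: "compact S" "S \<subseteq> \<Omega>" and S0: "\<forall>x. x \<notin> S \<longrightarrow> \<phi> x = 0 \<and> D x = 0"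
    and B': "\<forall>x. norm (D x) \<le> B" "\<forall>x y. norm (\<phi> x - \<phi> y) \<le> B * norm (x - y)"
    and dv': "\<forall>x. divergence \<phi> x = (\<Sum>b\<in>Basis. D x b \<bullet> b)" and c\<phi>: "continuous_on UNIV \<phi>"
    by (rule C1_compact_supportE[OF \<phi>]) (rule that, assumption+)
  note D = D D'[rule_format] and dv = dv'[rule_format] and B = B'[rule_format]
  have S: "compact S" "S \<subseteq> \<Omega>" "\<And>x. x \<notin> S \<Longrightarrow> \<phi> x = 0" "\<And>x. x \<notin> S \<Longrightarrow> D x = 0"
    using S S0 by auto
  define e :: "'a \<Rightarrow> real" where "e = indicator (\<Union>i\<in>I. P i)"
  have fI: "finite I" using V finite_subset by auto
  have Pb[measurable]: "P i \<in> sets borel" if "i \<in> V" for i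
    using P(2)[OF that] by (simp add: compact_imp_closed)
  have "(\<Union>i\<in>I. P i) \<in> sets borel" using fI V Pb by (intro sets.finite_UN) auto
  then have e[measurable]: "e \<in> borel_measurable borel" by (simp add: e_def)
  have e01: "0 \<le> e x" "e x \<le> 1" for x by (auto simp: e_def indicator_def)
  have [measurable]: "\<phi> \<in> borel_measurable borel" using c\<phi> by (rule borel_measurable_continuous_onI)
  have cD: "continuous_on UNIV (\<lambda>x. D x b \<bullet> b)" for b by (intro continuous_intros D)
  have [measurable]: "(\<lambda>x. D x b \<bullet> b) \<in> borel_measurable borel" for b
    using cD by (rule borel_measurable_continuous_onI)
  have B0: "B \<ge> 0" using B(1)[of 0] norm_ge_zero[of "D 0"] by linarith
  obtain d where d: "d > 0" "(\<Union>x\<in>S. cball x d) \<subseteq> \<Omega>"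
    using compact_subset_open_imp_cball_epsilon_subset[OF S(1) \<Omega>(1) S(2)] by blast
  \<comment> \<open>Steps of at most \<open>d\<close> keep \<open>x - h n *\<^sub>R b\<close> in
    \<Omega> for every \<open>x\<close> in the support, so both points lie in some cell.\<close>
  define h where "h n = d / real (Suc n)" for n
  have h: "h n > 0" "h n \<le> d" for n
    using d by (auto simp: h_def divide_le_eq_1 field_simps)
  have h0: "h \<longlonglongrightarrow> 0" unfolding h_def
    using tendsto_mult_right_zero[OF LIMSEQ_inverse_real_of_nat, of d] by (simp add: divide_inverse)
  obtain R where R: "\<And>x. x \<in> S \<Longrightarrow> norm x \<le> R" using compact_imp_bounded[OF S(1)] by (auto simp: bounded_iff)
  obtain M where M: "\<And>x. norm (\<phi> x) \<le> M"
  proof -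
    have "compact (\<phi> ` S)" using c\<phi> S by (intro compact_continuous_image) (auto intro: continuous_on_subset)
    then obtain M where "M > 0" "\<And>x. x \<in> S \<Longrightarrow> norm (\<phi> x) \<le> M"
      using compact_imp_bounded[of "\<phi> ` S"] by (auto simp: bounded_pos)
    then have "norm (\<phi> x) \<le> M" for x using S(3)[of x] by (cases "x \<in> S") auto
    with that show ?thesis by blast
  qed
  \<comment> \<open>Used for \<open>c = 0\<close> and for \<open>c = h n *\<^sub>R b\<close>: off
    the separating hyperplanes and off their translates, the point and its translate lie in at most
    one cell each.\<close>
  have AEn: "AE x in lborel. \<forall>i\<in>V. \<forall>j\<in>V. i \<noteq> j \<longrightarrow> \<not> (x - c \<in> P i \<and> x - c \<in> P j)" for c
  proof -
    have "AE x in lborel. i \<noteq> j \<longrightarrow> \<not> (x - c \<in> P i \<and> x - c \<in> P j)" if ij: "i \<in> V" "j \<in> V" for i j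
    proof (cases "i = j")
      case False
      have "\<nu> i j \<noteq> 0" using sep(1)[OF ij False] by auto
      from AE_not_in[OF hyperplane_null_lborel[OF this, of "a i j + c \<bullet> \<nu> i j"]]
      show ?thesis
      proof (rule eventually_mono, intro impI notI)
        fix x assume x: "x \<notin> {x. x \<bullet> \<nu> i j = a i j + c \<bullet> \<nu> i j}" "x - c \<in> P i \<and> x - c \<in> P j"
        then have "(x - c) \<bullet> \<nu> i j = a i j" using sep(2,3)[OF ij False] by force
        with x show False by (simp add: inner_diff_left)
      qed
    qed simp
    then show ?thesis using V by (intro AE_finite_allI) auto
  qed
  have sums: "(\<Sum>i\<in>V. indicator (P i) y) = (1::real)" "e y = (\<Sum>i\<in>I. indicator (P i) y)"
    if y: "\<forall>i\<in>V. \<forall>j\<in>V. i \<noteq> j \<longrightarrow> \<not> (y \<in> P i \<and> y \<in> P j)" "y \<in> \<Omega>" for y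
  proof -
    obtain k where k: "k \<in> V" "y \<in> P k" using y \<Omega> by auto
    have ind: "indicator (P i) y = (if i = k then 1 else 0 :: real)" if "i \<in> V" for i
      using y(1) k that by (auto simp: indicator_def)
    have "(\<Sum>i\<in>V. indicator (P i) y) = (\<Sum>i\<in>V. if i = k then 1 else 0 :: real)"
      using ind by (intro sum.cong) auto
    then show "(\<Sum>i\<in>V. indicator (P i) y) = (1::real)" using V k by simp
    have "(\<Sum>i\<in>I. indicator (P i) y) = (\<Sum>i\<in>I. if i = k then 1 else 0 :: real)"
      using ind V by (intro sum.cong) auto
    also have "\<dots> = (if k \<in> I then 1 else 0)" using fI by simp
    also have "\<dots> = e y"
    proof -
      have "i = k" if "i \<in> I" "y \<in> P i" for i
        using y(1) k V(2) that by (metis subsetD)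
      then have "y \<in> (\<Union>i\<in>I. P i) \<longleftrightarrow> k \<in> I" using k(2) by auto
      then show ?thesis by (simp add: e_def indicator_def)
    qed
    finally show "e y = (\<Sum>i\<in>I. indicator (P i) y)" ..
  qed
  let ?\<kappa> = "\<lambda>i j. indicator (P i \<inter> P j) :: 'a \<Rightarrow> real"
  have comp: "(\<integral>x. e x * (D x b \<bullet> b) \<partial>lborel) =
      (\<Sum>i\<in>I. \<Sum>j\<in>V - I. (b \<bullet> \<nu> i j) * (\<integral>x. ?\<kappa> i j x * (\<phi> x \<bullet> b) \<partial>?\<sigma> i j))"
    if b: "b \<in> Basis" for b
  proof -
    have nb: "norm b = 1" using b by simp
    define \<psi> where "\<psi> x = \<phi> x \<bullet> b" for x
    have \<psi>[measurable]: "\<psi> \<in> borel_measurable borel" unfolding \<psi>_def by measurable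
    have c\<psi>: "continuous_on UNIV \<psi>" unfolding \<psi>_def by (intro continuous_intros c\<phi>)
    have \<psi>M: "\<bar>\<psi> x\<bar> \<le> M" for x using Cauchy_Schwarz_ineq2[of "\<phi> x" b] M[of x] nb by (simp add: \<psi>_def)
    have M0: "M \<ge> 0" using \<psi>M[of 0] by linarith
    have \<psi>0: "\<psi> x = 0" if "x \<notin> S" for x using S(3)[OF that] by (simp add: \<psi>_def)
    have bS: "bounded S" using S(1) by (rule compact_imp_bounded)
    have int: "integrable lborel (\<lambda>x. g x * \<psi> x)" if "g \<in> borel_measurable borel" "\<And>x. \<bar>g x\<bar> \<le> 1" for g :: "'a \<Rightarrow> real"
    proof (rule integrable_bounded_support[OF _ bS, of _ M])
      show "\<bar>g x * \<psi> x\<bar> \<le> M" for x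
        using mult_mono[OF that(2)[of x] \<psi>M[of x]] by (simp add: abs_mult)
    qed (use that \<psi>0 in auto)
    let ?v = "\<lambda>n. h n *\<^sub>R b"
    let ?q = "\<lambda>n x. (\<psi> (x + h n *\<^sub>R b) - \<psi> x) / h n"
    have L1: "(\<lambda>n. \<integral>x. e x * ?q n x \<partial>lborel) \<longlonglongrightarrow> (\<integral>x. e x * (D x b \<bullet> b) \<partial>lborel)"
    proof (rule integral_dominated_convergence[where w="\<lambda>x. B * indicator (cball 0 (R + d)) x"])
      show "integrable lborel (\<lambda>x. B * indicator (cball (0::'a) (R + d)) x)"
        using emeasure_bounded_finite[of "cball (0::'a) (R + d)"] by (auto intro!: integrable_real_indicator)
      have "(\<lambda>n. e x * ?q n x) \<longlonglongrightarrow> e x * (D x b \<bullet> b)" for x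
      proof (intro tendsto_mult tendsto_const)
        have "(\<psi> has_derivative (\<lambda>v. D x v \<bullet> b)) (at x)"
          unfolding \<psi>_def using D(2)[of x] by (rule has_derivative_inner_left)
        then have d2: "(\<psi> has_derivative (\<lambda>v. D x v \<bullet> b)) (at (x + 0 *\<^sub>R b))" by simp
        have d1: "((\<lambda>t. x + t *\<^sub>R b) has_derivative (\<lambda>t. t *\<^sub>R b)) (at 0)"
          by (auto intro!: derivative_eq_intros)
        have "((\<lambda>t. \<psi> (x + t *\<^sub>R b)) has_derivative (\<lambda>t. D x (t *\<^sub>R b) \<bullet> b)) (at 0)"
          by (rule has_derivative_compose[OF d1 d2])
        then have "((\<lambda>t. \<psi> (x + t *\<^sub>R b)) has_real_derivative (D x b \<bullet> b)) (at 0)"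
        proof -
          have "(\<lambda>t. D x (t *\<^sub>R b) \<bullet> b) = (*) (D x b \<bullet> b)" by (auto simp: blinfun.scaleR_right)
          with \<open>(_ has_derivative (\<lambda>t. D x (t *\<^sub>R b) \<bullet> b)) (at 0)\<close> show ?thesis
            unfolding has_field_derivative_def by (simp only:)
        qed
        then have "((\<lambda>t. (\<psi> (x + t *\<^sub>R b) - \<psi> x) / t) \<longlongrightarrow> (D x b \<bullet> b)) (at 0)"
          by (simp add: has_field_derivative_iff)
        moreover have "filterlim h (at 0) sequentially"
        proof -
          have "h n \<noteq> 0" for n using h(1)[of n] by simp
          then show ?thesis using h0 by (simp add: filterlim_at)
        qed
        ultimately show "(\<lambda>n. ?q n x) \<longlonglongrightarrow> D x b \<bullet> b"
          by (rule filterlim_compose)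
      qed
      then show "AE x in lborel. (\<lambda>n. e x * ?q n x) \<longlonglongrightarrow> e x * (D x b \<bullet> b)" by simp
      have "norm (e x * ?q n x) \<le> B * indicator (cball 0 (R + d)) x" for n x
      proof (cases "x \<in> S \<or> x + ?v n \<in> S")
        case True
        then have "norm x \<le> R + d"
        proof
          assume "x + ?v n \<in> S"
          then have "norm (x + ?v n) \<le> R" by (rule R)
          moreover have "norm x \<le> norm (x + ?v n) + norm (?v n)"
            using norm_triangle_ineq4[of "x + ?v n" "h n *\<^sub>R b"] by simp
          ultimately show ?thesis using h[of n] nb by simp
        qed (use R[of x] d in auto)
        have "\<bar>\<psi> (x + ?v n) - \<psi> x\<bar> \<le> norm (\<phi> (x + ?v n) - \<phi> x) * norm b"
          unfolding \<psi>_def inner_diff_left[symmetric] by (rule Cauchy_Schwarz_ineq2)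
        also have "\<dots> \<le> B * h n" using B(2)[of "x + ?v n" x] h[of n] nb by simp
        finally have "\<bar>?q n x\<bar> \<le> B" using h[of n] by (simp add: divide_le_eq)
        then have "e x * \<bar>?q n x\<bar> \<le> 1 * B"
          using e01 by (intro mult_mono) auto
        then show ?thesis using \<open>norm x \<le> R + d\<close> e01 by (simp add: abs_mult)
      qed (use \<psi>0 B0 in auto)
      then show "AE x in lborel. norm (e x * ?q n x) \<le> B * indicator (cball 0 (R + d)) x" for n by simp
    qed measurable
    let ?G = "\<lambda>i j n x. indicator (P i) (x - ?v n) * indicator (P j) x - indicator (P j) (x - ?v n) * indicator (P i) x :: real"
    \<comment> \<open>Translation invariance moves the shift from \<psi> to \<open>e\<close>; almost
      everywhere on the support the jump of \<open>e\<close> is then the sum over pairs from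
      \<open>sum_diff_eq_double_sum\<close>.\<close>
    have eq: "(\<integral>x. e x * ?q n x \<partial>lborel) =
        (\<Sum>i\<in>I. \<Sum>j\<in>V - I. (1 / h n) * (\<integral>x. \<psi> x * ?G i j n x \<partial>lborel))" for n
    proof -
      have i1: "integrable lborel (\<lambda>x. e (x - ?v n) * \<psi> x)" "integrable lborel (\<lambda>x. e x * \<psi> x)"
        using e01 by (auto intro!: int)
      have i2: "integrable lborel (\<lambda>x. e x * \<psi> (x + ?v n))"
      proof (rule integrable_bounded_support[of _ "(\<lambda>x. x - ?v n) ` S" M])
        show "bounded ((\<lambda>x. x - ?v n) ` S)" using bS by (rule bounded_translation_minus)
        show "e x * \<psi> (x + ?v n) = 0" if "x \<notin> (\<lambda>x. x - ?v n) ` S" for x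
        proof -
          have "x + ?v n \<notin> S" using that by (metis add_diff_cancel_right' image_eqI)
          then show ?thesis by (simp add: \<psi>0)
        qed
        show "\<bar>e x * \<psi> (x + ?v n)\<bar> \<le> M" for x
          using mult_mono[OF e01(2)[of x] \<psi>M[of "x + ?v n"]] e01(1)[of x] by (simp add: abs_mult)
      qed measurable
      have G01: "\<bar>?G i j n x\<bar> \<le> 1" for i j x by (auto simp: indicator_def)
      have iG: "integrable lborel (\<lambda>x. \<psi> x * ?G i j n x)" if "i \<in> I" "j \<in> V - I" for i j
      proof -
        have [measurable]: "P i \<in> sets borel" "P j \<in> sets borel" using that V Pb by auto
        have "(\<lambda>x. ?G i j n x) \<in> borel_measurable borel" by measurable
        from int[OF this G01] show ?thesis by (simp add: mult.commute)
      qed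
      have "(\<integral>x. e x * ?q n x \<partial>lborel) =
          (\<integral>x. (1 / h n) * (e x * \<psi> (x + ?v n) - e x * \<psi> x) \<partial>lborel)"
        by (intro Bochner_Integration.integral_cong) (auto simp: field_simps)
      also have "\<dots> = (1 / h n) * ((\<integral>x. e x * \<psi> (x + ?v n) \<partial>lborel) - (\<integral>x. e x * \<psi> x \<partial>lborel))"
        using i1 i2 by simp
      also have "(\<integral>x. e x * \<psi> (x + ?v n) \<partial>lborel) = (\<integral>x. e (x - ?v n) * \<psi> x \<partial>lborel)"
        using lborel_integral_translate[of "\<lambda>x. e (x - ?v n) * \<psi> x" "h n *\<^sub>R b"] by simp
      also have "\<dots> - (\<integral>x. e x * \<psi> x \<partial>lborel) = (\<integral>x. e (x - ?v n) * \<psi> x - e x * \<psi> x \<partial>lborel)"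
        using i1 by simp
      also have "\<dots> = (\<integral>x. (\<Sum>i\<in>I. \<Sum>j\<in>V - I. \<psi> x * ?G i j n x) \<partial>lborel)"
      proof (rule integral_cong_AE)
        show "AE x in lborel. e (x - ?v n) * \<psi> x - e x * \<psi> x = (\<Sum>i\<in>I. \<Sum>j\<in>V - I. \<psi> x * ?G i j n x)"
          using AEn[of "h n *\<^sub>R b"] AEn[of 0]
        proof eventually_elim
          case (elim x)
          show ?case
          proof (cases "x \<in> S")
            case False
            then show ?thesis by (simp add: \<psi>0)
          next
            case True
            have "x \<in> \<Omega>" using True S by auto
            have "x - ?v n \<in> cball x d" using h[of n] nb by (simp add: dist_norm)
            then have "x - ?v n \<in> \<Omega>" using d True by blast
            note s1 = sums[OF elim(1) this]
            have s2: "(\<Sum>i\<in>V. indicator (P i) x) = (1::real)" "e x = (\<Sum>i\<in>I. indicator (P i) x)"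
              using sums[of x] elim(2) \<open>x \<in> \<Omega>\<close> by auto
            have "e (x - ?v n) - e x = (\<Sum>i\<in>I. \<Sum>j\<in>V - I. indicator (P i) (x - ?v n) * indicator (P j) x
                - indicator (P i) x * indicator (P j) (x - ?v n))"
              unfolding s1(2) s2(2) by (rule sum_diff_eq_double_sum[OF V s1(1) s2(1)])
            also have "\<dots> = (\<Sum>i\<in>I. \<Sum>j\<in>V - I. ?G i j n x)" by (simp add: mult.commute)
            finally have "e (x - ?v n) - e x = (\<Sum>i\<in>I. \<Sum>j\<in>V - I. ?G i j n x)" .
            then have "\<psi> x * (e (x - ?v n) - e x) = (\<Sum>i\<in>I. \<Sum>j\<in>V - I. \<psi> x * ?G i j n x)"
              by (simp only: sum_distrib_left)
            then show ?thesis by (simp add: algebra_simps)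
          qed
        qed
        show "(\<lambda>x. \<Sum>i\<in>I. \<Sum>j\<in>V - I. \<psi> x * ?G i j n x) \<in> borel_measurable lborel"
          using iG by (intro borel_measurable_sum borel_measurable_integrable)
      qed measurable
      also have "\<dots> = (\<Sum>i\<in>I. \<Sum>j\<in>V - I. (\<integral>x. \<psi> x * ?G i j n x \<partial>lborel))"
        using iG by (subst Bochner_Integration.integral_sum; (intro Bochner_Integration.integrable_sum)?; simp)
      finally show ?thesis by (simp only: sum_distrib_left)
    qed
    have "(\<lambda>n. \<Sum>i\<in>I. \<Sum>j\<in>V - I. (1 / h n) * (\<integral>x. \<psi> x * ?G i j n x \<partial>lborel)) \<longlonglongrightarrow>
      (\<Sum>i\<in>I. \<Sum>j\<in>V - I. (b \<bullet> \<nu> i j) * (\<integral>x. ?\<kappa> i j x * \<psi> x \<partial>?\<sigma> i j))"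
    proof (intro tendsto_sum)
      fix i j assume ij: "i \<in> I" "j \<in> V - I"
      then have "i \<in> V" "j \<in> V" "i \<noteq> j" using V by auto
      then show "(\<lambda>n. (1 / h n) * (\<integral>x. \<psi> x * ?G i j n x \<partial>lborel)) \<longlonglongrightarrow>
          (b \<bullet> \<nu> i j) * (\<integral>x. ?\<kappa> i j x * \<psi> x \<partial>?\<sigma> i j)"
        by (intro interface_flux_limit P sep c\<psi> h h0)
    qed
    then have "(\<lambda>n. \<integral>x. e x * ?q n x \<partial>lborel) \<longlonglongrightarrow>
      (\<Sum>i\<in>I. \<Sum>j\<in>V - I. (b \<bullet> \<nu> i j) * (\<integral>x. ?\<kappa> i j x * \<psi> x \<partial>?\<sigma> i j))"
      unfolding eq .
    from LIMSEQ_unique[OF L1 this] show ?thesis by (simp add: \<psi>_def)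
  qed
  have intD: "integrable lborel (\<lambda>x. e x * (D x b \<bullet> b))" if b: "b \<in> Basis" for b
  proof (rule integrable_bounded_support[OF _ compact_imp_bounded[OF S(1)], of _ B])
    fix x
    have "\<bar>D x b \<bullet> b\<bar> \<le> norm (D x b) * norm b" by (rule Cauchy_Schwarz_ineq2)
    also have "\<dots> \<le> B" using norm_blinfun[of "D x" b] B(1)[of x] b by simp
    finally have "\<bar>e x\<bar> * \<bar>D x b \<bullet> b\<bar> \<le> 1 * B" using e01[of x] by (intro mult_mono) auto
    then show "\<bar>e x * (D x b \<bullet> b)\<bar> \<le> B" by (simp add: abs_mult)
  qed (use S(4) in auto)
  have "(\<integral>x. e x * divergence \<phi> x \<partial>lborel) = (\<integral>x. (\<Sum>b\<in>Basis. e x * (D x b \<bullet> b)) \<partial>lborel)"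
    by (simp add: dv sum_distrib_left)
  also have "\<dots> = (\<Sum>b\<in>Basis. (\<integral>x. e x * (D x b \<bullet> b) \<partial>lborel))"
    using intD by (intro Bochner_Integration.integral_sum) auto
  also have "\<dots> = (\<Sum>b\<in>Basis. \<Sum>i\<in>I. \<Sum>j\<in>V - I. (b \<bullet> \<nu> i j) *
      (\<integral>x. ?\<kappa> i j x * (\<phi> x \<bullet> b) \<partial>?\<sigma> i j))"
    by (intro sum.cong refl comp)
  also have "\<dots> = (\<Sum>i\<in>I. \<Sum>j\<in>V - I. \<Sum>b\<in>Basis. (b \<bullet> \<nu> i j) *
      (\<integral>x. ?\<kappa> i j x * (\<phi> x \<bullet> b) \<partial>?\<sigma> i j))"
    by (subst sum.swap, intro sum.cong refl, subst sum.swap, rule refl)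
  also have "\<dots> = (\<Sum>i\<in>I. \<Sum>j\<in>V - I. \<integral>x. ?\<kappa> i j x * (\<phi> x \<bullet> \<nu> i j) \<partial>?\<sigma> i j)"
  proof (intro sum.cong refl)
    fix i j assume ij: "i \<in> I" "j \<in> V - I"
    then have ij': "i \<in> V" "j \<in> V" "i \<noteq> j" using V by auto
    have [measurable]: "P i \<in> sets borel" "P j \<in> sets borel" using ij' Pb by auto
    have "emeasure (?\<sigma> i j) (P i \<inter> P j) < \<infinity>"
      using ij' P(2) by (intro emeasure_hyperplane_measure_bounded sep) (auto intro: bounded_Int compact_imp_bounded)
    then have iK: "integrable (?\<sigma> i j) (\<lambda>x. M * indicator (P i \<inter> P j) x)"
      by (auto intro!: integrable_real_indicator)
    have ib: "integrable (?\<sigma> i j) (\<lambda>x. ?\<kappa> i j x * (\<phi> x \<bullet> b))" if "b \<in> Basis" for b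
    proof (rule Bochner_Integration.integrable_bound[OF iK])
      show "AE x in ?\<sigma> i j. norm (?\<kappa> i j x * (\<phi> x \<bullet> b)) \<le> norm (M * indicator (P i \<inter> P j) x)"
      proof (rule AE_I2)
        fix x show "norm (?\<kappa> i j x * (\<phi> x \<bullet> b)) \<le> norm (M * indicator (P i \<inter> P j) x)"
          using Cauchy_Schwarz_ineq2[of "\<phi> x" b] M[of x] that by (auto simp: indicator_def)
      qed
    qed measurable
    have "(\<Sum>b\<in>Basis. (b \<bullet> \<nu> i j) * (\<integral>x. ?\<kappa> i j x * (\<phi> x \<bullet> b) \<partial>?\<sigma> i j)) =
        (\<integral>x. (\<Sum>b\<in>Basis. (b \<bullet> \<nu> i j) * (?\<kappa> i j x * (\<phi> x \<bullet> b))) \<partial>?\<sigma> i j)"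
      using ib by (subst Bochner_Integration.integral_sum) auto
    also have "\<dots> = (\<integral>x. ?\<kappa> i j x * (\<phi> x \<bullet> \<nu> i j) \<partial>?\<sigma> i j)"
    proof (intro Bochner_Integration.integral_cong refl)
      fix x
      show "(\<Sum>b\<in>Basis. (b \<bullet> \<nu> i j) * (?\<kappa> i j x * (\<phi> x \<bullet> b))) = ?\<kappa> i j x * (\<phi> x \<bullet> \<nu> i j)"
        by (subst (2) euclidean_inner) (simp add: sum_distrib_left inner_commute mult_ac)
    qed
    finally show "(\<Sum>b\<in>Basis. (b \<bullet> \<nu> i j) * (\<integral>x. ?\<kappa> i j x * (\<phi> x \<bullet> b) \<partial>?\<sigma> i j)) =
      (\<integral>x. ?\<kappa> i j x * (\<phi> x \<bullet> \<nu> i j) \<partial>?\<sigma> i j)" .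
  qed
  finally show ?thesis by (simp add: e_def)
qed

section \<open>Perimeter of unions of convex cells\<close>

lemma has_real_derivative_max_0_squared:
  "((\<lambda>t::real. (max 0 t)\<^sup>2) has_real_derivative 2 * max 0 t) (at t)"
proof -
  consider "t > 0" | "t < 0" | "t = 0" by linarith
  then show ?thesis
  proof cases
    case 1
    have "((\<lambda>t::real. t\<^sup>2) has_real_derivative 2 * t) (at t)"
      by (auto intro!: derivative_eq_intros)
    then have "((\<lambda>t::real. (max 0 t)\<^sup>2) has_real_derivative 2 * t) (at t)"
      by (rule has_field_derivative_transform_within_open[of _ _ _ "{0<..}"]) (use 1 in auto)
    then show ?thesis using 1 by simp
  next
    case 2
    have "((\<lambda>t::real. (max 0 t)\<^sup>2) has_real_derivative 0) (at t)"
      by (rule has_field_derivative_transform_within_open[of "\<lambda>_. 0" _ _ "{..<0}"]) (use 2 in auto)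
    then show ?thesis using 2 by simp
  next
    \<comment> \<open>Squaring removes the corner of the positive part: the difference quotient at 0
      is bounded by \<open>\<bar>h\<bar>\<close>.\<close>
    case 3
    have "((\<lambda>h::real. (max 0 h)\<^sup>2 / h) \<longlongrightarrow> 0) (at 0)"
    proof (rule Lim_null_comparison[where g="\<lambda>h. \<bar>h\<bar>"])
      show "\<forall>\<^sub>F h in at 0. norm ((max 0 h)\<^sup>2 / h) \<le> \<bar>h::real\<bar>"
        by (intro always_eventually) (auto simp: max_def power2_eq_square)
      show "((\<lambda>h::real. \<bar>h\<bar>) \<longlongrightarrow> 0) (at 0)" by (rule tendsto_rabs_zero) (rule tendsto_ident_at)
    qed
    then show ?thesis using 3 by (simp add: has_field_derivative_iff)
  qed
qed

text \<open>Finitely many balls inside \<open>U\<close> cover \<open>C\<close> and yield a C1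
  function \<psi> that is positive on \<open>C\<close> and supported in these balls. Dividing it by
  a positive lower bound \<open>m\<close> on \<open>C\<close> and capping it smoothly at 1 gives the
  bump.\<close>

lemma C1_bump:
  fixes C U :: "'a::euclidean_space set"
  assumes C: "compact C" and U: "open U" "C \<subseteq> U"
  obtains \<eta> :: "'a \<Rightarrow> real" and g :: "'a \<Rightarrow> 'a"
  where "continuous_on UNIV g" "\<forall>x. (\<eta> has_derivative (\<lambda>v. g x \<bullet> v)) (at x)"
    "\<forall>x. 0 \<le> \<eta> x \<and> \<eta> x \<le> 1" "\<forall>x\<in>C. \<eta> x = 1"
    "compact (closure {x. \<eta> x \<noteq> 0})" "closure {x. \<eta> x \<noteq> 0} \<subseteq> U"
proof -
  have "\<forall>x\<in>C. \<exists>r>0. cball x r \<subseteq> U"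
    using U open_contains_cball by blast
  then obtain r where r: "\<And>x. x \<in> C \<Longrightarrow> r x > 0" "\<And>x. x \<in> C \<Longrightarrow> cball x (r x) \<subseteq> U" by metis
  have "C \<subseteq> (\<Union>c\<in>C. ball c (r c))"
  proof
    fix x assume "x \<in> C" then show "x \<in> (\<Union>c\<in>C. ball c (r c))" using r(1)[of x] by (intro UN_I[of x]) auto
  qed
  then obtain N where N: "N \<subseteq> C" "finite N" "C \<subseteq> (\<Union>c\<in>N. ball c (r c))"
    by (rule compactE_image[OF C open_ball]) 
  define q where "q c x = (r c)\<^sup>2 - (norm (x - c))\<^sup>2" for c x :: 'a
  define \<psi> where "\<psi> x = (\<Sum>c\<in>N. (max 0 (q c x))\<^sup>2)" for x
  define G where "G x = (\<Sum>c\<in>N. (2 * max 0 (q c x)) *\<^sub>R ((-2) *\<^sub>R (x - c)))" for x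
  have d\<psi>: "(\<psi> has_derivative (\<lambda>v. G x \<bullet> v)) (at x)" for x
  proof -
    have "((\<lambda>x. (max 0 (q c x))\<^sup>2) has_derivative (\<lambda>v. ((2 * max 0 (q c x)) *\<^sub>R ((-2) *\<^sub>R (x - c))) \<bullet> v)) (at x)" for c
    proof -
      have "(q c has_derivative (\<lambda>v. -2 * ((x - c) \<bullet> v))) (at x)"
        unfolding q_def power2_norm_eq_inner
        by (auto intro!: derivative_eq_intros simp: inner_commute)
      moreover have "((\<lambda>t. (max 0 t)\<^sup>2) has_derivative (*) (2 * max 0 (q c x))) (at (q c x))"
        using has_real_derivative_max_0_squared[of "q c x"] by (simp add: has_field_derivative_def)
      ultimately have "((\<lambda>x. (max 0 (q c x))\<^sup>2) has_derivative (\<lambda>v. 2 * max 0 (q c x) * (-2 * ((x - c) \<bullet> v)))) (at x)"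
        by (rule has_derivative_compose)
      then show ?thesis by (simp add: mult.assoc)
    qed
    then have "(\<psi> has_derivative (\<lambda>v. \<Sum>c\<in>N. ((2 * max 0 (q c x)) *\<^sub>R ((-2) *\<^sub>R (x - c))) \<bullet> v)) (at x)"
      unfolding \<psi>_def by (intro has_derivative_sum)
    then show ?thesis by (simp add: G_def inner_sum_left)
  qed
  have c\<psi>: "continuous_on UNIV \<psi>" unfolding \<psi>_def q_def by (intro continuous_intros)
  have cG: "continuous_on UNIV G" unfolding G_def q_def by (intro continuous_intros)
  have \<psi>0: "\<psi> x \<ge> 0" for x by (simp add: \<psi>_def sum_nonneg)
  have pos: "\<psi> x > 0" if x: "x \<in> C" for x
  proof -
    obtain c where c: "c \<in> N" "x \<in> ball c (r c)" using subsetD[OF N(3) x] by blast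
    then have "(norm (x - c))\<^sup>2 < (r c)\<^sup>2"
      by (intro power_strict_mono) (auto simp: dist_norm norm_minus_commute)
    then have "0 < (max 0 (q c x))\<^sup>2" by (simp add: q_def)
    also have "\<dots> \<le> \<psi> x" unfolding \<psi>_def using c N by (intro member_le_sum) auto
    finally show ?thesis .
  qed
  obtain m where m: "m > 0" "\<And>x. x \<in> C \<Longrightarrow> m \<le> \<psi> x"
  proof (cases "C = {}")
    case True with that[of 1] show ?thesis by simp
  next
    case False
    obtain x0 where "x0 \<in> C" "\<forall>y\<in>C. \<psi> x0 \<le> \<psi> y"
      using continuous_attains_inf[OF C False, of \<psi>] continuous_on_subset[OF c\<psi>, of C] by auto
    then show ?thesis using pos[of x0] by (intro that[of "\<psi> x0"]) auto
  qed
  \<comment> \<open>The cap \<open>s \<mapsto> 1 - (max 0 (1 - s))\<^sup>2\<close> is C1, sends 0 to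
    0 and is constantly 1 from \<open>s = 1\<close> on, hence wherever
    \<open>\<psi> x \<ge> m\<close>.\<close>
  define \<eta> where "\<eta> x = 1 - (max 0 (1 - \<psi> x / m))\<^sup>2" for x
  define g where "g x = (2 / m * max 0 (1 - \<psi> x / m)) *\<^sub>R G x" for x
  have d\<eta>: "(\<eta> has_derivative (\<lambda>v. g x \<bullet> v)) (at x)" for x
  proof -
    have "((\<lambda>x. 1 - \<psi> x / m) has_derivative (\<lambda>v. - (G x \<bullet> v) / m)) (at x)"
      using d\<psi>[of x] m by (auto intro!: derivative_eq_intros)
    moreover have "((\<lambda>t. (max 0 t)\<^sup>2) has_derivative (*) (2 * max 0 (1 - \<psi> x / m))) (at (1 - \<psi> x / m))"
      using has_real_derivative_max_0_squared[of "1 - \<psi> x / m"] by (simp add: has_field_derivative_def)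
    ultimately have "((\<lambda>x. (max 0 (1 - \<psi> x / m))\<^sup>2) has_derivative (\<lambda>v. 2 * max 0 (1 - \<psi> x / m) * (- (G x \<bullet> v) / m))) (at x)"
      by (rule has_derivative_compose)
    then have "(\<eta> has_derivative (\<lambda>v. 0 - 2 * max 0 (1 - \<psi> x / m) * (- (G x \<bullet> v) / m))) (at x)"
      unfolding \<eta>_def by (intro has_derivative_diff has_derivative_const)
    then show ?thesis by (simp add: g_def mult.assoc)
  qed
  have \<eta>01: "0 \<le> \<eta> x \<and> \<eta> x \<le> 1" for x
  proof -
    have "max 0 (1 - \<psi> x / m) \<le> 1" "max 0 (1 - \<psi> x / m) \<ge> 0" using \<psi>0[of x] m by auto
    then have "(max 0 (1 - \<psi> x / m))\<^sup>2 \<le> 1" by (simp add: power_le_one)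
    then show ?thesis by (simp add: \<eta>_def)
  qed
  have \<eta>1: "\<eta> x = 1" if "x \<in> C" for x using m(1) m(2)[OF that] by (simp add: \<eta>_def max_def field_simps)
  have "{x. \<eta> x \<noteq> 0} \<subseteq> (\<Union>c\<in>N. cball c (r c))"
  proof
    fix x assume x: "x \<in> {x. \<eta> x \<noteq> 0}"
    show "x \<in> (\<Union>c\<in>N. cball c (r c))"
    proof (rule ccontr)
      assume "x \<notin> (\<Union>c\<in>N. cball c (r c))"
      then have "r c < norm (x - c)" "r c > 0" if "c \<in> N" for c
        using that r N by (auto simp: dist_norm norm_minus_commute not_le)
      then have "(r c)\<^sup>2 \<le> (norm (x - c))\<^sup>2" if "c \<in> N" for c
        using that by (intro power_mono) (auto intro: less_imp_le)
      then have "\<psi> x = 0" unfolding \<psi>_def q_def by (intro sum.neutral) auto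
      with x show False by (simp add: \<eta>_def)
    qed
  qed
  moreover have cN: "compact (\<Union>c\<in>N. cball c (r c))" using N by (intro compact_UN) auto
  ultimately have cl: "closure {x. \<eta> x \<noteq> 0} \<subseteq> (\<Union>c\<in>N. cball c (r c))"
    by (intro closure_minimal compact_imp_closed)
  show ?thesis
  proof (rule that[of g \<eta>])
    show "continuous_on UNIV g" unfolding g_def using m by (intro continuous_intros c\<psi> cG) auto
    show "compact (closure {x. \<eta> x \<noteq> 0})" 
      using compact_Int_closed[OF cN closed_closure[of "{x. \<eta> x \<noteq> 0}"]] cl by (simp add: Int_absorb1)
    show "closure {x. \<eta> x \<noteq> 0} \<subseteq> U" using cl r(2) N(1) by blast
  qed (use d\<eta> \<eta>01 \<eta>1 in auto)
qed

lemma finite_uniform_positive: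
  fixes Q :: "'b \<Rightarrow> real \<Rightarrow> bool"
  assumes "finite A" "\<And>x. x \<in> A \<Longrightarrow> \<exists>d>0. Q x d" "\<And>x d d'. Q x d \<Longrightarrow> d' \<le> d \<Longrightarrow> Q x d'"
  shows "\<exists>d>0. \<forall>x\<in>A. Q x d"
  using assms(1,2)
proof (induction A rule: finite_induct)
  case empty
  then show ?case by (intro exI[of _ 1]) simp
next
  case (insert x A)
  have "\<exists>d>0. Q x d" using insert.prems by blast
  then obtain d1 where d1: "d1 > 0" "Q x d1" by blast
  have "\<exists>d>0. \<forall>x\<in>A. Q x d" using insert.prems by (intro insert.IH) auto
  then obtain d2 where d2: "d2 > 0" "\<forall>x\<in>A. Q x d2" by blast
  have "Q y (min d1 d2)" if "y \<in> insert x A" for y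
    using that d1 d2 assms(3)[of y _ "min d1 d2"] by (metis insertE min.cobounded1 min.cobounded2)
  then show ?case using d1 d2 by (intro exI[of _ "min d1 d2"]) auto
qed

text \<open>Disjoint compact sets have positive distance, so the bumps around them can be given
  disjoint supports. At every point at most one term of the sum is then nonzero, which keeps the
  norm at most 1.\<close>

lemma C1_field_prescribed_on_disjoint_compacts:
  fixes C :: "'p \<Rightarrow> 'a::euclidean_space set" and u :: "'p \<Rightarrow> 'a"
  assumes A: "finite A" and C: "\<And>p. p \<in> A \<Longrightarrow> compact (C p)" "\<And>p. p \<in> A \<Longrightarrow> C p \<subseteq> \<Omega>"
    and disj: "\<And>p q. p \<in> A \<Longrightarrow> q \<in> A \<Longrightarrow> p \<noteq> q \<Longrightarrow> C p \<inter> C q = {}"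
    and u: "\<And>p. p \<in> A \<Longrightarrow> norm (u p) \<le> 1" and \<Omega>: "open \<Omega>"
  obtains \<phi> where "\<phi> \<in> C1_compact_support \<Omega>" "\<forall>x. norm (\<phi> x) \<le> 1" "\<forall>p\<in>A. \<forall>x\<in>C p. \<phi> x = u p"
proof -
  have "\<exists>d>0. \<forall>pq\<in>A \<times> A. fst pq \<noteq> snd pq \<longrightarrow> (\<forall>x\<in>C (fst pq). \<forall>y\<in>C (snd pq). d \<le> dist x y)"
  proof (rule finite_uniform_positive)
    fix pq assume pq: "pq \<in> A \<times> A"
    show "\<exists>d>0. fst pq \<noteq> snd pq \<longrightarrow> (\<forall>x\<in>C (fst pq). \<forall>y\<in>C (snd pq). d \<le> dist x y)"
    proof (cases "fst pq = snd pq")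
      case False
      then have "\<exists>d>0. \<forall>x\<in>C (fst pq). \<forall>y\<in>C (snd pq). d \<le> dist x y"
        using pq by (intro separate_compact_closed C compact_imp_closed disj) auto
      then show ?thesis by blast
    qed (auto intro: exI[of _ 1])
  qed (use A in \<open>auto intro: order_trans\<close>)
  then obtain d where d: "d > 0"
    "\<And>p q x y. p \<in> A \<Longrightarrow> q \<in> A \<Longrightarrow> p \<noteq> q \<Longrightarrow> x \<in> C p \<Longrightarrow> y \<in> C q \<Longrightarrow> d \<le> dist x y" by auto
  define U where "U p = \<Omega> \<inter> (\<Union>x\<in>C p. ball x (d / 2))" for p
  have oU: "open (U p)" for p unfolding U_def using \<Omega> by (intro open_Int open_UN) auto
  have CU: "C p \<subseteq> U p" if "p \<in> A" for p using C(2)[OF that] d(1) by (force simp: U_def)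
  have disjU: "p = q" if "p \<in> A" "q \<in> A" "z \<in> U p" "z \<in> U q" for p q z
  proof (rule ccontr)
    assume "p \<noteq> q"
    obtain x y where xy: "x \<in> C p" "dist x z < d / 2" "y \<in> C q" "dist y z < d / 2"
      using \<open>z \<in> U p\<close> \<open>z \<in> U q\<close> by (auto simp: U_def)
    then have "d \<le> dist x y" using d(2) that \<open>p \<noteq> q\<close> by blast
    then show False using xy dist_triangle2[of x y z] by linarith
  qed
  let ?bump = "\<lambda>p \<eta> g. continuous_on UNIV g \<and> (\<forall>x. (\<eta> has_derivative (\<lambda>v. g x \<bullet> v)) (at x)) \<and>
    (\<forall>x. 0 \<le> \<eta> x \<and> \<eta> x \<le> 1) \<and> (\<forall>x\<in>C p. \<eta> x = 1) \<and>
    compact (closure {x. \<eta> x \<noteq> 0}) \<and> closure {x. \<eta> x \<noteq> (0::real)} \<subseteq> U p"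
  have "\<exists>\<eta> g. ?bump p \<eta> g" if "p \<in> A" for p
    by (rule C1_bump[OF C(1)[OF that] oU CU[OF that]]) blast
  then obtain \<eta> g where bump: "\<forall>p\<in>A. ?bump p (\<eta> p) (g p)" by metis
  then have \<eta>: "\<And>p. p \<in> A \<Longrightarrow> continuous_on UNIV (g p)"
    "\<And>p x. p \<in> A \<Longrightarrow> (\<eta> p has_derivative (\<lambda>v. g p x \<bullet> v)) (at x)"
    "\<And>p x. p \<in> A \<Longrightarrow> 0 \<le> \<eta> p x \<and> \<eta> p x \<le> 1" "\<And>p x. p \<in> A \<Longrightarrow> x \<in> C p \<Longrightarrow> \<eta> p x = 1"
    "\<And>p. p \<in> A \<Longrightarrow> compact (closure {x. \<eta> p x \<noteq> 0})" "\<And>p. p \<in> A \<Longrightarrow> closure {x. \<eta> p x \<noteq> 0} \<subseteq> U p"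
    by simp_all
  define \<phi> where "\<phi> x = (\<Sum>p\<in>A. \<eta> p x *\<^sub>R u p)" for x
  define L where "L x v = (\<Sum>p\<in>A. (g p x \<bullet> v) *\<^sub>R u p)" for x v
  have bL: "bounded_linear (L x)" for x unfolding L_def
    by (intro bounded_linear_sum bounded_linear_scaleR_const bounded_linear_inner_right)
  have zero: "\<eta> q x = 0" if "p \<in> A" "q \<in> A" "q \<noteq> p" "\<eta> p x \<noteq> 0" for p q x
  proof (rule ccontr)
    assume "\<eta> q x \<noteq> 0"
    then have "x \<in> U p" "x \<in> U q"
      using that \<eta>(6)[of p] \<eta>(6)[of q] closure_subset[of "{x. \<eta> p x \<noteq> 0}"] closure_subset[of "{x. \<eta> q x \<noteq> 0}"] by auto
    with disjU that show False by blast
  qed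
  have single: "\<phi> x = \<eta> p x *\<^sub>R u p" if "p \<in> A" "\<eta> p x \<noteq> 0" for p x
  proof -
    have "\<phi> x = \<eta> p x *\<^sub>R u p + (\<Sum>q\<in>A - {p}. \<eta> q x *\<^sub>R u q)"
      unfolding \<phi>_def using A that(1) by (rule sum.remove)
    also have "(\<Sum>q\<in>A - {p}. \<eta> q x *\<^sub>R u q) = 0"
      using zero[OF that(1)] that(2) by (intro sum.neutral) auto
    finally show ?thesis by simp
  qed
  show ?thesis
  proof (rule that[of \<phi>])
    have supp: "{x. \<phi> x \<noteq> 0} \<subseteq> (\<Union>p\<in>A. closure {x. \<eta> p x \<noteq> 0})"
    proof
      fix x assume "x \<in> {x. \<phi> x \<noteq> 0}"
      then obtain p where "p \<in> A" "\<eta> p x \<noteq> 0" unfolding \<phi>_def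
        by (metis (mono_tags, lifting) mem_Collect_eq scale_zero_left sum.neutral)
      then show "x \<in> (\<Union>p\<in>A. closure {x. \<eta> p x \<noteq> 0})"
        using closure_subset[of "{x. \<eta> p x \<noteq> 0}"] by blast
    qed
    have cS: "compact (\<Union>p\<in>A. closure {x. \<eta> p x \<noteq> 0})" using A \<eta>(5) by (intro compact_UN) auto
    have cl: "closure {x. \<phi> x \<noteq> 0} \<subseteq> (\<Union>p\<in>A. closure {x. \<eta> p x \<noteq> 0})"
      using supp cS by (intro closure_minimal compact_imp_closed)
    have "compact (closure {x. \<phi> x \<noteq> 0})"
      using compact_Int_closed[OF cS closed_closure[of "{x. \<phi> x \<noteq> 0}"]] cl by (simp add: Int_absorb1)
    moreover have "closure {x. \<phi> x \<noteq> 0} \<subseteq> \<Omega>"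
      using cl \<eta>(6) unfolding U_def by blast
    moreover have "continuous_on UNIV (\<lambda>x. Blinfun (L x))"
    proof (rule continuous_on_blinfun_componentwise)
      fix i :: 'a
      show "continuous_on UNIV (\<lambda>x. Blinfun (L x) i)"
        unfolding bounded_linear_Blinfun_apply[OF bL] L_def by (intro continuous_intros \<eta>(1))
    qed
    moreover have "(\<phi> has_derivative blinfun_apply (Blinfun (L x))) (at x)" for x
      unfolding bounded_linear_Blinfun_apply[OF bL] unfolding L_def \<phi>_def
      by (intro has_derivative_sum has_derivative_scaleR_left \<eta>(2))
    ultimately show "\<phi> \<in> C1_compact_support \<Omega>" unfolding C1_compact_support_def by blast
    show "\<forall>x. norm (\<phi> x) \<le> 1"
    proof
      fix x
      show "norm (\<phi> x) \<le> 1"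
      proof (cases "\<exists>p\<in>A. \<eta> p x \<noteq> 0")
        case True
        then obtain p where p: "p \<in> A" "\<eta> p x \<noteq> 0" by blast
        show ?thesis using single[OF p] u[OF p(1)] \<eta>(3)[OF p(1), of x] mult_le_one[of "\<eta> p x" "norm (u p)"] by simp
      qed (simp add: \<phi>_def)
    qed
    show "\<forall>p\<in>A. \<forall>x\<in>C p. \<phi> x = u p" using single \<eta>(4) by simp
  qed
qed

section \<open>Null frontiers and compact parts of interfaces\<close>

lemma AE_not_in_frontiers:
  fixes P :: "'i \<Rightarrow> 'a::euclidean_space set"
  assumes "finite V" "\<And>i. i \<in> V \<Longrightarrow> convex (P i)"
  shows "AE x in lborel. \<forall>i\<in>V. x \<notin> frontier (P i)"
by (rule AE_finite_allI[OF assms(1)]) (intro AE_not_in convex_frontier_null_sets assms(2))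

text \<open>A point of a closed cell off its frontier is interior to the cell and hence to the
  union. Frontiers of convex sets are null, so passing to the interior removes only a null
  set.\<close>

lemma set_integral_interior_Union_convex:
  fixes P :: "'i \<Rightarrow> 'a::euclidean_space set" and f :: "'a \<Rightarrow> real"
  assumes V: "finite V" and P: "\<And>i. i \<in> V \<Longrightarrow> convex (P i)" "\<And>i. i \<in> V \<Longrightarrow> closed (P i)"
    and f[measurable]: "f \<in> borel_measurable borel"
  shows "(LINT x:interior (\<Union>i\<in>V. P i)|lebesgue. f x) = (\<integral>x. indicator (\<Union>i\<in>V. P i) x * f x \<partial>lborel)"
proof -
  have [measurable]: "(\<Union>i\<in>V. P i) \<in> sets borel" using V P by (intro sets.finite_UN) auto
  have "(LINT x:interior (\<Union>i\<in>V. P i)|lebesgue. f x) = (\<integral>x. indicator (interior (\<Union>i\<in>V. P i)) x * f x \<partial>lborel)"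
    unfolding set_lebesgue_integral_def by (subst integral_completion) auto
  also have "\<dots> = (\<integral>x. indicator (\<Union>i\<in>V. P i) x * f x \<partial>lborel)"
  proof (rule integral_cong_AE)
    show "AE x in lborel. indicator (interior (\<Union>i\<in>V. P i)) x * f x = indicator (\<Union>i\<in>V. P i) x * f x"
      using AE_not_in_frontiers[of V P, OF V P(1)]
    proof (rule eventually_mono)
      fix x assume x: "\<forall>i\<in>V. x \<notin> frontier (P i)"
      have "x \<in> interior (\<Union>i\<in>V. P i)" if "i \<in> V" "x \<in> P i" for i
      proof -
        have "x \<in> interior (P i)" using x that P(2)[OF that(1)] by (auto simp: frontier_def)
        moreover have "interior (P i) \<subseteq> interior (\<Union>i\<in>V. P i)" using that by (intro interior_mono) auto
        ultimately show ?thesis by blast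
      qed
      then have "x \<in> interior (\<Union>i\<in>V. P i) \<longleftrightarrow> x \<in> (\<Union>i\<in>V. P i)"
        using interior_subset[of "\<Union>i\<in>V. P i"] by blast
      then show "indicator (interior (\<Union>i\<in>V. P i)) x * f x = indicator (\<Union>i\<in>V. P i) x * f x"
        by (simp add: indicator_def)
    qed
  qed measurable
  finally show ?thesis .
qed

text \<open>At almost every point of the interface half balls of \<open>P\<close> and
  \<open>Q\<close> combine to a full ball, so the point is interior to \<open>P \<union> Q\<close>.
  Points at distance at least \<open>1 / Suc n\<close> from the complement of this interior exhaust
  the interface by compact sets. Lying in the interior is what later makes the compact parts of
  different interfaces disjoint and contained in \<Omega>.\<close>

lemma interface_inner_compact:
  fixes P Q :: "'a::euclidean_space set"
  assumes \<nu>: "norm \<nu> = 1"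
    and P: "convex P" "compact P" "interior P \<noteq> {}" "P \<subseteq> {x. x \<bullet> \<nu> \<le> a}"
    and Q: "convex Q" "compact Q" "interior Q \<noteq> {}" "Q \<subseteq> {x. x \<bullet> \<nu> \<ge> a}" and d: "d > 0"
  shows "\<exists>C. compact C \<and> C \<subseteq> P \<inter> Q \<inter> interior (P \<union> Q) \<and>
    measure (hyperplane_measure \<nu> a) (P \<inter> Q) \<le> measure (hyperplane_measure \<nu> a) C + d"
proof -
  let ?\<sigma> = "hyperplane_measure \<nu> a" and ?K = "P \<inter> Q"
  define G where "G = interior (P \<union> Q)"
  have nn: "\<nu> \<bullet> \<nu> = 1" using \<nu> by (simp add: norm_eq_1)
  have cK: "compact ?K" "convex ?K" using P Q by (auto simp: compact_Int compact_imp_closed convex_Int)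
  have KB: "?K \<in> sets borel" "G \<in> sets borel" using cK by (auto simp: compact_imp_closed G_def)
  have finK: "emeasure ?\<sigma> A < \<infinity>" if "A \<subseteq> ?K" for A
    using that cK(1) by (intro emeasure_hyperplane_measure_bounded[OF \<nu>] bounded_subset[OF compact_imp_bounded])
  have "emeasure ?\<sigma> (?K - G) = 0"
  proof -
    have "AE z in lborel. \<not> (a \<le> z \<bullet> \<nu> \<and> z \<bullet> \<nu> \<le> a + 1 \<and> z - (z \<bullet> \<nu> - a) *\<^sub>R \<nu> \<in> ?K - G)"
      using AE_interface_interior[OF \<nu> cK(2) compact_imp_closed[OF cK(1)], of a]
    proof (rule eventually_mono, intro notI)
      fix z let ?y = "z - (z \<bullet> \<nu> - a) *\<^sub>R \<nu>"
      assume 1: "a \<le> z \<bullet> \<nu> \<longrightarrow> z \<bullet> \<nu> \<le> a + 1 \<longrightarrow> ?y \<in> ?K \<longrightarrow>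
          (\<exists>e>0. \<forall>v. v \<bullet> \<nu> = 0 \<longrightarrow> norm v < e \<longrightarrow> ?y + v \<in> ?K)"
        and 2: "a \<le> z \<bullet> \<nu> \<and> z \<bullet> \<nu> \<le> a + 1 \<and> ?y \<in> ?K - G"
      then obtain e where e: "e > 0" "\<And>v. v \<bullet> \<nu> = 0 \<Longrightarrow> norm v < e \<Longrightarrow> ?y + v \<in> ?K" by blast
      have y: "?y \<bullet> \<nu> = a" using nn by (simp add: inner_diff_left)
      obtain r where r: "r > 0" "\<And>x. norm (x - ?y) < r \<Longrightarrow> x \<bullet> \<nu> \<le> a \<Longrightarrow> x \<in> P"
        "\<And>x. norm (x - ?y) < r \<Longrightarrow> x \<bullet> \<nu> \<ge> a \<Longrightarrow> x \<in> Q"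
        using both_half_balls[OF \<nu> P(1,3,4) Q(1,3,4) e(1) y e(2)] by blast
      have "ball ?y r \<subseteq> P \<union> Q"
      proof
        fix x assume "x \<in> ball ?y r"
        then have "norm (x - ?y) < r" by (simp add: dist_norm norm_minus_commute)
        then show "x \<in> P \<union> Q" using r(2,3)[of x] by (cases "x \<bullet> \<nu> \<le> a") auto
      qed
      then have "?y \<in> G" using r(1) unfolding G_def mem_interior by blast
      with 2 show False by blast
    qed
    from emeasure_eq_0_AE[OF this] KB show ?thesis
      by (subst emeasure_hyperplane_measure) auto
  qed
  then have KG: "measure ?\<sigma> (?K \<inter> G) = measure ?\<sigma> ?K"
  proof -
    have "emeasure ?\<sigma> ?K = emeasure ?\<sigma> (?K \<inter> G) + emeasure ?\<sigma> (?K - G)"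
      using KB by (subst plus_emeasure) (auto intro!: arg_cong[where f="emeasure ?\<sigma>"])
    then show ?thesis using \<open>emeasure ?\<sigma> (?K - G) = 0\<close> by (simp add: measure_def)
  qed
  define C where "C n = {y \<in> ?K. 1 / real (Suc n) \<le> infdist y (- G)}" for n
  have cC: "compact (C n)" for n
  proof -
    have "closed {y. 1 / real (Suc n) \<le> infdist y (- G)}"
      by (intro closed_Collect_le continuous_intros)
    moreover have "C n = ?K \<inter> {y. 1 / real (Suc n) \<le> infdist y (- G)}" by (auto simp: C_def)
    ultimately show ?thesis using cK(1) by (simp add: compact_Int_closed)
  qed
  \<comment> \<open>\<open>infdist\<close> to the empty set is 0 by convention, so it detects
    membership in \<open>- G\<close> only when that set is nonempty.\<close>
  have neG: "- G \<noteq> {}"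
  proof
    assume "- G = {}"
    then have "bounded (UNIV :: 'a set)"
      using bounded_subset[OF bounded_Un[THEN iffD2, OF conjI[OF compact_imp_bounded[OF P(2)] compact_imp_bounded[OF Q(2)]]]]
        interior_subset[of "P \<union> Q"] unfolding G_def by (metis Compl_empty_eq double_compl)
    then show False using not_bounded_UNIV by blast
  qed
  have clG: "closed (- G)" by (simp add: G_def closed_Compl)
  have C_un: "(\<Union>n. C n) = ?K \<inter> G"
  proof (intro antisym subsetI)
    fix y assume "y \<in> (\<Union>n. C n)"
    then obtain n where n: "y \<in> ?K" "1 / real (Suc n) \<le> infdist y (- G)" by (auto simp: C_def)
    have "0 < 1 / real (Suc n)" by simp
    then have "infdist y (- G) \<noteq> 0" using n(2) by linarith
    then show "y \<in> ?K \<inter> G" using n(1) by (metis ComplI IntI infdist_zero)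
  next
    fix y assume y: "y \<in> ?K \<inter> G"
    then have "infdist y (- G) \<noteq> 0" using in_closed_iff_infdist_zero[OF clG neG] by blast
    then have "infdist y (- G) > 0" using infdist_nonneg[of y "- G"] by linarith
    then obtain n where "inverse (real (Suc n)) < infdist y (- G)" using reals_Archimedean by blast
    then show "y \<in> (\<Union>n. C n)" using y by (auto simp: C_def inverse_eq_divide intro!: exI[of _ n])
  qed
  have "incseq C"
  proof (intro incseq_SucI subsetI)
    fix n y assume "y \<in> C n"
    then have "y \<in> ?K" "1 / real (Suc n) \<le> infdist y (- G)" by (auto simp: C_def)
    moreover have "1 / real (Suc (Suc n)) \<le> 1 / real (Suc n)" by (intro divide_left_mono) auto
    ultimately show "y \<in> C (Suc n)" unfolding C_def by fastforce
  qed
  moreover have "range C \<subseteq> sets ?\<sigma>" using cC by (auto simp: compact_imp_closed)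
  moreover have "emeasure ?\<sigma> (\<Union>n. C n) \<noteq> \<infinity>" unfolding C_un using finK[OF Int_lower1, of G] by simp
  ultimately have "(\<lambda>n. measure ?\<sigma> (C n)) \<longlonglongrightarrow> measure ?\<sigma> ?K"
    unfolding KG[symmetric] C_un[symmetric] by (intro Lim_measure_incseq)
  then have "eventually (\<lambda>n. dist (measure ?\<sigma> (C n)) (measure ?\<sigma> ?K) < d) sequentially"
    using d by (rule tendstoD)
  then obtain n where "dist (measure ?\<sigma> (C n)) (measure ?\<sigma> ?K) < d" by (auto simp: eventually_sequentially)
  then have "measure ?\<sigma> ?K \<le> measure ?\<sigma> (C n) + d" by (simp add: dist_real_def)
  moreover have "C n \<subseteq> ?K \<inter> G" using C_un by blast
  ultimately show ?thesis using cC[of n] unfolding G_def by blast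
qed

text \<open>The last hypothesis excludes cracks: an interface inside the union of the cells but
  outside \<Omega> would be invisible to the test fields. As the left side shows, the sum does not
  depend on the chosen separating hyperplanes.\<close>

theorem perimeter_union_of_cells:
  fixes P :: "'i \<Rightarrow> 'a::euclidean_space set"
  assumes V: "finite V" "I \<subseteq> V"
    and P: "\<And>i. i \<in> V \<Longrightarrow> convex (P i)" "\<And>i. i \<in> V \<Longrightarrow> compact (P i)" "\<And>i. i \<in> V \<Longrightarrow> interior (P i) \<noteq> {}"
    and sep: "\<And>i j. i \<in> V \<Longrightarrow> j \<in> V \<Longrightarrow> i \<noteq> j \<Longrightarrow> norm (\<nu> i j) = 1"
      "\<And>i j. i \<in> V \<Longrightarrow> j \<in> V \<Longrightarrow> i \<noteq> j \<Longrightarrow> P i \<subseteq> {x. x \<bullet> \<nu> i j \<le> a i j}"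
      "\<And>i j. i \<in> V \<Longrightarrow> j \<in> V \<Longrightarrow> i \<noteq> j \<Longrightarrow> P j \<subseteq> {x. x \<bullet> \<nu> i j \<ge> a i j}"
    and \<Omega>: "open \<Omega>" "\<Omega> \<subseteq> (\<Union>i\<in>V. P i)" "interior (\<Union>i\<in>V. P i) \<subseteq> \<Omega>"
  shows "perimeter (interior (\<Union>i\<in>I. P i)) \<Omega> =
    ereal (\<Sum>i\<in>I. \<Sum>j\<in>V - I. measure (hyperplane_measure (\<nu> i j) (a i j)) (P i \<inter> P j))"
proof -
  let ?\<sigma> = "\<lambda>i j. hyperplane_measure (\<nu> i j) (a i j)" and ?E = "interior (\<Union>i\<in>I. P i)"
  define S where "S = (\<Sum>i\<in>I. \<Sum>j\<in>V - I. measure (?\<sigma> i j) (P i \<inter> P j))"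
  have fI: "finite I" using V finite_subset by auto
  have ij: "i \<in> V" "j \<in> V" "i \<noteq> j" if "i \<in> I" "j \<in> V - I" for i j using V that by auto
  have Pb: "P i \<in> sets borel" if "i \<in> V" for i using P(2)[OF that] by (simp add: compact_imp_closed)
  have finK: "emeasure (?\<sigma> i j) (P i \<inter> P j) < \<infinity>" if "i \<in> I" "j \<in> V - I" for i j
    using ij[OF that] P(2) by (intro emeasure_hyperplane_measure_bounded sep) (auto intro: bounded_Int compact_imp_bounded)
  let ?div = "\<lambda>\<phi>. LINT x:?E|lebesgue. divergence \<phi> x"
  have flux: "?div \<phi> =
      (\<Sum>i\<in>I. \<Sum>j\<in>V - I. \<integral>x. indicator (P i \<inter> P j) x * (\<phi> x \<bullet> \<nu> i j) \<partial>?\<sigma> i j)"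
    if \<phi>: "\<phi> \<in> C1_compact_support \<Omega>" for \<phi>
  proof -
    have "divergence \<phi> \<in> borel_measurable borel" by (rule C1_compact_supportE[OF \<phi>])
    then have "?div \<phi> = (\<integral>x. indicator (\<Union>i\<in>I. P i) x * divergence \<phi> x \<partial>lborel)"
      using V P by (intro set_integral_interior_Union_convex fI) (auto intro: compact_imp_closed)
    also have "\<dots> = (\<Sum>i\<in>I. \<Sum>j\<in>V - I. \<integral>x. indicator (P i \<inter> P j) x * (\<phi> x \<bullet> \<nu> i j) \<partial>?\<sigma> i j)"
      by (rule divergence_integral_eq_interface_flux[OF V P sep \<Omega>(1,2) \<phi>])
    finally show ?thesis .
  qed
  let ?\<kappa> = "\<lambda>i j. indicator (P i \<inter> P j) :: 'a \<Rightarrow> real"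
  have int: "integrable (?\<sigma> i j) (\<lambda>x. ?\<kappa> i j x * (\<phi> x \<bullet> \<nu> i j))"
    "\<And>x. \<bar>\<phi> x \<bullet> \<nu> i j\<bar> \<le> 1"
    if "i \<in> I" "j \<in> V - I" and \<phi>: "\<phi> \<in> C1_compact_support \<Omega>" "\<forall>x. norm (\<phi> x) \<le> 1" for i j \<phi>
  proof -
    have [measurable]: "P i \<in> sets borel" "P j \<in> sets borel" using ij[OF that(1,2)] Pb by auto
    have "continuous_on UNIV \<phi>" by (rule C1_compact_supportE[OF \<phi>(1)])
    then have [measurable]: "\<phi> \<in> borel_measurable borel" by (rule borel_measurable_continuous_onI)
    show 1: "\<bar>\<phi> x \<bullet> \<nu> i j\<bar> \<le> 1" for x
      using Cauchy_Schwarz_ineq2[of "\<phi> x" "\<nu> i j"] \<phi>(2) sep(1)[OF ij[OF that(1,2)]] by (auto intro: order_trans)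
    show "integrable (?\<sigma> i j) (\<lambda>x. ?\<kappa> i j x * (\<phi> x \<bullet> \<nu> i j))"
    proof (rule Bochner_Integration.integrable_bound)
      show "integrable (?\<sigma> i j) (?\<kappa> i j)"
        using finK[OF that(1,2)] by (intro integrable_real_indicator) auto
      show "AE x in ?\<sigma> i j. norm (?\<kappa> i j x * (\<phi> x \<bullet> \<nu> i j)) \<le> norm (?\<kappa> i j x)"
        using 1 by (intro AE_I2) (auto simp: indicator_def)
    qed measurable
  qed
  have indint: "integrable (?\<sigma> i j) (indicator A :: 'a \<Rightarrow> real)" "(\<integral>x. indicator A x \<partial>?\<sigma> i j) = measure (?\<sigma> i j) A"
    if "i \<in> I" "j \<in> V - I" "A \<in> sets borel" "A \<subseteq> P i \<inter> P j" for i j A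
  proof -
    have "P i \<inter> P j \<in> sets borel" using ij[OF that(1,2)] Pb by auto
    then have "emeasure (?\<sigma> i j) A \<le> emeasure (?\<sigma> i j) (P i \<inter> P j)" using that by (intro emeasure_mono) auto
    then have "emeasure (?\<sigma> i j) A < \<infinity>" using finK[OF that(1,2)] by (rule order_le_less_trans)
    then show "integrable (?\<sigma> i j) (indicator A :: 'a \<Rightarrow> real)" using that(3) by (intro integrable_real_indicator) auto
    show "(\<integral>x. indicator A x \<partial>?\<sigma> i j) = measure (?\<sigma> i j) A" using that(3) by simp
  qed
  have upper: "?div \<phi> \<le> S"
    if \<phi>: "\<phi> \<in> C1_compact_support \<Omega>" "\<forall>x. norm (\<phi> x) \<le> 1" for \<phi>
    unfolding flux[OF \<phi>(1)] S_def
  proof (intro sum_mono)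
    fix i j assume i: "i \<in> I" and j: "j \<in> V - I"
    have K: "P i \<inter> P j \<in> sets borel" using ij[OF i j] Pb by auto
    have "(\<integral>x. ?\<kappa> i j x * (\<phi> x \<bullet> \<nu> i j) \<partial>?\<sigma> i j) \<le> (\<integral>x. ?\<kappa> i j x \<partial>?\<sigma> i j)"
    proof (rule integral_mono[OF int(1)[OF i j \<phi>] indint(1)[OF i j K subset_refl]])
      fix x show "?\<kappa> i j x * (\<phi> x \<bullet> \<nu> i j) \<le> ?\<kappa> i j x"
        using int(2)[OF i j \<phi>, of x] by (auto simp: indicator_def)
    qed
    then show "(\<integral>x. ?\<kappa> i j x * (\<phi> x \<bullet> \<nu> i j) \<partial>?\<sigma> i j) \<le> measure (?\<sigma> i j) (P i \<inter> P j)"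
      using indint(2)[OF i j K subset_refl] by simp
  qed
  have lower: "\<exists>\<phi>\<in>C1_compact_support \<Omega>. (\<forall>x. norm (\<phi> x) \<le> 1) \<and> S \<le> ?div \<phi> + e"
    if e: "e > 0" for e
  proof -
    define A where "A = I \<times> (V - I)"
    have fA: "finite A" using fI V by (simp add: A_def)
    \<comment> \<open>Each of the \<open>card A\<close> pairs will lose at most
      \<open>2 * d\<close>; the added 1 keeps the denominator positive when \<open>A\<close> is
      empty.\<close>
    define d where "d = e / (2 * (real (card A) + 1))"
    have d: "d > 0" using e by (simp add: d_def add_nonneg_pos)
    let ?C = "\<lambda>p C. compact C \<and> C \<subseteq> P (fst p) \<inter> P (snd p) \<inter> interior (P (fst p) \<union> P (snd p)) \<and>
        measure (?\<sigma> (fst p) (snd p)) (P (fst p) \<inter> P (snd p)) \<le> measure (?\<sigma> (fst p) (snd p)) C + d"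
    have "\<forall>p\<in>A. \<exists>C. ?C p C"
    proof
      fix p assume "p \<in> A"
      then have "fst p \<in> V" "snd p \<in> V" "fst p \<noteq> snd p" using V by (auto simp: A_def)
      then show "\<exists>C. ?C p C" by (intro interface_inner_compact P sep d)
    qed
    from bchoice[OF this] obtain C where CC: "\<forall>p\<in>A. ?C p (C p)" by (rule exE)
    note C = bspec[OF CC, THEN conjunct1] bspec[OF CC, THEN conjunct2, THEN conjunct1]
      bspec[OF CC, THEN conjunct2, THEN conjunct2]
    have disj_int: "interior (P k) \<inter> P i = {}" if "k \<in> V" "i \<in> V" "k \<noteq> i" for k i
    proof -
      have "\<nu> k i \<noteq> 0" using sep(1)[OF that] by auto
      moreover have "interior (P k) \<subseteq> interior {x. \<nu> k i \<bullet> x \<le> a k i}"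
        using sep(2)[OF that] by (intro interior_mono) (simp add: inner_commute)
      ultimately have "interior (P k) \<subseteq> {x. \<nu> k i \<bullet> x < a k i}" by (simp add: interior_halfspace_le)
      then show ?thesis using sep(3)[OF that] by (force simp: inner_commute)
    qed
    \<comment> \<open>A third cell is the closure of its interior. At a point interior to
      \<open>P i \<union> P j\<close> this interior would have to meet
      \<open>P i \<union> P j\<close>, which the separating hyperplanes forbid.\<close>
    have cell: "k = i \<or> k = j"
      if "k \<in> V" "i \<in> V" "j \<in> V" "y \<in> P k" "y \<in> interior (P i \<union> P j)" for k i j y
    proof (rule ccontr)
      assume "\<not> (k = i \<or> k = j)"
      then have "interior (P k) \<inter> (P i \<union> P j) = {}" using disj_int that by blast
      moreover have "y \<in> closure (interior (P k))"
        using convex_closure_interior[OF P(1,3)[OF that(1)]] closure_subset[of "P k"] that(4) by blast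
      then have "interior (P i \<union> P j) \<inter> interior (P k) \<noteq> {}"
        using that(5) open_Int_closure_eq_empty[OF open_interior, of "P i \<union> P j" "interior (P k)"] by blast
      ultimately show False using interior_subset[of "P i \<union> P j"] by blast
    qed
    \<comment> \<open>A common point would put both cells of \<open>q\<close> among those of
      \<open>p\<close>; membership in \<open>I\<close> then matches first with first and second with
      second.\<close>
    have Cdisj: "C p \<inter> C q = {}" if p: "p \<in> A" and q: "q \<in> A" and pq: "p \<noteq> q" for p q
    proof (rule ccontr)
      assume "C p \<inter> C q \<noteq> {}"
      then obtain y where y: "y \<in> C p" "y \<in> C q" by blast
      have yp: "y \<in> interior (P (fst p) \<union> P (snd p))" using C(2)[OF p] y by blast
      have yq: "y \<in> P (fst q)" "y \<in> P (snd q)" using C(2)[OF q] y by auto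
      have "fst p \<in> I" "snd p \<in> V" "snd p \<notin> I" "fst q \<in> I" "snd q \<in> V" "snd q \<notin> I" "fst p \<in> V" "fst q \<in> V"
        using p q V by (auto simp: A_def)
      then have "fst q = fst p" "snd q = snd p"
        using cell[of "fst q" "fst p" "snd p" y] cell[of "snd q" "fst p" "snd p" y] yp yq by auto
      with pq show False by (simp add: prod_eq_iff)
    qed
    have C\<Omega>: "C p \<subseteq> \<Omega>" if p: "p \<in> A" for p
    proof -
      have "P (fst p) \<union> P (snd p) \<subseteq> (\<Union>i\<in>V. P i)" using p V by (auto simp: A_def)
      then have "interior (P (fst p) \<union> P (snd p)) \<subseteq> interior (\<Union>i\<in>V. P i)" by (rule interior_mono)
      then show ?thesis using C(2)[OF p] \<Omega>(3) by blast
    qed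
    define u where "u p = \<nu> (fst p) (snd p)" for p
    have u1: "norm (u p) = 1" if "p \<in> A" for p
      using that V unfolding u_def A_def by (intro sep) auto
    obtain \<phi> where \<phi>: "\<phi> \<in> C1_compact_support \<Omega>" "\<forall>x. norm (\<phi> x) \<le> 1" "\<forall>p\<in>A. \<forall>x\<in>C p. \<phi> x = u p"
    proof (rule C1_field_prescribed_on_disjoint_compacts[OF fA, of C \<Omega> u])
      show "norm (u p) \<le> 1" if "p \<in> A" for p using u1[OF that] by simp
    qed (use C(1) C\<Omega> Cdisj \<Omega>(1) in \<open>auto\<close>)
    have flux_ge: "measure (?\<sigma> i j) (P i \<inter> P j) - 2 * d \<le> (\<integral>x. ?\<kappa> i j x * (\<phi> x \<bullet> \<nu> i j) \<partial>?\<sigma> i j)"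
      if i: "i \<in> I" and j: "j \<in> V - I" for i j
    proof -
      have p: "(i, j) \<in> A" using i j by (simp add: A_def)
      have K: "P i \<inter> P j \<in> sets borel" using ij[OF i j] Pb by auto
      have CK: "C (i, j) \<in> sets borel" "C (i, j) \<subseteq> P i \<inter> P j"
        using C(1)[OF p] C(2)[OF p] by (auto simp: compact_imp_closed)
      have nn: "\<nu> i j \<bullet> \<nu> i j = 1" using sep(1)[OF ij[OF i j]] by (simp add: norm_eq_1)
      \<comment> \<open>On the compact part the field is the normal and the integrand is 1; on the
        rest of the interface it is at least -1. A rest of measure at most \<open>d\<close>
        therefore costs at most \<open>2 * d\<close>.\<close>
      have "2 * measure (?\<sigma> i j) (C (i, j)) - measure (?\<sigma> i j) (P i \<inter> P j) =
          (\<integral>x. 2 * indicator (C (i, j)) x - ?\<kappa> i j x \<partial>?\<sigma> i j)"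
        using indint[OF i j K subset_refl] indint[OF i j CK] by simp
      also have "\<dots> \<le> (\<integral>x. ?\<kappa> i j x * (\<phi> x \<bullet> \<nu> i j) \<partial>?\<sigma> i j)"
      proof (rule integral_mono)
        show "integrable (?\<sigma> i j) (\<lambda>x. 2 * indicator (C (i, j)) x - ?\<kappa> i j x)"
          using indint(1)[OF i j K subset_refl] indint(1)[OF i j CK] by (intro Bochner_Integration.integrable_diff) auto
        show "integrable (?\<sigma> i j) (\<lambda>x. ?\<kappa> i j x * (\<phi> x \<bullet> \<nu> i j))"
          by (rule int(1)[OF i j \<phi>(1,2)])
        fix x
        show "2 * indicator (C (i, j)) x - ?\<kappa> i j x \<le> ?\<kappa> i j x * (\<phi> x \<bullet> \<nu> i j)"
        proof (cases "x \<in> C (i, j)")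
          case True
          then have "\<phi> x = \<nu> i j" using \<phi>(3) p by (auto simp: u_def)
          then show ?thesis using True CK(2) nn by (auto simp: indicator_def)
        next
          case False
          then show ?thesis using int(2)[OF i j \<phi>(1,2), of x] by (auto simp: indicator_def)
        qed
      qed
      finally show ?thesis using C(3)[OF p] by simp
    qed
    have "(\<Sum>i\<in>I. \<Sum>j\<in>V - I. measure (?\<sigma> i j) (P i \<inter> P j) - 2 * d) \<le> ?div \<phi>"
      unfolding flux[OF \<phi>(1)] by (intro sum_mono flux_ge)
    moreover have "(\<Sum>i\<in>I. \<Sum>j\<in>V - I. measure (?\<sigma> i j) (P i \<inter> P j) - 2 * d) = S - real (card A) * (2 * d)"
      by (simp add: S_def sum_subtractf A_def card_cartesian_product)
    moreover have "real (card A) * (2 * d) \<le> e"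
      using e by (simp add: d_def divide_le_eq)
    ultimately have "S \<le> ?div \<phi> + e" by linarith
    with \<phi> show ?thesis by blast
  qed
  show ?thesis
    unfolding perimeter_def S_def[symmetric]
  proof (rule antisym)
    show "(SUP \<phi>\<in>{\<phi> \<in> C1_compact_support \<Omega>. \<forall>x. norm (\<phi> x) \<le> 1}. ereal (?div \<phi>)) \<le> ereal S"
      using upper by (intro SUP_least) auto
    show "ereal S \<le> (SUP \<phi>\<in>{\<phi> \<in> C1_compact_support \<Omega>. \<forall>x. norm (\<phi> x) \<le> 1}. ereal (?div \<phi>))"
      (is "_ \<le> ?R")
    proof (rule ereal_le_epsilon2)
      fix e :: real assume "e > 0"
      then obtain \<phi> where \<phi>: "\<phi> \<in> C1_compact_support \<Omega>" "\<forall>x. norm (\<phi> x) \<le> 1"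
        "S \<le> ?div \<phi> + e" using lower by blast
      have "ereal S \<le> ereal (?div \<phi>) + ereal e" using \<phi>(3) by simp
      also have "\<dots> \<le> ?R + ereal e" using \<phi>(1,2) by (intro add_right_mono SUP_upper) auto
      finally show "ereal S \<le> ?R + ereal e" .
    qed
  qed
qed

section \<open>Triangulations and minimal cuts\<close>

lemma open_simplex_facts:
  fixes T :: "'a::euclidean_space set"
  assumes "open_simplex T"
  shows "open T" "convex T" "T \<noteq> {}" "convex (closure T)" "compact (closure T)" "interior (closure T) = T"
proof -
  obtain S where S: "int DIM('a) simplex S" "T = interior S"
    using assms by (auto simp: open_simplex_def)
  have cS: "convex S" "compact S" using S by (auto simp: convex_simplex compact_simplex)
  have "aff_dim S = int DIM('a)" using aff_dim_simplex[OF S(1)] .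
  then have T: "T = rel_interior S" using S(2) by (simp add: interior_rel_interior_gen)
  have "S \<noteq> {}" using \<open>aff_dim S = int DIM('a)\<close> by (metis aff_dim_empty of_nat_0_le_iff neg_0_le_iff_le not_one_le_zero)
  then show ne: "T \<noteq> {}" using T cS by (simp add: rel_interior_eq_empty)
  show "open T" "convex T" using S cS by (auto simp: convex_interior)
  have "closure T = S"
    using convex_closure_interior[OF cS(1)] ne S(2) cS(2) by (simp add: compact_imp_closed)
  then show "convex (closure T)" "compact (closure T)" "interior (closure T) = T" using cS S by auto
qed

text \<open>Meant for open simplices, whose closures may meet: the disjoint sets themselves are
  separated, and the closed half-spaces then contain the closures too.\<close>

lemma separating_unit_normal:
  fixes S T :: "'a::euclidean_space set"
  assumes "convex S" "convex T" "S \<noteq> {}" "T \<noteq> {}" "S \<inter> T = {}"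
  obtains \<nu> a where "norm \<nu> = 1" "closure S \<subseteq> {x. x \<bullet> \<nu> \<le> a}" "closure T \<subseteq> {x. x \<bullet> \<nu> \<ge> a}"
proof -
  obtain v c where v: "v \<noteq> 0" "\<forall>x\<in>S. v \<bullet> x \<le> c" "\<forall>x\<in>T. v \<bullet> x \<ge> c"
    using separating_hyperplane_sets[OF assms] by blast
  let ?\<nu> = "v /\<^sub>R norm v" and ?a = "c / norm v"
  have "S \<subseteq> {x. ?\<nu> \<bullet> x \<le> ?a}" "T \<subseteq> {x. ?\<nu> \<bullet> x \<ge> ?a}"
    using v by (auto simp: divide_inverse mult.commute intro!: mult_left_mono)
  then have "closure S \<subseteq> {x. ?\<nu> \<bullet> x \<le> ?a}" "closure T \<subseteq> {x. ?\<nu> \<bullet> x \<ge> ?a}"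
    by (simp_all only: closure_minimal closed_halfspace_le closed_halfspace_ge)
  then show ?thesis using v(1) by (intro that[of ?\<nu> ?a]) (simp_all add: inner_commute)
qed

text \<open>Near a boundary point the points strictly below the graph form an open set that misses
  \<Omega> and hence its closure. Moving from the boundary point against \<open>e\<close> enters
  this set at once, so the point is not interior to the closure; slits in \<Omega> are thereby ruled
  out.\<close>

lemma strongly_lipschitz_interior_closure:
  fixes \<Omega> :: "'a::euclidean_space set"
  assumes o: "open \<Omega>" and lip: "strongly_lipschitz_boundary \<Omega>"
  shows "interior (closure \<Omega>) \<subseteq> \<Omega>"
proof
  fix x assume x: "x \<in> interior (closure \<Omega>)"
  show "x \<in> \<Omega>"
  proof (rule ccontr)
    assume nx: "x \<notin> \<Omega>"
    then have "x \<in> frontier \<Omega>" using x interior_subset o by (auto simp: frontier_def interior_open)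
    then obtain r e L g where r: "r > 0" "norm e = 1" "L-lipschitz_on {z. z \<bullet> e = 0} g"
      and eq: "\<Omega> \<inter> ball x r = {y \<in> ball x r. y \<bullet> e > g (y - (y \<bullet> e) *\<^sub>R e)}"
      using lip unfolding strongly_lipschitz_boundary_def by blast
    have ee: "e \<bullet> e = 1" using r by (simp add: norm_eq_1)
    define pr where "pr y = y - (y \<bullet> e) *\<^sub>R e" for y
    have pr0: "pr y \<bullet> e = 0" for y by (simp add: pr_def inner_diff_left ee)
    obtain s where s: "s > 0" "ball x s \<subseteq> closure \<Omega>" using x mem_interior by blast
    define t where "t = min r s / 2"
    have t: "t > 0" "t < r" "t < s" using r s by (auto simp: t_def)
    define y where "y = x - t *\<^sub>R e"
    have "pr y = pr x" by (simp add: y_def pr_def inner_diff_left ee algebra_simps)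
    moreover have "x \<bullet> e \<le> g (pr x)"
    proof (rule ccontr)
      assume "\<not> x \<bullet> e \<le> g (pr x)"
      then have "x \<in> \<Omega> \<inter> ball x r" unfolding eq using r by (simp add: pr_def)
      with nx show False by simp
    qed
    moreover have "y \<bullet> e = x \<bullet> e - t" by (simp add: y_def inner_diff_left ee)
    ultimately have yW: "y \<bullet> e < g (pr y)" using t by simp
    have yb: "y \<in> ball x r" "y \<in> ball x s" using t r by (auto simp: y_def dist_norm)
    define W where "W = {z. z \<bullet> e < g (pr z)} \<inter> ball x r"
    have "continuous_on {z. z \<bullet> e = 0} g" using r(3) by (rule lipschitz_on_continuous_on)
    moreover have "continuous_on UNIV pr" unfolding pr_def by (intro continuous_intros)
    ultimately have "continuous_on UNIV (\<lambda>z. g (pr z))"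
      using pr0 by (intro continuous_on_compose2[of "{z. z \<bullet> e = 0}" g UNIV pr]) auto
    then have "open W" unfolding W_def by (intro open_Int open_Collect_less continuous_intros) auto
    have "W \<inter> \<Omega> = {}"
    proof (rule ccontr)
      assume "W \<inter> \<Omega> \<noteq> {}"
      then obtain z where "z \<in> W" "z \<in> \<Omega>" by blast
      then have z: "z \<in> \<Omega> \<inter> ball x r" "z \<bullet> e < g (pr z)" by (simp_all add: W_def)
      from z(1) have "z \<bullet> e > g (pr z)" unfolding eq by (simp add: pr_def)
      with z(2) show False by simp
    qed
    then have "W \<inter> closure \<Omega> = {}" using \<open>open W\<close> by (simp add: open_Int_closure_eq_empty)
    moreover have "y \<in> W" using yW yb by (simp add: W_def)
    ultimately show False using s(2) yb(2) by blast
  qed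
qed

text \<open>The function is prescribed on the open cells only. Its values on cell boundaries affect
  neither the integral nor measurability, because these boundaries are null and
  \<open>lebesgue\<close> is complete.\<close>

lemma piecewise_constant_integral:
  fixes T :: "nat \<Rightarrow> 'a::euclidean_space set" and p :: "'a \<Rightarrow> real"
  assumes T: "\<And>i. i \<in> V \<Longrightarrow> open_simplex (T i)" and disj: "disjoint_family_on T V" and fV: "finite V"
    and p: "\<And>i x. i \<in> V \<Longrightarrow> x \<in> T i \<Longrightarrow> p x = c i" and J: "J \<subseteq> V"
  shows "(LINT x:simplex_union T J|lebesgue. p x) = (\<Sum>i\<in>J. c i * measure lebesgue (T i))"
proof -
  have fJ: "finite J" using J fV finite_subset by auto
  let ?E = "simplex_union T J"
  let ?f = "\<lambda>x. \<Sum>i\<in>J. c i * indicator (T i) x"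
  have Tl: "T i \<in> lmeasurable" if "i \<in> J" for i
  proof -
    have iV: "i \<in> V" using that J by blast
    have "bounded (T i)"
      by (rule bounded_subset[OF compact_imp_bounded[OF open_simplex_facts(5)[OF T[OF iV]]] closure_subset])
    moreover have "open (T i)" by (rule open_simplex_facts(1)[OF T[OF iV]])
    ultimately show ?thesis by (rule lmeasurable_open)
  qed
  have fm: "?f \<in> borel_measurable lebesgue"
    using Tl by (intro borel_measurable_sum borel_measurable_times borel_measurable_indicator) auto
  have "AE x in lebesgue. \<forall>i\<in>J. x \<notin> frontier (closure (T i))"
    using AE_not_in_frontiers[OF fJ, of "\<lambda>i. closure (T i)"] open_simplex_facts(4)[OF T] J
    by (intro AE_completion) blast
  then have ae: "AE x in lebesgue. ?f x = indicator ?E x *\<^sub>R p x"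
  proof (rule eventually_mono)
    fix x assume x: "\<forall>i\<in>J. x \<notin> frontier (closure (T i))"
    show "?f x = indicator ?E x *\<^sub>R p x"
    proof (cases "x \<in> ?E")
      case True
      then obtain k where k: "k \<in> J" "x \<in> closure (T k)" using interior_subset unfolding simplex_union_def by blast
      then have kV: "k \<in> V" using J by blast
      have "x \<in> interior (closure (T k))" using x k by (auto simp: frontier_def)
      then have xT: "x \<in> T k" using open_simplex_facts(6)[OF T[OF kV]] by simp
      have "x \<notin> T i" if "i \<in> J" "i \<noteq> k" for i
        using disjoint_family_onD[OF disj, of i k] that kV xT J by blast
      then have "?f x = (\<Sum>i\<in>J. if i = k then c k else 0)"
        using xT by (intro sum.cong) auto
      also have "\<dots> = p x" using fJ k p[OF kV xT] by simp
      finally show ?thesis using True by simp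
    next
      case False
      have "x \<notin> T i" if "i \<in> J" for i
      proof
        assume "x \<in> T i"
        moreover have "T i \<subseteq> interior (\<Union>i\<in>J. closure (T i))"
        proof (rule interior_maximal)
          show "T i \<subseteq> (\<Union>i\<in>J. closure (T i))" using that closure_subset[of "T i"] by blast
          show "open (T i)" using open_simplex_facts(1)[OF T] that J by blast
        qed
        ultimately show False using False unfolding simplex_union_def by blast
      qed
      then show ?thesis using False by (simp add: sum.neutral)
    qed
  qed
  have "(LINT x:?E|lebesgue. p x) = (\<integral>x. ?f x \<partial>lebesgue)"
    unfolding set_lebesgue_integral_def
  proof (rule integral_cong_AE)
    show "(\<lambda>x. indicator ?E x *\<^sub>R p x) \<in> borel_measurable lebesgue"
      by (rule borel_measurable_AE[OF fm ae])
    show "AE x in lebesgue. indicator ?E x *\<^sub>R p x = ?f x" using ae by (rule eventually_mono) simp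
  qed (rule fm)
  also have "\<dots> = (\<Sum>i\<in>J. (\<integral>x. c i * indicator (T i) x \<partial>lebesgue))"
    using Tl by (intro Bochner_Integration.integral_sum integrable_mult_right integrable_real_indicator)
      (simp_all add: fmeasurable_def del: emeasure_completion)
  also have "\<dots> = (\<Sum>i\<in>J. c i * measure lebesgue (T i))"
    using Tl by (intro sum.cong) auto
  finally show ?thesis .
qed

theorem lemma4p5:
  fixes \<Omega> :: "'a::euclidean_space set"
    and n :: nat
    and T :: "nat \<Rightarrow> 'a set"
    and p :: "'a \<Rightarrow> real"
    and c :: "nat \<Rightarrow> real"
    and lam :: real
    and I :: "nat set"
  assumes "polyhedral_domain \<Omega>" and "bounded \<Omega>" and "strongly_lipschitz_boundary \<Omega>"
    and "domain_triangulation \<Omega> n T"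
    and "\<forall>i\<in>{1..n}. \<forall>x\<in>T i. p x = c i"
    and "(LINT x:\<Omega>|lebesgue. p x) = 0"
    and "lam \<ge> 0"
    and "I \<subseteq> {1..n}"
    and "minimal_cut n T lam c I"
  shows "is_arg_min (\<lambda>E. perimeter E \<Omega> - ereal (lam * (LINT x:E|lebesgue. p x)))
           (\<lambda>E. E \<in> simplicial_sets n T) (simplex_union T I)"
proof -
  let ?V = "{1..n}"
  have o\<Omega>: "open \<Omega>" using assms(1) by (simp add: polyhedral_domain_def)
  have T: "open_simplex (T i)" if "i \<in> ?V" for i using assms(4) that by (auto simp: domain_triangulation_def)
  have disj: "disjoint_family_on T ?V" and cl: "closure \<Omega> = (\<Union>i\<in>?V. closure (T i))"
    using assms(4) by (auto simp: domain_triangulation_def)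
  define P where "P i = closure (T i)" for i
  have P: "convex (P i)" "compact (P i)" "interior (P i) \<noteq> {}" if "i \<in> ?V" for i
    using open_simplex_facts[OF T[OF that]] by (auto simp: P_def)
  have TT: "T i \<inter> T j = {}" if "i \<in> ?V" "j \<in> ?V" "i \<noteq> j" for i j
    using disj that by (auto simp: disjoint_family_on_def)
  let ?sep = "\<lambda>i j \<nu>a. i \<in> ?V \<longrightarrow> j \<in> ?V \<longrightarrow> i \<noteq> j \<longrightarrow>
    norm (fst \<nu>a) = 1 \<and> P i \<subseteq> {x. x \<bullet> fst \<nu>a \<le> snd \<nu>a} \<and> P j \<subseteq> {x. x \<bullet> fst \<nu>a \<ge> snd \<nu>a}"
  have "\<forall>i j. \<exists>\<nu>a. ?sep i j \<nu>a"
  proof (intro allI)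
    fix i j
    show "\<exists>\<nu>a. ?sep i j \<nu>a"
    proof (cases "i \<in> ?V \<and> j \<in> ?V \<and> i \<noteq> j")
      case True
      then obtain \<nu> a where "norm \<nu> = 1" "P i \<subseteq> {x. x \<bullet> \<nu> \<le> a}" "P j \<subseteq> {x. x \<bullet> \<nu> \<ge> a}"
        using separating_unit_normal[OF open_simplex_facts(2)[OF T[of i]] open_simplex_facts(2)[OF T[of j]]
          open_simplex_facts(3)[OF T[of i]] open_simplex_facts(3)[OF T[of j]] TT[of i j]] unfolding P_def by blast
      then show ?thesis by (intro exI[of _ "(\<nu>, a)"]) simp
    qed blast
  qed
  \<comment> \<open>The hyperplanes for \<open>(i, j)\<close> and \<open>(j, i)\<close> are chosen
    independently. This is harmless, as each pair across a cut enters \<open>Per\<close> in one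
    order only.\<close>
  then obtain N where N: "\<And>i j. ?sep i j (N i j)" by metis
  define \<nu> where "\<nu> i j = fst (N i j)" for i j
  define a where "a i j = snd (N i j)" for i j
  have sep: "norm (\<nu> i j) = 1" "P i \<subseteq> {x. x \<bullet> \<nu> i j \<le> a i j}" "P j \<subseteq> {x. x \<bullet> \<nu> i j \<ge> a i j}"
    if "i \<in> ?V" "j \<in> ?V" "i \<noteq> j" for i j
    using N[of i j] that by (auto simp: \<nu>_def a_def)
  define Per where "Per J = (\<Sum>i\<in>J. \<Sum>j\<in>?V - J. measure (hyperplane_measure (\<nu> i j) (a i j)) (P i \<inter> P j))" for J
  define m where "m i = c i * measure lebesgue (T i)" for i
  \<comment> \<open>The value of the cut for the empty set, which cuts exactly the edges into the
    sink.\<close>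
  define A where "A = (\<Sum>i\<in>?V. max 0 (lam * m i))"
  have \<Omega>P: "\<Omega> \<subseteq> (\<Union>i\<in>?V. P i)" "interior (\<Union>i\<in>?V. P i) \<subseteq> \<Omega>"
    using cl closure_subset[of \<Omega>] strongly_lipschitz_interior_closure[OF o\<Omega> assms(3)] by (auto simp: P_def)
  have F: "perimeter (simplex_union T J) \<Omega> - ereal (lam * (LINT x:simplex_union T J|lebesgue. p x))
      = ereal (Per J - lam * (\<Sum>i\<in>J. m i))" if J: "J \<subseteq> ?V" for J
  proof -
    have "perimeter (simplex_union T J) \<Omega> = ereal (Per J)"
      using perimeter_union_of_cells[OF finite_atLeastAtMost J P sep o\<Omega> \<Omega>P]
      by (simp add: Per_def simplex_union_def P_def)
    moreover have "(LINT x:simplex_union T J|lebesgue. p x) = (\<Sum>i\<in>J. m i)"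
      unfolding m_def using assms(5) T disj J by (intro piecewise_constant_integral[of ?V]) auto
    ultimately show ?thesis by simp
  qed
  \<comment> \<open>Disjoint open cells also miss each other's closures, so their frontiers and
    their closures meet in the same set.\<close>
  have w: "st_weight T lam c (Node j) (Node i) =
      ennreal (measure (hyperplane_measure (\<nu> i j) (a i j)) (P i \<inter> P j))"
    if ij: "i \<in> ?V" "j \<in> ?V" "i \<noteq> j" for i j
  proof -
    have "T i \<inter> closure (T j) = {}" "T j \<inter> closure (T i) = {}"
      using TT[OF ij] open_simplex_facts(1)[OF T] ij by (auto simp: open_Int_closure_eq_empty)
    then have "frontier (T j) \<inter> frontier (T i) = P i \<inter> P j"
      using open_simplex_facts(1)[OF T] ij by (auto simp: frontier_def P_def interior_open)
    moreover have "compact (P i \<inter> P j)" using P ij by (simp add: compact_Int)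
    moreover have "P i \<inter> P j \<subseteq> {x. x \<bullet> \<nu> i j = a i j}" using sep(2,3)[OF ij] by force
    moreover have "emeasure (hyperplane_measure (\<nu> i j) (a i j)) (P i \<inter> P j) < \<infinity>"
      using \<open>compact (P i \<inter> P j)\<close> by (intro emeasure_hyperplane_measure_bounded sep(1)[OF ij] compact_imp_bounded)
    ultimately show ?thesis
      using hausdorff_measure_eq_hyperplane_measure[OF sep(1)[OF ij], of "P i \<inter> P j" "a i j"]
      by (simp add: emeasure_eq_ennreal_measure)
  qed
  have cut: "cut_value n T lam c J = ennreal (Per J - lam * (\<Sum>i\<in>J. m i) + A)"
    and cut_nonneg: "0 \<le> Per J - lam * (\<Sum>i\<in>J. m i) + A" if J: "J \<subseteq> ?V" for J
  proof -
    have fJ: "finite J" using J finite_subset by blast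
    have "(\<Sum>i\<in>?V - J. \<Sum>j\<in>J. st_weight T lam c (Node i) (Node j)) =
        (\<Sum>i\<in>J. \<Sum>j\<in>?V - J. st_weight T lam c (Node j) (Node i))" by (rule sum.swap)
    also have "\<dots> = (\<Sum>i\<in>J. \<Sum>j\<in>?V - J. ennreal (measure (hyperplane_measure (\<nu> i j) (a i j)) (P i \<inter> P j)))"
      using J by (intro sum.cong refl w) auto
    also have "\<dots> = ennreal (Per J)"
      unfolding Per_def by (simp add: sum_ennreal sum_nonneg)
    finally have 1: "(\<Sum>i\<in>?V - J. \<Sum>j\<in>J. st_weight T lam c (Node i) (Node j)) = ennreal (Per J)" .
    have 2: "(\<Sum>i\<in>J. st_weight T lam c Source (Node i)) = ennreal (\<Sum>i\<in>J. max 0 (- lam * m i))"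
      by (simp add: sum_ennreal m_def mult.assoc)
    have 3: "(\<Sum>i\<in>?V - J. st_weight T lam c (Node i) Sink) = ennreal (\<Sum>i\<in>?V - J. max 0 (lam * m i))"
      by (simp add: sum_ennreal m_def mult.assoc)
    have "A = (\<Sum>i\<in>?V - J. max 0 (lam * m i)) + (\<Sum>i\<in>J. max 0 (lam * m i))"
      unfolding A_def using J by (intro sum.subset_diff) auto
    \<comment> \<open>Termwise \<open>max 0 (- x) - max 0 x = - x\<close>: the source weights on
      \<open>J\<close>, minus the sink weights on \<open>J\<close> that are counted in
      \<open>A\<close>, leave the linear term of the energy.\<close>
    moreover have "(\<Sum>i\<in>J. max 0 (- lam * m i)) - (\<Sum>i\<in>J. max 0 (lam * m i)) = - (lam * (\<Sum>i\<in>J. m i))"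
      unfolding sum_subtractf[symmetric] sum_distrib_left sum_negf[symmetric]
      by (intro sum.cong) (auto simp: max_def)
    ultimately have eq: "Per J + (\<Sum>i\<in>J. max 0 (- lam * m i)) + (\<Sum>i\<in>?V - J. max 0 (lam * m i))
        = Per J - lam * (\<Sum>i\<in>J. m i) + A" by linarith
    have nn: "0 \<le> Per J" "0 \<le> (\<Sum>i\<in>J. max 0 (- lam * m i))" "0 \<le> (\<Sum>i\<in>?V - J. max 0 (lam * m i))"
      unfolding Per_def by (intro sum_nonneg; simp)+
    show "cut_value n T lam c J = ennreal (Per J - lam * (\<Sum>i\<in>J. m i) + A)"
      unfolding cut_value_def 1 2 3 eq[symmetric] using nn by (simp add: ennreal_plus)
    \<comment> \<open>\<open>ennreal\<close> sends every negative number to 0, so the comparison of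
      cut values descends to the reals only with this sign.\<close>
    show "0 \<le> Per J - lam * (\<Sum>i\<in>J. m i) + A" unfolding eq[symmetric] using nn by simp
  qed
  have min: "Per I - lam * (\<Sum>i\<in>I. m i) \<le> Per J - lam * (\<Sum>i\<in>J. m i)" if J: "J \<subseteq> ?V" for J
  proof -
    have "cut_value n T lam c I \<le> cut_value n T lam c J"
      using assms(9) J unfolding minimal_cut_def is_arg_min_linorder by blast
    then show ?thesis
      unfolding cut[OF assms(8)] cut[OF J] using cut_nonneg[OF J] by (simp add: ennreal_le_iff)
  qed
  show ?thesis
    unfolding is_arg_min_linorder
  proof (intro conjI allI impI)
    show "simplex_union T I \<in> simplicial_sets n T" using assms(8) by (auto simp: simplicial_sets_def)
    fix E assume "E \<in> simplicial_sets n T"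
    then obtain J where J: "J \<subseteq> ?V" "E = simplex_union T J" by (auto simp: simplicial_sets_def)
    show "perimeter (simplex_union T I) \<Omega> - ereal (lam * (LINT x:simplex_union T I|lebesgue. p x))
      \<le> perimeter E \<Omega> - ereal (lam * (LINT x:E|lebesgue. p x))"
      unfolding J(2) F[OF assms(8)] F[OF J(1)] using min[OF J(1)] by simp
  qed
qed

end
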